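(* The following decision problem is $\mathbf{NP}$-complete: given a $3$-regular graph $G$, decide whether $\sigma(G)=2$.
   Context: All graphs are finite and simple. For a graph $G$, a vertex labeling $c: V(G)\to\mathbb{N}$ is a sigma coloring of $G$ if for every two adjacent vertices $u,v$ of $G$ we have $\sum_{w\sim u} c(w)\neq \sum_{w\sim v} c(w)$, where $w\sim x$ means $w$ is adjacent to $x$. If $c$ uses exactly $k$ distinct labels, it is a $k$-labeling. The sigma chromatic number $\sigma(G)$ is the minimum number of distinct labels used by a sigma coloring of $G$. A graph is $3$-regular if every vertex has degree $3$. *)

theory Defs
  imports Complex_Main "HOL-Library.Nat_Bijection" "HOL-Computational_Algebra.Polynomial"
begin

section \<open>Sigma colorings of finite simple graphs\<close>

definition simple_graph :: "'a set \<Rightarrow> 'a set set \<Rightarrow> bool" where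
  "simple_graph V E \<longleftrightarrow> finite V \<and> (\<forall>e\<in>E. e \<subseteq> V \<and> card e = 2)"

definition nbhd :: "'a set \<Rightarrow> 'a set set \<Rightarrow> 'a \<Rightarrow> 'a set" where
  "nbhd V E v = {w \<in> V. {v, w} \<in> E}"

definition regular_graph :: "nat \<Rightarrow> 'a set \<Rightarrow> 'a set set \<Rightarrow> bool" where
  "regular_graph d V E \<longleftrightarrow> simple_graph V E \<and> (\<forall>v\<in>V. card (nbhd V E v) = d)"

definition sigma_coloring :: "'a set \<Rightarrow> 'a set set \<Rightarrow> ('a \<Rightarrow> nat) \<Rightarrow> bool" where
  "sigma_coloring V E c \<longleftrightarrow>
     (\<forall>u\<in>V. \<forall>v\<in>V. {u, v} \<in> E \<longrightarrow> (\<Sum>w\<in>nbhd V E u. c w) \<noteq> (\<Sum>w\<in>nbhd V E v. c w))"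

definition sigma_chromatic_number :: "'a set \<Rightarrow> 'a set set \<Rightarrow> nat" where
  "sigma_chromatic_number V E = (LEAST k. \<exists>c. sigma_coloring V E c \<and> card (c ` V) = k)"

text \<open>Every finite simple graph has a sigma coloring, so the minimum above is over a
  nonempty set: label the vertices by distinct powers of two; adjacent vertices have different
  neighbourhoods, hence different sums.\<close>

lemma sigma_coloring_exists:
  assumes "simple_graph V E"
  shows "\<exists>c. sigma_coloring V E c"
proof -
  have fin: "finite V" using assms by (simp add: simple_graph_def)
  obtain f :: "'a \<Rightarrow> nat" where f: "inj_on f V"
    using finite_imp_inj_to_nat_seg[OF fin] by blast
  define c where "c = (\<lambda>v. (2::nat) ^ f v)"
  have "(\<Sum>w\<in>nbhd V E u. c w) \<noteq> (\<Sum>w\<in>nbhd V E v. c w)"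
    if uv: "u \<in> V" "v \<in> V" "{u, v} \<in> E" for u v
  proof
    assume eq: "(\<Sum>w\<in>nbhd V E u. c w) = (\<Sum>w\<in>nbhd V E v. c w)"
    have sub: "nbhd V E x \<subseteq> V" for x by (auto simp: nbhd_def)
    have S: "(\<Sum>w\<in>nbhd V E x. c w) = (\<Sum>i\<in>f ` nbhd V E x. 2 ^ i)" for x
      by (subst sum.reindex) (auto simp: c_def intro: inj_on_subset[OF f sub])
    have "f ` nbhd V E u = f ` nbhd V E v"
      using eq finite_subset[OF sub fin] unfolding S set_encode_def[symmetric]
      by (simp add: set_encode_eq)
    then have "nbhd V E u = nbhd V E v"
      using inj_on_image_eq_iff[OF f sub sub] by blast
    moreover have "v \<in> nbhd V E u" using uv by (auto simp: nbhd_def)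
    moreover have "v \<notin> nbhd V E v" using assms by (force simp: nbhd_def simple_graph_def)
    ultimately show False by blast
  qed
  then show ?thesis unfolding sigma_coloring_def by blast
qed

section \<open>Deterministic multi-tape Turing machines\<close>

text \<open>
  States and tape symbols are natural numbers. Symbol 0 is the blank, and the input bits False
  and True are written as symbols 1 and 2. The start state is 0; the machine runs as long as its
  state is below \<open>num_states\<close>, and \<open>num_states\<close> itself is the halting state. The transition function
  maps the state and the list of scanned symbols (one per tape) to the new state and, for each
  tape, the symbol to be written and the head movement. Tapes are infinite in both directions.
\<close>

datatype move = Move_Left | Move_Stay | Move_Right

fun offset :: "move \<Rightarrow> int" where
  "offset Move_Left = -1"
| "offset Move_Stay = 0"
| "offset Move_Right = 1"

record tm =
  num_tapes :: nat
  num_states :: nat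
  num_symbols :: nat
  delta :: "nat \<Rightarrow> nat list \<Rightarrow> nat \<times> (nat \<times> move) list"

definition wf_tm :: "tm \<Rightarrow> bool" where
  "wf_tm M \<longleftrightarrow> num_tapes M \<ge> 1 \<and> num_symbols M \<ge> 3 \<and>
     (\<forall>q < num_states M. \<forall>ss. length ss = num_tapes M \<and> set ss \<subseteq> {..<num_symbols M} \<longrightarrow>
        (let (q', acts) = delta M q ss in
           q' \<le> num_states M \<and> length acts = num_tapes M \<and> fst ` set acts \<subseteq> {..<num_symbols M}))"

record config =
  state :: nat
  tape :: "nat \<Rightarrow> int \<Rightarrow> nat"
  head :: "nat \<Rightarrow> int"

definition halted :: "tm \<Rightarrow> config \<Rightarrow> bool" where
  "halted M C \<longleftrightarrow> state C \<ge> num_states M"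

definition step :: "tm \<Rightarrow> config \<Rightarrow> config" where
  "step M C = (if halted M C then C else
     (let (q', acts) = delta M (state C) (map (\<lambda>i. tape C i (head C i)) [0..<num_tapes M]) in
      \<lparr> state = q',
        tape = (\<lambda>i. if i < num_tapes M then (tape C i)(head C i := fst (acts ! i)) else tape C i),
        head = (\<lambda>i. if i < num_tapes M then head C i + offset (snd (acts ! i)) else head C i) \<rparr>))"

definition string_tape :: "bool list \<Rightarrow> int \<Rightarrow> nat" where
  "string_tape x j =
     (if 0 \<le> j \<and> j < int (length x) then (if x ! nat j then 2 else 1) else 0)"

text \<open>The \<open>i\<close>-th input string is written on tape \<open>i\<close>; all other tapes are blank.\<close>

definition init_config :: "bool list list \<Rightarrow> config" where
  "init_config xs =
     \<lparr> state = 0,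
       tape = (\<lambda>i. if i < length xs then string_tape (xs ! i) else (\<lambda>_. 0)),
       head = (\<lambda>_. 0) \<rparr>"

text \<open>The output is read on the last tape, from cell 0 to the cell before the first blank.
  Since \<open>step\<close> is the identity on halted configurations, halting within \<open>t\<close> steps means being
  halted after exactly \<open>t\<close> iterations.\<close>

definition outputs_within :: "tm \<Rightarrow> bool list list \<Rightarrow> nat \<Rightarrow> bool list \<Rightarrow> bool" where
  "outputs_within M xs t y \<longleftrightarrow>
     (let C = (step M ^^ t) (init_config xs) in
        halted M C \<and>
        (\<forall>j \<in> {0..int (length y)}. tape C (num_tapes M - 1) j = string_tape y j))"

section \<open>Polynomial time, NP and NP-completeness\<close>

definition polytime_function :: "(bool list \<Rightarrow> bool list) \<Rightarrow> bool" where
  "polytime_function f \<longleftrightarrow>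
     (\<exists>M (p :: nat poly). wf_tm M \<and>
        (\<forall>x. outputs_within M [x] (poly p (length x)) (f x)))"

definition polytime_relation :: "(bool list \<Rightarrow> bool list \<Rightarrow> bool) \<Rightarrow> bool" where
  "polytime_relation R \<longleftrightarrow>
     (\<exists>M (p :: nat poly). wf_tm M \<and> num_tapes M \<ge> 2 \<and>
        (\<forall>x y. outputs_within M [x, y] (poly p (length x + length y)) [R x y]))"

definition NP :: "bool list set set" where
  "NP = {L. \<exists>R (p :: nat poly). polytime_relation R \<and>
           (\<forall>x. x \<in> L \<longleftrightarrow> (\<exists>y. length y \<le> poly p (length x) \<and> R x y))}"

definition polytime_reducible :: "bool list set \<Rightarrow> bool list set \<Rightarrow> bool" (infix "\<le>\<^sub>p" 50) where
  "L \<le>\<^sub>p L' \<longleftrightarrow> (\<exists>f. polytime_function f \<and> (\<forall>x. x \<in> L \<longleftrightarrow> f x \<in> L'))"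

definition NP_complete :: "bool list set \<Rightarrow> bool" where
  "NP_complete L \<longleftrightarrow> L \<in> NP \<and> (\<forall>L' \<in> NP. L' \<le>\<^sub>p L)"

section \<open>The decision problem\<close>

text \<open>A graph with vertex set \<open>{0, \<dots>, n - 1}\<close> is presented to a machine as its adjacency matrix,
  row by row.\<close>

definition adj_matrix :: "nat \<Rightarrow> nat set set \<Rightarrow> bool list" where
  "adj_matrix n E = concat (map (\<lambda>i. map (\<lambda>j. {i, j} \<in> E) [0..<n]) [0..<n])"

lemma adj_matrix_inj:
  assumes "simple_graph {..<n} E" "simple_graph {..<n'} E'" "adj_matrix n E = adj_matrix n' E'"
  shows "n = n' \<and> E = E'"
proof -
  have len: "length (adj_matrix m F) = m * m" for m F
    by (simp add: adj_matrix_def length_concat comp_def sum_list_triv)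
  have n: "n = n'" using arg_cong[OF assms(3), of length]
    by (simp add: len) (metis nat_mult_eq_cancel1 power2_eq_square power2_eq_imp_eq zero_le)
  have "map (\<lambda>i. map (\<lambda>j. {i, j} \<in> E) [0..<n]) [0..<n] = map (\<lambda>i. map (\<lambda>j. {i, j} \<in> E') [0..<n]) [0..<n]"
    using assms(3) unfolding n[symmetric] adj_matrix_def
    by (subst (asm) concat_eq_concat_iff) (auto simp: set_zip)
  then have iff: "{i, j} \<in> E \<longleftrightarrow> {i, j} \<in> E'" if "i < n" "j < n" for i j
    using that by (simp add: list_eq_iff_nth_eq)
  have "e \<in> E \<longleftrightarrow> e \<in> E'" for e
  proof (cases "\<exists>i<n. \<exists>j<n. e = {i, j}")
    case True then show ?thesis using iff by blast
  next
    case False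
    then have "\<not> (e \<subseteq> {..<n} \<and> card e = 2)" by (auto simp: card_2_iff)
    then show ?thesis using assms(1,2) n by (auto simp: simple_graph_def)
  qed
  then show ?thesis using n by blast
qed

definition CUBIC_SIGMA_2 :: "bool list set" where
  "CUBIC_SIGMA_2 = {adj_matrix n E | n E.
     regular_graph 3 {..<n} E \<and> sigma_chromatic_number {..<n} E = 2}"

end

theory Submission imports Defs begin

text \<open>
  Polynomial time is established through counters. A machine that only reads its tapes, apart from
  appending to an output tape, is a program whose variables are the head positions, and such a
  program evaluates in polynomial time every arithmetic expression built from addition, truncated
  subtraction, bounded sums, and access to the input bits. So the verifier for membership in NP and
  the reduction only have to be given by expressions of this kind: the reduction outputs the
  adjacency matrix entry by entry.

  For hardness, the run of a verifier on an input and an unknown certificate is described by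
  implications between facts of the form ``at time \<open>t\<close> cell \<open>p\<close> holds \<open>s\<close>''; since the machine is
  deterministic, these force all facts that are true of the run, and no uniqueness clauses are
  needed. The resulting 3-clauses become monotone not-all-equal clauses, and these become a cubic graph. In
  a cubic graph two labels may be taken to be truth values, and adjacent vertices must have
  different numbers of true neighbours. Then the two vertices attached to the ends of a diamond
  (\<open>K\<^sub>4\<close> minus an edge) carry the same value, so that rings of diamonds transport a value, and the
  three outer neighbours of a triangle are not all equal. Conversely, all these constraints can be met.
\<close>

section \<open>Counter programs on Turing machines\<close>

text \<open>No size of a constructed object is ever estimated: whatever the expression, its value is
  bounded by a polynomial in the input length. So every construction may be wasteful, and each is
  chosen such that an entry can be computed from its index alone. The number of a clause is the code
  of all its parameters, and numbers that describe no clause get a tautology. Every variable owns a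
  hub for every slot, so that a vertex number is arithmetic in variable, slot and role, and
  occurrences of a variable need not be counted. What constrains the clauses is their width: a
  transition depends on the state and on the symbols of all tapes, too much for three literals, so
  these entries are first folded into one number, one entry per clause. Apart from tautologies, only
  two kinds of clauses are not implications with a positive conclusion: a certificate cell holds
  some symbol, and the final answer is not negative. The latter contradicts a forced fact whenever
  the run rejects.\<close>

datatype com = SKIP | INC nat | DEC nat | OUT bool | SEQ com com
  | IFS nat "nat set" com com | WHILE nat "nat set" com

type_synonym cstate = "(nat \<Rightarrow> nat) \<times> bool list"

text \<open>\<open>A r p\<close> is the symbol in cell \<open>p\<close> of tape \<open>r\<close>.
  Tests look at a scanned symbol and not at a number, which treats input tapes and counters alike.
  The additional step in \<open>big_SEQ\<close> and \<open>big_WT\<close> pays for discarding a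
  finished \<open>SKIP\<close>, a transition of its own.\<close>

inductive big :: "(nat \<Rightarrow> nat \<Rightarrow> nat) \<Rightarrow> com \<Rightarrow> cstate \<Rightarrow> nat \<Rightarrow> cstate \<Rightarrow> bool"
  for A where
  big_SKIP: "big A SKIP s 0 s"
| big_INC: "big A (INC r) (s, w) 1 (s(r := s r + 1), w)"
| big_DEC: "s r > 0 \<Longrightarrow> big A (DEC r) (s, w) 1 (s(r := s r - 1), w)"
| big_OUT: "big A (OUT b) (s, w) 1 (s, w @ [b])"
| big_SEQ: "big A c1 s t1 s1 \<Longrightarrow> big A c2 s1 t2 s2 \<Longrightarrow> big A (SEQ c1 c2) s (t1 + 1 + t2) s2"
| big_IFT: "A r (fst s r) \<in> S \<Longrightarrow> big A c1 s t s' \<Longrightarrow> big A (IFS r S c1 c2) s (1 + t) s'"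
| big_IFF: "A r (fst s r) \<notin> S \<Longrightarrow> big A c2 s t s' \<Longrightarrow> big A (IFS r S c1 c2) s (1 + t) s'"
| big_WT: "A r (fst s r) \<in> S \<Longrightarrow> big A c s t1 s1 \<Longrightarrow> big A (WHILE r S c) s1 t2 s2 \<Longrightarrow>
     big A (WHILE r S c) s (1 + (t1 + 1 + t2)) s2"
| big_WF: "A r (fst s r) \<notin> S \<Longrightarrow> big A (WHILE r S c) s 1 s"

fun regs :: "com \<Rightarrow> nat set" where
  "regs SKIP = {}"
| "regs (INC r) = {r}"
| "regs (DEC r) = {r}"
| "regs (OUT b) = {}"
| "regs (SEQ c1 c2) = regs c1 \<union> regs c2"
| "regs (IFS r S c1 c2) = insert r (regs c1 \<union> regs c2)"
| "regs (WHILE r S c) = insert r (regs c)"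

lemma finite_regs: "finite (regs c)"
  by (induction c) auto

text \<open>A step is split into control and data: the next command depends only on the scanned
  symbols, the change of the data only on the \<open>active\<close> command. This is the shape of a
  machine transition.\<close>

fun nxt :: "(nat \<Rightarrow> nat) \<Rightarrow> com \<Rightarrow> com" where
  "nxt \<sigma> (SEQ c1 c2) = (if c1 = SKIP then c2 else SEQ (nxt \<sigma> c1) c2)"
| "nxt \<sigma> (IFS r S c1 c2) = (if \<sigma> r \<in> S then c1 else c2)"
| "nxt \<sigma> (WHILE r S c) = (if \<sigma> r \<in> S then SEQ c (WHILE r S c) else SKIP)"
| "nxt \<sigma> _ = SKIP"

fun active :: "com \<Rightarrow> com" where
  "active (SEQ c1 c2) = active c1"
| "active (IFS r S c1 c2) = SKIP"
| "active (WHILE r S c) = SKIP"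
| "active c = c"

fun effect :: "com \<Rightarrow> cstate \<Rightarrow> cstate" where
  "effect (INC r) (s, w) = (s(r := s r + 1), w)"
| "effect (DEC r) (s, w) = (s(r := s r - 1), w)"
| "effect (OUT b) (s, w) = (s, w @ [b])"
| "effect _ s = s"

definition small :: "(nat \<Rightarrow> nat \<Rightarrow> nat) \<Rightarrow> com \<times> cstate \<Rightarrow> com \<times> cstate \<Rightarrow> bool" where
  "small A = (\<lambda>(c, s) (c', s'). c \<noteq> SKIP \<and> (\<forall>r. active c = DEC r \<longrightarrow> fst s r > 0) \<and>
     c' = nxt (\<lambda>r. A r (fst s r)) c \<and> s' = effect (active c) s)"

lemma small_SEQ:
  assumes "(small A ^^ t) (c1, s) (c1', s')"
  shows "(small A ^^ t) (SEQ c1 c2, s) (SEQ c1' c2, s')"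
  using assms
proof (induction t arbitrary: c1' s')
  case (Suc t)
  then obtain c s1 where 1: "(small A ^^ t) (c1, s) (c, s1)" and 2: "small A (c, s1) (c1', s')"
    by auto
  from 2 have "small A (SEQ c c2, s1) (SEQ c1' c2, s')"
    by (auto simp: small_def)
  with Suc.IH[OF 1] show ?case by auto
qed auto

lemma relpowp_add_trans: "(R ^^ m) x y \<Longrightarrow> (R ^^ n) y z \<Longrightarrow> (R ^^ (m + n)) x z"
  for R :: "'a \<Rightarrow> 'a \<Rightarrow> bool"
  by (auto simp: relpowp_add)

lemma small_first: "R x y \<Longrightarrow> (R ^^ n) y z \<Longrightarrow> (R ^^ (1 + n)) x z"
  for R :: "'a \<Rightarrow> 'a \<Rightarrow> bool"
  by (rule relpowp_add_trans[of 1]) (auto simp: OO_def)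

lemma big_imp_small: "big A c s t s' \<Longrightarrow> (small A ^^ t) (c, s) (SKIP, s')"
proof (induction rule: big.induct)
  case (big_SEQ c1 s t1 s1 c2 t2 s2)
  have "(small A ^^ 1) (SEQ SKIP c2, s1) (c2, s1)"
    by (auto simp: small_def OO_def)
  from relpowp_add_trans[OF relpowp_add_trans[OF small_SEQ[OF big_SEQ.IH(1)] this] big_SEQ.IH(2)]
  show ?case .
next
  case (big_IFT r s S c1 t s' c2)
  then show ?case by (intro small_first) (auto simp: small_def)
next
  case (big_IFF r s S c2 t s' c1)
  then show ?case by (intro small_first) (auto simp: small_def)
next
  case (big_WT r s S c t1 s1 t2 s2)
  let ?w = "WHILE r S c"
  have "(small A ^^ 1) (SEQ SKIP ?w, s1) (?w, s1)"
    by (auto simp: small_def OO_def)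
  from relpowp_add_trans[OF relpowp_add_trans[OF small_SEQ[OF big_WT.IH(1)] this] big_WT.IH(2)]
  show ?case by (rule small_first[rotated]) (use big_WT.hyps in \<open>auto simp: small_def\<close>)
qed (auto simp: small_def)

text \<open>The finite control: all commands that can remain during a run. Unfolding a loop only
  yields \<open>SEQ d (WHILE r S c)\<close> with \<open>d\<close> a continuation of the body, so the
  set stays finite.\<close>

fun conts :: "com \<Rightarrow> com set" where
  "conts (SEQ c1 c2) = (\<lambda>d. SEQ d c2) ` conts c1 \<union> conts c2"
| "conts (IFS r S c1 c2) = insert (IFS r S c1 c2) (conts c1 \<union> conts c2)"
| "conts (WHILE r S c) = {WHILE r S c, SKIP} \<union> (\<lambda>d. SEQ d (WHILE r S c)) ` conts c"
| "conts c = {c, SKIP}"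

lemma finite_conts: "finite (conts c)"
  by (induction c) auto

lemma self_in_conts: "c \<in> conts c"
  by (induction c) auto

lemma SKIP_in_conts: "SKIP \<in> conts c"
  by (induction c) auto

lemma nxt_in_conts: "d \<in> conts c \<Longrightarrow> nxt \<sigma> d \<in> conts c"
  by (induction c arbitrary: d) (auto simp: self_in_conts SKIP_in_conts split: if_splits)

lemma regs_conts: "d \<in> conts c \<Longrightarrow> regs d \<subseteq> regs c"
  by (induction c arbitrary: d) (auto, blast+)

lemma regs_active: "regs (active d) \<subseteq> regs d"
  by (induction d) auto

lemma active_cases: "active d = SKIP \<or> (\<exists>r. active d = INC r) \<or> (\<exists>r. active d = DEC r) \<or> (\<exists>b. active d = OUT b)"
  by (induction d) auto

lemma nxt_cong: "(\<And>r. r \<in> regs d \<Longrightarrow> \<sigma> r = \<tau> r) \<Longrightarrow> nxt \<sigma> d = nxt \<tau> d"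
  by (induction d) auto

section \<open>Simulation of counter programs by Turing machines\<close>

text \<open>Counter tapes carry the symbol 1 on cell 0 and blanks elsewhere, so that the head position
  is the value of the counter and the scanned symbol tests it for zero.\<close>

definition cells :: "bool list list \<Rightarrow> nat \<Rightarrow> nat \<Rightarrow> nat" where
  "cells xs i j = (if i < length xs then string_tape (xs ! i) (int j) else if j = 0 then 1 else 0)"

fun reg_move :: "com \<Rightarrow> nat \<Rightarrow> move" where
  "reg_move (INC r) i = (if i = r then Move_Right else Move_Stay)"
| "reg_move (DEC r) i = (if i = r then Move_Left else Move_Stay)"
| "reg_move _ i = Move_Stay"

fun out_action :: "com \<Rightarrow> nat \<Rightarrow> nat \<times> move" where
  "out_action (OUT b) a = (if b then 2 else 1, Move_Right)"
| "out_action _ a = (a, Move_Stay)"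

lemma string_tape_snoc: "string_tape (w @ [b]) = (string_tape w)(int (length w) := if b then 2 else 1)"
proof
  fix j :: int
  show "string_tape (w @ [b]) j = ((string_tape w)(int (length w) := if b then 2 else 1)) j"
  proof (cases "0 \<le> j \<and> j < int (length w)")
    case True
    then have "nat j < length w" by linarith
    with True show ?thesis by (auto simp: string_tape_def nth_append)
  qed (auto simp: string_tape_def nth_append)
qed

lemma halted_funpow: "halted M C \<Longrightarrow> (step M ^^ t) C = C"
  by (induction t) (auto simp: step_def)

lemma outputs_within_mono:
  assumes "outputs_within M xs t y" "t \<le> t'"
  shows "outputs_within M xs t' y"
proof -
  have "(step M ^^ t') (init_config xs) = (step M ^^ (t' - t)) ((step M ^^ t) (init_config xs))"
    using assms(2) by (metis add.commute comp_apply funpow_add le_add_diff_inverse)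
  with assms(1) show ?thesis
    by (simp add: outputs_within_def Let_def halted_funpow)
qed

text \<open>The continuations become the states, with \<open>SKIP\<close> as the halting state.
  State 0 is spent on writing the marks on cell 0 of the counter tapes, hence \<open>Suc t\<close>.
  Tape \<open>n\<close> is the output tape; \<open>l \<le> n\<close> keeps it apart from the
  inputs.\<close>

lemma com_machine:
  assumes reg: "regs c \<subseteq> {..<n}" and n: "1 \<le> l" "l \<le> n"
  obtains M where "wf_tm M" "num_tapes M = Suc n"
    "\<And>xs t s w. length xs = l \<Longrightarrow> big (cells xs) c (\<lambda>_. 0, []) t (s, w) \<Longrightarrow>
       outputs_within M xs (Suc t) w"
proof -
  define D where "D = conts c - {SKIP}"
  define K where "K = card D"
  have finD: "finite D" by (simp add: D_def finite_conts)
  obtain f where f: "bij_betw f D {..<K}"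
    using ex_bij_betw_finite_nat[OF finD] unfolding K_def lessThan_atLeast0 by blast
  define idx where "idx = (\<lambda>d. if d = SKIP then Suc K else Suc (f d))"
  define dec where "dec = (\<lambda>q. inv_into D f (q - 1))"
  have dec: "dec q \<in> D" if "0 < q" "q < Suc K" for q
    unfolding dec_def using that f by (intro inv_into_into) (auto simp: bij_betw_def)
  have dec_idx: "dec (idx d) = d" if "d \<in> D" for d
    using that f by (auto simp: dec_def idx_def bij_betw_def D_def)
  have fK: "f d < K" if "d \<in> D" for d
    using f that by (auto simp: bij_betw_def)
  have idx_le: "idx d \<le> Suc K" if "d \<in> conts c" for d
    using that fK[of d] by (auto simp: idx_def D_def)
  have idx_less: "0 < idx d" "idx d < Suc K" if "d \<in> D" for d
    using that fK[of d] by (auto simp: idx_def D_def)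
  define M where "M = \<lparr> num_tapes = Suc n, num_states = Suc K, num_symbols = 3,
     delta = (\<lambda>q ss. if q = 0
        then (idx c, map (\<lambda>i. (if l \<le> i \<and> i < n then 1 else ss ! i, Move_Stay)) [0..<Suc n])
        else (idx (nxt (\<lambda>r. ss ! r) (dec q)),
          map (\<lambda>i. if i < n then (ss ! i, reg_move (active (dec q)) i)
                   else out_action (active (dec q)) (ss ! i)) [0..<Suc n])) \<rparr>"
  have [simp]: "num_tapes M = Suc n" "num_states M = Suc K" "num_symbols M = 3"
    by (simp_all add: M_def)
  have out3: "fst (out_action a b) < 3" if "b < 3" for a b
    using that by (cases a) auto
  have "wf_tm M"
    unfolding wf_tm_def
  proof (intro conjI allI impI)
    fix q ss assume q: "q < num_states M"
      and ss: "length ss = num_tapes M \<and> set ss \<subseteq> {..<num_symbols M}"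
    have s3: "ss ! i < 3" if "i < Suc n" for i
    proof -
      have "ss ! i \<in> set ss" using ss that by simp
      then show ?thesis using ss by auto
    qed
    show "let (q', acts) = delta M q ss in
           q' \<le> num_states M \<and> length acts = num_tapes M \<and> fst ` set acts \<subseteq> {..<num_symbols M}"
    proof (cases "q = 0")
      case True
      then show ?thesis using s3 idx_le[OF self_in_conts]
        by (auto simp: M_def simp del: upt_Suc)
    next
      case False
      then have "dec q \<in> conts c" using dec[of q] q by (auto simp: D_def)
      from idx_le[OF nxt_in_conts[OF this]] False show ?thesis
        using s3 out3 by (auto simp: M_def simp del: upt_Suc)
    qed
  qed simp_all
  moreover have "outputs_within M xs (Suc t) w"
    if xs: "length xs = l" and b: "big (cells xs) c (\<lambda>_. 0, []) t (s, w)" for xs t s w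
  proof -
    \<comment> \<open>Only cells from 0 on are described. This suffices because \<open>small\<close>
      excludes \<open>DEC\<close> at 0, so that no head moves to the left of cell 0.\<close>
    define rel where "rel = (\<lambda>(d, s, w) (C :: config). state C = idx d \<and> d \<in> conts c \<and>
      (\<forall>i<n. head C i = int (s i) \<and> (\<forall>j. tape C i (int j) = cells xs i j)) \<and>
      tape C n = string_tape w \<and> head C n = int (length w))"
    have init: "rel (c, (\<lambda>_. 0), []) (step M (init_config xs))"
      using xs n self_in_conts[of c]
      by (auto simp: rel_def step_def halted_def init_config_def M_def cells_def string_tape_def
          simp del: upt_Suc)
    have sim: "rel (d', s', w') (step M C)"
      if r: "rel (d, s, w) C" and sm: "small (cells xs) (d, s, w) (d', s', w')" for d s w d' s' w' C
    proof -
      have dD: "d \<in> D" and dc: "d \<in> conts c" using r sm by (auto simp: rel_def small_def D_def)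
      have rd: "regs d \<subseteq> {..<n}" using regs_conts[OF dc] reg by auto
      have ra: "regs (active d) \<subseteq> {..<n}" using regs_active[of d] rd by auto
      have st: "state C = idx d" using r by (simp add: rel_def)
      have nx: "nxt (\<lambda>r. map (\<lambda>i. tape C i (head C i)) [0..<Suc n] ! r) d
          = nxt (\<lambda>r. cells xs r (s r)) d"
      proof (rule nxt_cong)
        fix r' assume "r' \<in> regs d"
        then have "r' < n" using rd by auto
        then show "map (\<lambda>i. tape C i (head C i)) [0..<Suc n] ! r' = cells xs r' (s r')"
          using r by (simp add: rel_def nth_append)
      qed
      have d': "d' = nxt (\<lambda>r. cells xs r (s r)) d" "(s', w') = effect (active d) (s, w)"
        and pos: "\<And>r. active d = DEC r \<Longrightarrow> s r > 0"
        using sm by (auto simp: small_def)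
      have nh: "\<not> halted M C" using idx_less[OF dD] st by (simp add: halted_def)
      have step: "step M C = \<lparr> state = idx d',
        tape = (\<lambda>i. if i < Suc n then (tape C i)(head C i := if i < n then tape C i (head C i)
            else fst (out_action (active d) (tape C i (head C i)))) else tape C i),
        head = (\<lambda>i. if i < Suc n then head C i + offset (if i < n then reg_move (active d) i
            else snd (out_action (active d) (tape C i (head C i)))) else head C i) \<rparr>"
      proof -
        have "state C \<noteq> 0" using idx_less[OF dD] st by simp
        then have "delta M (state C) (map (\<lambda>i. tape C i (head C i)) [0..<Suc n]) =
          (idx d', map (\<lambda>i. if i < n then (tape C i (head C i), reg_move (active d) i)
                   else out_action (active d) (tape C i (head C i))) [0..<Suc n])"
          using nx dec_idx[OF dD] unfolding M_def d'(1) st by (auto simp del: upt_Suc)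
        then show ?thesis using nh
          by (auto simp: step_def fun_eq_iff simp del: upt_Suc)
      qed
      have "d' \<in> conts c" unfolding d'(1) by (rule nxt_in_conts[OF dc])
      moreover have "(\<forall>i<n. head (step M C) i = int (s' i) \<and> (\<forall>j. tape (step M C) i (int j) = cells xs i j)) \<and>
        tape (step M C) n = string_tape w' \<and> head (step M C) n = int (length w')"
        using r d'(2) active_cases[of d] pos ra unfolding step
        by (elim disjE exE) (auto simp: rel_def string_tape_snoc fun_eq_iff of_nat_diff Suc_leI)
      ultimately show ?thesis unfolding rel_def using step by auto
    qed
    have "rel (d', s', w') ((step M ^^ t) C)"
      if "(small (cells xs) ^^ t) (d, s, w) (d', s', w')" "rel (d, s, w) C" for t d s w d' s' w' C
      using that
    proof (induction t arbitrary: d' s' w')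
      case (Suc t)
      then obtain e where 1: "(small (cells xs) ^^ t) (d, s, w) e" and 2: "small (cells xs) e (d', s', w')"
        by auto
      obtain d1 s1 w1 where e: "e = (d1, s1, w1)" by (cases e)
      from sim[OF Suc.IH[OF 1[unfolded e] Suc.prems(2)] 2[unfolded e]] show ?case by simp
    qed auto
    from this[OF big_imp_small[OF b] init]
    have "rel (SKIP, s, w) ((step M ^^ Suc t) (init_config xs))"
      by (simp only: funpow_Suc_right comp_apply)
    then show ?thesis
      by (auto simp: outputs_within_def rel_def halted_def idx_def Let_def simp del: funpow.simps)
  qed
  ultimately show ?thesis using that[of M] by simp
qed

section \<open>Arithmetic expressions in polynomial time\<close>

definition exec :: "(nat \<Rightarrow> nat \<Rightarrow> nat) \<Rightarrow> com \<Rightarrow> cstate \<Rightarrow> nat \<Rightarrow> cstate \<Rightarrow> bool" where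
  "exec A c s t s' \<longleftrightarrow> (\<exists>t0\<le>t. big A c s t0 s')"

lemma exec_mono: "exec A c s t s' \<Longrightarrow> t \<le> t' \<Longrightarrow> exec A c s t' s'"
  by (auto simp: exec_def intro: order_trans)

lemma exec_SKIP: "s = s' \<Longrightarrow> exec A SKIP s t s'"
  using big_SKIP[of A s] by (auto simp: exec_def)

lemma exec_INC: "s' = s(r := Suc (s r)) \<Longrightarrow> exec A (INC r) (s, w) 1 (s', w)"
  using big_INC[of A r s w] by (auto simp: exec_def)

lemma exec_DEC: "s r > 0 \<Longrightarrow> s' = s(r := s r - 1) \<Longrightarrow> exec A (DEC r) (s, w) 1 (s', w)"
  using big_DEC[of s r A w] by (auto simp: exec_def)

lemma exec_OUT: "exec A (OUT b) (s, w) 1 (s, w @ [b])"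
  using big_OUT[of A b s w] by (auto simp: exec_def)

lemma exec_SEQ:
  assumes "exec A c1 s t1 s1" "exec A c2 s1 t2 s2"
  shows "exec A (SEQ c1 c2) s (t1 + 1 + t2) s2"
proof -
  obtain u1 u2 where "u1 \<le> t1" "u2 \<le> t2" "big A c1 s u1 s1" "big A c2 s1 u2 s2"
    using assms by (auto simp: exec_def)
  then show ?thesis
    using big_SEQ[of A c1 s u1 s1 c2 u2 s2] unfolding exec_def by (intro exI[of _ "u1 + 1 + u2"]) auto
qed

lemma exec_IFS:
  assumes "A r (fst s r) \<in> S \<Longrightarrow> exec A c1 s t s'" "A r (fst s r) \<notin> S \<Longrightarrow> exec A c2 s t s'"
  shows "exec A (IFS r S c1 c2) s (Suc t) s'"
proof (cases "A r (fst s r) \<in> S")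
  case True
  then obtain u where u: "u \<le> t" "big A c1 s u s'" using assms by (auto simp: exec_def)
  from big_IFT[OF True u(2)] u(1) show ?thesis unfolding exec_def by (intro exI[of _ "1 + u"]) auto
next
  case False
  then obtain u where u: "u \<le> t" "big A c2 s u s'" using assms by (auto simp: exec_def)
  from big_IFF[OF False u(2)] u(1) show ?thesis unfolding exec_def by (intro exI[of _ "1 + u"]) auto
qed

lemma exec_WHILE:
  assumes "\<And>k. k < n \<Longrightarrow> A r (fst (\<sigma> k) r) \<in> S" "A r (fst (\<sigma> n) r) \<notin> S"
    "\<And>k. k < n \<Longrightarrow> exec A c (\<sigma> k) b (\<sigma> (Suc k))"
  shows "exec A (WHILE r S c) (\<sigma> 0) (n * (b + 2) + 1) (\<sigma> n)"
  using assms
proof (induction n arbitrary: \<sigma>)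
  case 0
  then show ?case using big_WF[of A r "\<sigma> 0" S c] by (auto simp: exec_def)
next
  case (Suc n)
  have "exec A (WHILE r S c) ((\<lambda>k. \<sigma> (Suc k)) 0) (n * (b + 2) + 1) ((\<lambda>k. \<sigma> (Suc k)) n)"
    by (rule Suc.IH) (use Suc.prems in auto)
  then obtain t2 where t2: "t2 \<le> n * (b + 2) + 1" "big A (WHILE r S c) (\<sigma> 1) t2 (\<sigma> (Suc n))"
    by (auto simp: exec_def)
  obtain t1 where t1: "t1 \<le> b" "big A c (\<sigma> 0) t1 (\<sigma> 1)"
    using Suc.prems(3)[of 0] by (auto simp: exec_def)
  have "A r (fst (\<sigma> 0) r) \<in> S" using Suc.prems(1) by simp
  from big_WT[OF this t1(2) t2(2)] t1(1) t2(1) show ?case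
    unfolding exec_def by (intro exI[of _ "1 + (t1 + 1 + t2)"]) auto
qed

text \<open>Only cell 0 of a counter tape is marked, so scanning a blank means that the counter is
  positive. The result is a for-loop that consumes its own bound.\<close>

definition drain :: "nat \<Rightarrow> com \<Rightarrow> com" where
  "drain r c = WHILE r {0} (SEQ (DEC r) c)"

lemma cells_counter: "length xs \<le> r \<Longrightarrow> cells xs r j \<in> {0} \<longleftrightarrow> j > 0"
  by (auto simp: cells_def)

text \<open>\<open>\<tau> k\<close> gives the counters after \<open>k\<close> rounds, except for
  \<open>r\<close>, whose entry is always overwritten by the number of remaining rounds. The 4 in
  the time bound is the test, the decrement and two sequencing steps.\<close>

lemma exec_drain:
  assumes r: "length xs \<le> r"
    and body: "\<And>k. k < n \<Longrightarrow> exec (cells xs) c ((\<tau> k)(r := n - Suc k), \<omega> k) b ((\<tau> (Suc k))(r := n - Suc k), \<omega> (Suc k))"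
    and "s = (\<tau> 0)(r := n)" "s' = (\<tau> n)(r := 0)" "w = \<omega> 0" "w' = \<omega> n" "n * (b + 4) + 1 \<le> t"
  shows "exec (cells xs) (drain r c) (s, w) t (s', w')"
proof -
  define \<sigma> where "\<sigma> = (\<lambda>k. ((\<tau> k)(r := n - k), \<omega> k))"
  have "exec (cells xs) (drain r c) (\<sigma> 0) (n * ((1 + 1 + b) + 2) + 1) (\<sigma> n)"
    unfolding drain_def
  proof (rule exec_WHILE)
    show "cells xs r (fst (\<sigma> k) r) \<in> {0}" if "k < n" for k
      using that cells_counter[OF r] by (simp add: \<sigma>_def)
    show "cells xs r (fst (\<sigma> n) r) \<notin> {0}"
      using cells_counter[OF r] by (simp add: \<sigma>_def)
    show "exec (cells xs) (SEQ (DEC r) c) (\<sigma> k) (1 + 1 + b) (\<sigma> (Suc k))" if k: "k < n" for k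
      unfolding \<sigma>_def by (rule exec_SEQ[OF exec_DEC body[OF k]]) (use k in \<open>auto simp: Suc_diff_Suc\<close>)
  qed
  then show ?thesis
    using assms(3-) by (auto simp: \<sigma>_def algebra_simps elim!: exec_mono)
qed

lemma exec_transfer:
  assumes "length xs \<le> r" "r \<noteq> a" "s' = s(r := 0, a := s a + s r)" "s r * 5 + 1 \<le> t"
  shows "exec (cells xs) (drain r (INC a)) (s, w) t (s', w)"
  by (rule exec_drain[where \<tau> = "\<lambda>k. s(a := s a + k)" and n = "s r" and \<omega> = "\<lambda>_. w" and b = 1])
    (use assms in \<open>auto intro!: exec_INC[simplified]\<close>)

lemma exec_clear:
  assumes "length xs \<le> r" "s' = s(r := 0)" "s r * 4 + 1 \<le> t"
  shows "exec (cells xs) (drain r SKIP) (s, w) t (s', w)"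
  by (rule exec_drain[where \<tau> = "\<lambda>k. s" and n = "s r" and \<omega> = "\<lambda>_. w" and b = 0])
    (use assms in \<open>auto simp: fun_eq_iff intro!: exec_SKIP\<close>)

section \<open>Arithmetic expressions, their compilation and its cost\<close>

datatype expr = Const nat | Var nat | Len nat | Inp nat expr | Add expr expr | Sub expr expr
  | Sum nat expr expr | Let_in nat expr expr

definition in_len :: "bool list list \<Rightarrow> nat \<Rightarrow> nat" where
  "in_len xs i = (if i < length xs then length (xs ! i) else 0)"

definition in_bit :: "bool list list \<Rightarrow> nat \<Rightarrow> nat \<Rightarrow> bool" where
  "in_bit xs i j \<longleftrightarrow> i < length xs \<and> j < length (xs ! i) \<and> xs ! i ! j"

fun eval :: "bool list list \<Rightarrow> (nat \<Rightarrow> nat) \<Rightarrow> expr \<Rightarrow> nat" where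
  "eval xs \<epsilon> (Const k) = k"
| "eval xs \<epsilon> (Var v) = \<epsilon> v"
| "eval xs \<epsilon> (Len i) = in_len xs i"
| "eval xs \<epsilon> (Inp i a) = (if in_bit xs i (eval xs \<epsilon> a) then 1 else 0)"
| "eval xs \<epsilon> (Add a b) = eval xs \<epsilon> a + eval xs \<epsilon> b"
| "eval xs \<epsilon> (Sub a b) = eval xs \<epsilon> a - eval xs \<epsilon> b"
| "eval xs \<epsilon> (Sum v a b) = (\<Sum>i<eval xs \<epsilon> a. eval xs (\<epsilon>(v := i)) b)"
| "eval xs \<epsilon> (Let_in v a b) = eval xs (\<epsilon>(v := eval xs \<epsilon> a)) b"

fun incs :: "nat \<Rightarrow> nat \<Rightarrow> com" where
  "incs d 0 = SKIP"
| "incs d (Suc k) = SEQ (INC d) (incs d k)"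

text \<open>\<open>compile l \<rho> d a\<close> leaves the value of \<open>a\<close> in register \<open>d\<close>, provided that all registers
  from \<open>d\<close> on are zero; it restores every other register. Variable \<open>v\<close> is held in register
  \<open>\<rho> v\<close>, and registers below \<open>l\<close> are the heads on the input tapes.\<close>

fun compile :: "nat \<Rightarrow> (nat \<Rightarrow> nat) \<Rightarrow> nat \<Rightarrow> expr \<Rightarrow> com" where
  "compile l \<rho> d (Const k) = incs d k"
| "compile l \<rho> d (Var v) =
     SEQ (drain (\<rho> v) (SEQ (INC d) (INC (d + 1)))) (drain (d + 1) (INC (\<rho> v)))"
| "compile l \<rho> d (Len i) = (if l \<le> i then SKIP else
     SEQ (WHILE i {1, 2} (SEQ (INC d) (SEQ (INC (d + 1)) (INC i)))) (drain (d + 1) (DEC i)))"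
| "compile l \<rho> d (Inp i a) = (if l \<le> i then SKIP else
     SEQ (compile l \<rho> d a) (SEQ (drain d (SEQ (INC (d + 1)) (INC i)))
       (SEQ (IFS i {2} (INC d) SKIP) (drain (d + 1) (DEC i)))))"
| "compile l \<rho> d (Add a b) =
     SEQ (compile l \<rho> d a) (SEQ (compile l \<rho> (d + 1) b) (drain (d + 1) (INC d)))"
| "compile l \<rho> d (Sub a b) =
     SEQ (compile l \<rho> d a) (SEQ (compile l \<rho> (d + 1) b) (drain (d + 1) (IFS d {0} (DEC d) SKIP)))"
| "compile l \<rho> d (Sum v a b) =
     SEQ (compile l \<rho> (d + 1) a)
       (SEQ (drain (d + 1) (SEQ (compile l (\<rho>(v := d + 2)) (d + 3) b)
          (SEQ (drain (d + 3) (INC d)) (INC (d + 2))))) (drain (d + 2) SKIP))"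
| "compile l \<rho> d (Let_in v a b) =
     SEQ (compile l \<rho> d a) (SEQ (compile l (\<rho>(v := d)) (d + 1) b)
       (SEQ (drain d SKIP) (drain (d + 1) (INC d))))"

text \<open>Here \<open>m\<close> bounds all variables and input lengths. The body of
  \<open>Sum\<close> or \<open>Let_in\<close> sees one more variable, with a value up to
  \<open>val_bound a m\<close>; therefore its bound is taken at
  \<open>m + val_bound a m\<close>.\<close>

fun val_bound :: "expr \<Rightarrow> nat \<Rightarrow> nat" where
  "val_bound (Const k) m = k"
| "val_bound (Var v) m = m"
| "val_bound (Len i) m = m"
| "val_bound (Inp i a) m = 1"
| "val_bound (Add a b) m = val_bound a m + val_bound b m"
| "val_bound (Sub a b) m = val_bound a m"
| "val_bound (Sum v a b) m = val_bound a m * val_bound b (m + val_bound a m)"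
| "val_bound (Let_in v a b) m = val_bound b (m + val_bound a m)"

fun time_bound :: "expr \<Rightarrow> nat \<Rightarrow> nat" where
  "time_bound (Const k) m = 2 * k"
| "time_bound (Var v) m = 12 * m + 3"
| "time_bound (Len i) m = 12 * m + 3"
| "time_bound (Inp i a) m = time_bound a m + 12 * val_bound a m + 7"
| "time_bound (Add a b) m = time_bound a m + time_bound b m + 5 * val_bound b m + 3"
| "time_bound (Sub a b) m = time_bound a m + time_bound b m + 6 * val_bound b m + 3"
| "time_bound (Sum v a b) m = time_bound a m + val_bound a m *
     (time_bound b (m + val_bound a m) + 5 * val_bound b (m + val_bound a m) + 8)
     + 4 * val_bound a m + 4"
| "time_bound (Let_in v a b) m = time_bound a m + time_bound b (m + val_bound a m)
     + 4 * val_bound a m + 5 * val_bound b (m + val_bound a m) + 5"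

lemma eval_le_val_bound:
  "(\<And>v. \<epsilon> v \<le> m) \<Longrightarrow> (\<And>i. in_len xs i \<le> m) \<Longrightarrow> eval xs \<epsilon> a \<le> val_bound a m"
proof (induction a arbitrary: \<epsilon> m)
  case (Sum v a b)
  have a: "eval xs \<epsilon> a \<le> val_bound a m" using Sum by blast
  have "eval xs (\<epsilon>(v := i)) b \<le> val_bound b (m + val_bound a m)" if "i < eval xs \<epsilon> a" for i
    using Sum.prems that a by (intro Sum.IH(2)) (auto intro: trans_le_add1)
  then have "(\<Sum>i<eval xs \<epsilon> a. eval xs (\<epsilon>(v := i)) b) \<le> of_nat (card {..<eval xs \<epsilon> a}) * val_bound b (m + val_bound a m)"
    by (intro sum_bounded_above) auto
  also have "\<dots> \<le> val_bound a m * val_bound b (m + val_bound a m)"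
    using a by simp
  finally show ?case by simp
next
  case (Let_in v a b)
  have a: "eval xs \<epsilon> a \<le> val_bound a m" using Let_in by blast
  then show ?case using Let_in.prems by (auto intro!: Let_in.IH(2) simp: trans_le_add1 trans_le_add2)
next
  case (Add a b)
  then show ?case by (auto intro: add_mono)
next
  case (Sub a b)
  then show ?case using le_trans[OF diff_le_self] by auto
qed auto

lemma exec_incs: "exec A (incs d k) (s, w) (2 * k) (s(d := s d + k), w)"
proof (induction k arbitrary: s)
  case (Suc k)
  have "exec A (SEQ (INC d) (incs d k)) (s, w) (1 + 1 + 2 * k)
     ((s(d := Suc (s d)))(d := (s(d := Suc (s d))) d + k), w)"
    by (rule exec_SEQ[OF exec_INC Suc.IH]) (rule refl)
  then show ?case by (simp add: fun_upd_def cong: if_cong)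
qed (auto intro: exec_SKIP)

lemma string_tape_eq_2: "string_tape x (int j) = 2 \<longleftrightarrow> j < length x \<and> x ! j"
  by (auto simp: string_tape_def)

lemma string_tape_nonblank: "string_tape x (int j) \<in> {1, 2} \<longleftrightarrow> j < length x"
  by (auto simp: string_tape_def)

text \<open>A counter can only be read by draining it. So \<open>Var\<close> empties a register into
  two copies and refills it from the second, and an excursion of an input head is undone by a count
  kept in \<open>d + 1\<close>. The assumptions that input heads are at 0 and registers from
  \<open>d\<close> on are zero hold again for each recursive call, at a larger \<open>d\<close>
  where a result must be kept.\<close>

lemma exec_compile:
  assumes "\<And>v. length xs \<le> \<rho> v" "\<And>v. \<rho> v < d" "length xs \<le> d"
    "\<And>i. i < length xs \<Longrightarrow> s i = 0" "\<And>r. d \<le> r \<Longrightarrow> s r = 0"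
    "\<And>v. s (\<rho> v) \<le> m" "\<And>i. in_len xs i \<le> m"
  shows "exec (cells xs) (compile (length xs) \<rho> d a) (s, w) (time_bound a m)
    (s(d := eval xs (\<lambda>v. s (\<rho> v)) a), w)"
  using assms
proof (induction a arbitrary: \<rho> d s m)
  case (Const k)
  then show ?case using exec_incs[of "cells xs" d k s w] by (simp add: fun_upd_def)
next
  case (Var v)
  let ?r = "\<rho> v"
  let ?n = "s (\<rho> v)"
  have r: "?r < d" "length xs \<le> ?r" using Var.prems by auto
  have r': "Suc d \<noteq> ?r" "d \<noteq> ?r" using r by auto
  have n: "?n \<le> m" using Var.prems by auto
  have "exec (cells xs) (compile (length xs) \<rho> d (Var v)) (s, w) ((?n * 7 + 1) + 1 + (?n * 5 + 1)) (s(d := ?n), w)"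
    unfolding compile.simps
  proof (rule exec_SEQ)
    show "exec (cells xs) (drain ?r (SEQ (INC d) (INC (d + 1)))) (s, w) (?n * 7 + 1)
       (s(d := ?n, d + 1 := ?n, ?r := 0), w)"
    proof (rule exec_drain[where \<tau> = "\<lambda>k. s(d := k, d + 1 := k)" and n = ?n and \<omega> = "\<lambda>_. w" and b = "1 + 1 + 1"])
      fix k assume "k < ?n"
      show "exec (cells xs) (SEQ (INC d) (INC (d + 1))) ((s(d := k, d + 1 := k))(?r := ?n - Suc k), w) (1 + 1 + 1)
          ((s(d := Suc k, d + 1 := Suc k))(?r := ?n - Suc k), w)"
        by (rule exec_SEQ[OF exec_INC exec_INC], rule refl) (use r in \<open>auto simp: fun_eq_iff\<close>)
    qed (use r r' Var.prems in \<open>auto simp: fun_eq_iff\<close>)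
    show "exec (cells xs) (drain (d + 1) (INC ?r)) (s(d := ?n, d + 1 := ?n, ?r := 0), w) (?n * 5 + 1) (s(d := ?n), w)"
      by (rule exec_transfer) (use r r' Var.prems in \<open>auto simp: fun_eq_iff\<close>)
  qed
  then show ?case using n by (auto elim!: exec_mono simp: fun_upd_def)
next
  case (Len i)
  show ?case
  proof (cases "length xs \<le> i")
    case True
    then show ?thesis using Len.prems by (auto intro!: exec_SKIP simp: in_len_def fun_eq_iff)
  next
    case False
    let ?n = "length (xs ! i)"
    have n: "?n \<le> m" using Len.prems(7)[of i] False by (simp add: in_len_def)
    have i: "i < d" using False Len.prems by linarith
    have "exec (cells xs) (compile (length xs) \<rho> d (Len i)) (s, w) ((?n * ((1 + 1 + (1 + 1 + 1)) + 2) + 1) + 1 + (?n * 5 + 1)) (s(d := ?n), w)"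
      using False unfolding compile.simps if_not_P[OF False]
    proof (intro exec_SEQ)
      let ?\<sigma> = "\<lambda>k. (s(d := k, d + 1 := k, i := k), w)"
      have "exec (cells xs) (WHILE i {1, 2} (SEQ (INC d) (SEQ (INC (d + 1)) (INC i)))) (?\<sigma> 0)
         (?n * ((1 + 1 + (1 + 1 + 1)) + 2) + 1) (?\<sigma> ?n)"
      proof (rule exec_WHILE)
        show "cells xs i (fst (?\<sigma> k) i) \<in> {1, 2}" if "k < ?n" for k
          using that False string_tape_nonblank[of "xs ! i" k] by (auto simp: cells_def)
        show "cells xs i (fst (?\<sigma> ?n) i) \<notin> {1, 2}"
          using False string_tape_nonblank[of "xs ! i" ?n] by (auto simp: cells_def)
        show "exec (cells xs) (SEQ (INC d) (SEQ (INC (d + 1)) (INC i))) (?\<sigma> k) (1 + 1 + (1 + 1 + 1)) (?\<sigma> (Suc k))" for k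
          by (rule exec_SEQ[OF exec_INC exec_SEQ[OF exec_INC exec_INC]], rule refl, rule refl)
            (use i in \<open>auto simp: fun_eq_iff\<close>)
      qed
      moreover have "?\<sigma> 0 = (s, w)" using Len.prems False by (auto simp: fun_eq_iff)
      ultimately show "exec (cells xs) (WHILE i {1, 2} (SEQ (INC d) (SEQ (INC (d + 1)) (INC i)))) (s, w)
         (?n * ((1 + 1 + (1 + 1 + 1)) + 2) + 1) (?\<sigma> ?n)" by simp
      show "exec (cells xs) (drain (d + 1) (DEC i)) (?\<sigma> ?n) (?n * 5 + 1) (s(d := ?n), w)"
        by (rule exec_drain[where \<tau> = "\<lambda>k. s(d := ?n, i := ?n - k)" and n = ?n and \<omega> = "\<lambda>_. w" and b = 1])
          (use i Len.prems False in \<open>auto simp: fun_eq_iff intro!: exec_DEC[simplified]\<close>)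
    qed
    then show ?thesis using n False by (auto elim!: exec_mono simp: in_len_def fun_upd_def)
  qed
next
  case (Inp i a)
  show ?case
  proof (cases "length xs \<le> i")
    case True
    then show ?thesis using Inp.prems by (auto intro!: exec_SKIP simp: in_bit_def fun_eq_iff)
  next
    case False
    let ?v = "eval xs (\<lambda>v. s (\<rho> v)) a"
    let ?b = "if in_bit xs i ?v then 1 else 0 :: nat"
    have v: "?v \<le> val_bound a m" using Inp.prems by (intro eval_le_val_bound) auto
    have i: "i < d" using False Inp.prems by linarith
    have "exec (cells xs) (compile (length xs) \<rho> d (Inp i a)) (s, w)
       (time_bound a m + 1 + ((?v * 7 + 1) + 1 + (Suc 1 + 1 + (?v * 5 + 1)))) (s(d := ?b), w)"
      unfolding compile.simps if_not_P[OF False]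
    proof (intro exec_SEQ)
      show "exec (cells xs) (compile (length xs) \<rho> d a) (s, w) (time_bound a m) (s(d := ?v), w)"
        by (rule Inp.IH) (use Inp.prems in auto)
      show "exec (cells xs) (drain d (SEQ (INC (d + 1)) (INC i))) (s(d := ?v), w) (?v * 7 + 1)
         (s(d := 0, d + 1 := ?v, i := ?v), w)"
      proof (rule exec_drain[where \<tau> = "\<lambda>k. s(d + 1 := k, i := k)" and n = ?v and \<omega> = "\<lambda>_. w" and b = "1 + 1 + 1"])
        fix k assume "k < ?v"
        show "exec (cells xs) (SEQ (INC (d + 1)) (INC i)) ((s(d + 1 := k, i := k))(d := ?v - Suc k), w) (1 + 1 + 1)
          ((s(d + 1 := Suc k, i := Suc k))(d := ?v - Suc k), w)"
          by (rule exec_SEQ[OF exec_INC exec_INC], rule refl) (use i in \<open>auto simp: fun_eq_iff\<close>)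
      qed (use i False Inp.prems in \<open>auto simp: fun_eq_iff\<close>)
      show "exec (cells xs) (IFS i {2} (INC d) SKIP) (s(d := 0, d + 1 := ?v, i := ?v), w) (Suc 1)
         (s(d := ?b, d + 1 := ?v, i := ?v), w)"
        by (rule exec_IFS)
          (use i False string_tape_eq_2[of "xs ! i" ?v] in
            \<open>auto simp: fun_eq_iff cells_def in_bit_def intro!: exec_INC[simplified] exec_SKIP\<close>)
      show "exec (cells xs) (drain (d + 1) (DEC i)) (s(d := ?b, d + 1 := ?v, i := ?v), w) (?v * 5 + 1) (s(d := ?b), w)"
        by (rule exec_drain[where \<tau> = "\<lambda>k. s(d := ?b, i := ?v - k)" and n = ?v and \<omega> = "\<lambda>_. w" and b = 1])
          (use i Inp.prems False in \<open>auto simp: fun_eq_iff intro!: exec_DEC[simplified]\<close>)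
    qed
    then show ?thesis using v False
      by (cases "in_bit xs i ?v") (auto elim!: exec_mono simp: fun_upd_def)
  qed
next
  case (Add a b)
  let ?va = "eval xs (\<lambda>v. s (\<rho> v)) a"
  let ?vb = "eval xs (\<lambda>v. s (\<rho> v)) b"
  have v: "?vb \<le> val_bound b m" using Add.prems by (intro eval_le_val_bound) auto
  have \<rho>: "\<rho> v \<noteq> d" "\<rho> v < d + 1" for v using Add.prems(2)[of v] by auto
  have "exec (cells xs) (compile (length xs) \<rho> d (Add a b)) (s, w)
     (time_bound a m + 1 + (time_bound b m + 1 + (?vb * 5 + 1))) (s(d := ?va + ?vb), w)"
    unfolding compile.simps
  proof (intro exec_SEQ)
    show "exec (cells xs) (compile (length xs) \<rho> d a) (s, w) (time_bound a m) (s(d := ?va), w)"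
      by (rule Add.IH) (use Add.prems in auto)
    have "exec (cells xs) (compile (length xs) \<rho> (d + 1) b) (s(d := ?va), w) (time_bound b m)
       ((s(d := ?va))(d + 1 := eval xs (\<lambda>v. (s(d := ?va)) (\<rho> v)) b), w)"
      by (rule Add.IH) (use Add.prems \<rho> in auto)
    then show "exec (cells xs) (compile (length xs) \<rho> (d + 1) b) (s(d := ?va), w) (time_bound b m)
       (s(d := ?va, d + 1 := ?vb), w)" using \<rho> by simp
    show "exec (cells xs) (drain (d + 1) (INC d)) (s(d := ?va, d + 1 := ?vb), w) (?vb * 5 + 1) (s(d := ?va + ?vb), w)"
      by (rule exec_transfer) (use Add.prems in \<open>auto simp: fun_eq_iff\<close>)
  qed
  then show ?case using v by (auto elim!: exec_mono simp: fun_upd_def)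
next
  case (Sub a b)
  let ?va = "eval xs (\<lambda>v. s (\<rho> v)) a"
  let ?vb = "eval xs (\<lambda>v. s (\<rho> v)) b"
  have v: "?vb \<le> val_bound b m" using Sub.prems by (intro eval_le_val_bound) auto
  have \<rho>: "\<rho> v \<noteq> d" "\<rho> v < d + 1" for v using Sub.prems(2)[of v] by auto
  have "exec (cells xs) (compile (length xs) \<rho> d (Sub a b)) (s, w)
     (time_bound a m + 1 + (time_bound b m + 1 + (?vb * 6 + 1))) (s(d := ?va - ?vb), w)"
    unfolding compile.simps
  proof (intro exec_SEQ)
    show "exec (cells xs) (compile (length xs) \<rho> d a) (s, w) (time_bound a m) (s(d := ?va), w)"
      by (rule Sub.IH) (use Sub.prems in auto)
    have "exec (cells xs) (compile (length xs) \<rho> (d + 1) b) (s(d := ?va), w) (time_bound b m)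
       ((s(d := ?va))(d + 1 := eval xs (\<lambda>v. (s(d := ?va)) (\<rho> v)) b), w)"
      by (rule Sub.IH) (use Sub.prems \<rho> in auto)
    then show "exec (cells xs) (compile (length xs) \<rho> (d + 1) b) (s(d := ?va), w) (time_bound b m)
       (s(d := ?va, d + 1 := ?vb), w)" using \<rho> by simp
    \<comment> \<open>The test stops the subtraction at 0: a blank under head \<open>d\<close> says
      that there is something left to decrement.\<close>
    show "exec (cells xs) (drain (d + 1) (IFS d {0} (DEC d) SKIP)) (s(d := ?va, d + 1 := ?vb), w) (?vb * 6 + 1)
        (s(d := ?va - ?vb), w)"
    proof (rule exec_drain[where \<tau> = "\<lambda>k. s(d := ?va - k)" and n = ?vb and \<omega> = "\<lambda>_. w" and b = "Suc 1"])
      fix k assume "k < ?vb"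
      show "exec (cells xs) (IFS d {0} (DEC d) SKIP) ((s(d := ?va - k))(d + 1 := ?vb - Suc k), w) (Suc 1)
        ((s(d := ?va - Suc k))(d + 1 := ?vb - Suc k), w)"
        by (rule exec_IFS, rule exec_DEC)
          (use Sub.prems(3) in \<open>auto simp: cells_def fun_eq_iff intro!: exec_SKIP split: if_splits\<close>)
    qed (use Sub.prems in \<open>auto simp: fun_eq_iff\<close>)
  qed
  then show ?case using v by (auto elim!: exec_mono simp: fun_upd_def)
next
  case (Sum v a b)
  let ?\<epsilon> = "\<lambda>v. s (\<rho> v)"
  let ?n = "eval xs ?\<epsilon> a"
  let ?f = "\<lambda>i. eval xs (?\<epsilon>(v := i)) b"
  let ?m = "m + val_bound a m"
  have n: "?n \<le> val_bound a m" using Sum.prems by (intro eval_le_val_bound) auto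
  have f: "?f i \<le> val_bound b ?m" if "i < ?n" for i
    using Sum.prems n that by (intro eval_le_val_bound) (auto intro: trans_le_add1)
  have \<rho>: "\<rho> v \<noteq> d" "\<rho> v \<noteq> d + 1" "\<rho> v \<noteq> d + 2" "\<rho> v < d + 1" "\<rho> v < d + 3" for v
    using Sum.prems(2)[of v] by auto
  let ?B = "time_bound b ?m + 1 + ((val_bound b ?m * 5 + 1) + 1 + 1)"
  \<comment> \<open>Register \<open>d\<close> accumulates the sum, \<open>d + 1\<close> holds the
    number of remaining rounds, \<open>d + 2\<close> is the summation index, and
    \<open>d + 3\<close> receives the current summand.\<close>
  let ?\<tau> = "\<lambda>k. s(d := (\<Sum>i<k. ?f i), d + 2 := k)"
  have "exec (cells xs) (compile (length xs) \<rho> d (Sum v a b)) (s, w)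
     (time_bound a m + 1 + ((?n * (?B + 4) + 1) + 1 + (?n * 4 + 1))) (s(d := (\<Sum>i<?n. ?f i)), w)"
    unfolding compile.simps
  proof (intro exec_SEQ)
    show "exec (cells xs) (compile (length xs) \<rho> (d + 1) a) (s, w) (time_bound a m) (s(d + 1 := ?n), w)"
      by (rule Sum.IH) (use Sum.prems \<rho> in auto)
    show "exec (cells xs) (drain (d + 1) (SEQ (compile (length xs) (\<rho>(v := d + 2)) (d + 3) b)
          (SEQ (drain (d + 3) (INC d)) (INC (d + 2))))) (s(d + 1 := ?n), w) (?n * (?B + 4) + 1)
          ((?\<tau> ?n)(d + 1 := 0), w)"
    proof (rule exec_drain[where \<tau> = ?\<tau> and n = ?n and \<omega> = "\<lambda>_. w" and b = ?B])
      fix k assume k: "k < ?n"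
      let ?s = "(?\<tau> k)(d + 1 := ?n - Suc k)"
      have env: "(\<lambda>u. ?s ((\<rho>(v := d + 2)) u)) = ?\<epsilon>(v := k)"
        using \<rho> by (auto simp: fun_eq_iff)
      have "exec (cells xs) (compile (length xs) (\<rho>(v := d + 2)) (d + 3) b) (?s, w) (time_bound b ?m)
          (?s(d + 3 := eval xs (\<lambda>u. ?s ((\<rho>(v := d + 2)) u)) b), w)"
      proof (rule Sum.IH(2))
        fix u show "?s ((\<rho>(v := d + 2)) u) \<le> ?m"
          using \<rho>[of u] Sum.prems(6)[of u] k n by (auto intro: trans_le_add1)
      qed (use Sum.prems \<rho> in \<open>auto intro: trans_le_add1\<close>)
      then have 1: "exec (cells xs) (compile (length xs) (\<rho>(v := d + 2)) (d + 3) b) (?s, w) (time_bound b ?m)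
          (?s(d + 3 := ?f k), w)" unfolding env .
      have 2: "exec (cells xs) (drain (d + 3) (INC d)) (?s(d + 3 := ?f k), w) (val_bound b ?m * 5 + 1)
          (s(d := (\<Sum>i<Suc k. ?f i), d + 2 := k, d + 1 := ?n - Suc k), w)"
        by (rule exec_transfer) (use Sum.prems f[OF k] in \<open>auto simp: fun_eq_iff\<close>)
      show "exec (cells xs) (SEQ (compile (length xs) (\<rho>(v := d + 2)) (d + 3) b) (SEQ (drain (d + 3) (INC d)) (INC (d + 2))))
         (?s, w) ?B ((?\<tau> (Suc k))(d + 1 := ?n - Suc k), w)"
        by (rule exec_SEQ[OF 1 exec_SEQ[OF 2 exec_INC]]) (auto simp: fun_eq_iff)
    qed (use Sum.prems in \<open>auto simp: fun_eq_iff\<close>)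
    show "exec (cells xs) (drain (d + 2) SKIP) ((?\<tau> ?n)(d + 1 := 0), w) (?n * 4 + 1) (s(d := (\<Sum>i<?n. ?f i)), w)"
      by (rule exec_clear) (use Sum.prems in \<open>auto simp: fun_eq_iff\<close>)
  qed
  moreover have "?n * (?B + 4) \<le> val_bound a m * (?B + 4)" using n by (rule mult_le_mono1)
  ultimately show ?case using n by (auto elim!: exec_mono simp: algebra_simps fun_upd_def)
next
  case (Let_in v a b)
  let ?\<epsilon> = "\<lambda>v. s (\<rho> v)"
  let ?va = "eval xs ?\<epsilon> a"
  let ?vb = "eval xs (?\<epsilon>(v := ?va)) b"
  let ?m = "m + val_bound a m"
  have va: "?va \<le> val_bound a m" using Let_in.prems by (intro eval_le_val_bound) auto
  have vb: "?vb \<le> val_bound b ?m"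
    using Let_in.prems va by (intro eval_le_val_bound) (auto intro: trans_le_add1)
  have \<rho>: "\<rho> v \<noteq> d" "\<rho> v < d + 1" for v using Let_in.prems(2)[of v] by auto
  have "exec (cells xs) (compile (length xs) \<rho> d (Let_in v a b)) (s, w)
     (time_bound a m + 1 + (time_bound b ?m + 1 + ((?va * 4 + 1) + 1 + (?vb * 5 + 1)))) (s(d := ?vb), w)"
    unfolding compile.simps
  proof (intro exec_SEQ)
    show "exec (cells xs) (compile (length xs) \<rho> d a) (s, w) (time_bound a m) (s(d := ?va), w)"
      by (rule Let_in.IH) (use Let_in.prems in auto)
    let ?s = "s(d := ?va)"
    have env: "(\<lambda>u. ?s ((\<rho>(v := d)) u)) = ?\<epsilon>(v := ?va)"
      using \<rho> by (auto simp: fun_eq_iff)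
    have "exec (cells xs) (compile (length xs) (\<rho>(v := d)) (d + 1) b) (?s, w) (time_bound b ?m)
       (?s(d + 1 := eval xs (\<lambda>u. ?s ((\<rho>(v := d)) u)) b), w)"
    proof (rule Let_in.IH(2))
      fix u show "?s ((\<rho>(v := d)) u) \<le> ?m"
        using \<rho>[of u] Let_in.prems(6)[of u] va by (auto intro: trans_le_add1)
    qed (use Let_in.prems \<rho> in \<open>auto intro: trans_le_add1\<close>)
    then show "exec (cells xs) (compile (length xs) (\<rho>(v := d)) (d + 1) b) (?s, w) (time_bound b ?m)
       (?s(d + 1 := ?vb), w)" unfolding env .
    show "exec (cells xs) (drain d SKIP) (?s(d + 1 := ?vb), w) (?va * 4 + 1) (s(d + 1 := ?vb), w)"
      by (rule exec_clear) (use Let_in.prems in \<open>auto simp: fun_eq_iff\<close>)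
    show "exec (cells xs) (drain (d + 1) (INC d)) (s(d + 1 := ?vb), w) (?vb * 5 + 1) (s(d := ?vb), w)"
      by (rule exec_transfer) (use Let_in.prems in \<open>auto simp: fun_eq_iff\<close>)
  qed
  then show ?case using va vb by (auto elim!: exec_mono simp: fun_upd_def)
qed

section \<open>Polynomial bounds and polynomial-time evaluation\<close>

lemma poly_nat_mono: "x \<le> y \<Longrightarrow> poly p x \<le> poly p y" for p :: "nat poly"
  by (induction p) (auto intro!: add_mono mult_mono)

definition poly_bounded :: "(nat \<Rightarrow> nat) \<Rightarrow> bool" where
  "poly_bounded f \<longleftrightarrow> (\<exists>p :: nat poly. \<forall>m. f m \<le> poly p m)"

lemma poly_bounded_const: "poly_bounded (\<lambda>m. k)"
  unfolding poly_bounded_def by (intro exI[of _ "[:k:]"]) simp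

lemma poly_bounded_id: "poly_bounded (\<lambda>m. m)"
  unfolding poly_bounded_def by (intro exI[of _ "[:0, 1:]"]) simp

lemma poly_bounded_add:
  assumes "poly_bounded f" "poly_bounded g"
  shows "poly_bounded (\<lambda>m. f m + g m)"
proof -
  obtain p q :: "nat poly" where "\<And>m. f m \<le> poly p m" "\<And>m. g m \<le> poly q m"
    using assms by (auto simp: poly_bounded_def)
  then show ?thesis unfolding poly_bounded_def by (intro exI[of _ "p + q"]) (auto intro: add_mono)
qed

lemma poly_bounded_mult:
  assumes "poly_bounded f" "poly_bounded g"
  shows "poly_bounded (\<lambda>m. f m * g m)"
proof -
  obtain p q :: "nat poly" where "\<And>m. f m \<le> poly p m" "\<And>m. g m \<le> poly q m"
    using assms by (auto simp: poly_bounded_def)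
  then show ?thesis unfolding poly_bounded_def by (intro exI[of _ "p * q"]) (auto intro: mult_mono)
qed

lemma poly_bounded_compose:
  assumes "poly_bounded f" "poly_bounded g"
  shows "poly_bounded (\<lambda>m. f (g m))"
proof -
  obtain p q :: "nat poly" where p: "\<And>m. f m \<le> poly p m" and q: "\<And>m. g m \<le> poly q m"
    using assms by (auto simp: poly_bounded_def)
  have "f (g m) \<le> poly (pcompose p q) m" for m
    unfolding poly_pcompose using p[of "g m"] poly_nat_mono[OF q[of m], of p] by (rule order_trans)
  then show ?thesis unfolding poly_bounded_def by blast
qed

lemmas poly_bounded_intros = poly_bounded_const poly_bounded_id poly_bounded_add poly_bounded_mult

lemma poly_bounded_val_bound: "poly_bounded (val_bound a)"
proof (induction a)
  case (Const k)
  have "poly_bounded (\<lambda>m. k)"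
    by (intro poly_bounded_intros)
  then show ?case by (simp add: poly_bounded_def)
next
  case (Var v)
  have "poly_bounded (\<lambda>m. m)"
    by (intro poly_bounded_intros)
  then show ?case by (simp add: poly_bounded_def)
next
  case (Len i)
  have "poly_bounded (\<lambda>m. m)"
    by (intro poly_bounded_intros)
  then show ?case by (simp add: poly_bounded_def)
next
  case (Inp i a)
  have "poly_bounded (\<lambda>m. 1)"
    by (intro Inp poly_bounded_intros)
  then show ?case by (simp add: poly_bounded_def)
next
  case (Add a b)
  have "poly_bounded (\<lambda>m. val_bound a m + val_bound b m)"
    by (intro Add poly_bounded_intros)
  then show ?case by (simp add: poly_bounded_def)
next
  case (Sub a b)
  have "poly_bounded (\<lambda>m. val_bound a m)"
    by (intro Sub poly_bounded_intros)
  then show ?case by (simp add: poly_bounded_def)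
next
  case (Sum v a b)
  have "poly_bounded (\<lambda>m. val_bound a m * val_bound b (m + val_bound a m))"
    by (intro Sum poly_bounded_intros poly_bounded_compose[OF Sum.IH(2)])
  then show ?case by (simp add: poly_bounded_def)
next
  case (Let_in v a b)
  have "poly_bounded (\<lambda>m. val_bound b (m + val_bound a m))"
    by (intro Let_in poly_bounded_intros poly_bounded_compose[OF Let_in.IH(2)])
  then show ?case by (simp add: poly_bounded_def)
qed

lemma poly_bounded_time_bound: "poly_bounded (time_bound a)"
proof (induction a)
  case (Const k)
  have "poly_bounded (\<lambda>m. 2 * k)"
    by (intro poly_bounded_intros poly_bounded_val_bound)
  then show ?case by (simp add: poly_bounded_def)
next
  case (Var v)
  have "poly_bounded (\<lambda>m. 12 * m + 3)"
    by (intro poly_bounded_intros poly_bounded_val_bound)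
  then show ?case by (simp add: poly_bounded_def)
next
  case (Len i)
  have "poly_bounded (\<lambda>m. 12 * m + 3)"
    by (intro poly_bounded_intros poly_bounded_val_bound)
  then show ?case by (simp add: poly_bounded_def)
next
  case (Inp i a)
  have "poly_bounded (\<lambda>m. time_bound a m + 12 * val_bound a m + 7)"
    by (intro Inp poly_bounded_intros poly_bounded_val_bound)
  then show ?case by (simp add: poly_bounded_def)
next
  case (Add a b)
  have "poly_bounded (\<lambda>m. time_bound a m + time_bound b m + 5 * val_bound b m + 3)"
    by (intro Add poly_bounded_intros poly_bounded_val_bound)
  then show ?case by (simp add: poly_bounded_def)
next
  case (Sub a b)
  have "poly_bounded (\<lambda>m. time_bound a m + time_bound b m + 6 * val_bound b m + 3)"
    by (intro Sub poly_bounded_intros poly_bounded_val_bound)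
  then show ?case by (simp add: poly_bounded_def)
next
  case (Sum v a b)
  have "poly_bounded (\<lambda>m. time_bound a m + val_bound a m * (time_bound b (m + val_bound a m) + 5 * val_bound b (m + val_bound a m) + 8) + 4 * val_bound a m + 4)"
    by (intro Sum poly_bounded_intros poly_bounded_val_bound poly_bounded_compose[OF Sum.IH(2)] poly_bounded_compose[OF poly_bounded_val_bound])
  then show ?case by (simp add: poly_bounded_def)
next
  case (Let_in v a b)
  have "poly_bounded (\<lambda>m. time_bound a m + time_bound b (m + val_bound a m) + 4 * val_bound a m + 5 * val_bound b (m + val_bound a m) + 5)"
    by (intro Let_in poly_bounded_intros poly_bounded_val_bound poly_bounded_compose[OF Let_in.IH(2)] poly_bounded_compose[OF poly_bounded_val_bound])
  then show ?case by (simp add: poly_bounded_def)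
qed

lemma regs_bound: "\<exists>n\<ge>l. regs c \<subseteq> {..<n}"
proof -
  obtain n where "regs c \<subseteq> {..<n}"
    using finite_regs[of c] finite_nat_iff_bounded by blast
  then show ?thesis by (intro exI[of _ "max l n"]) (auto simp: subset_iff less_max_iff_disj)
qed

text \<open>The environments are constant, so one register represents all variables at once.
  Register 1 is 0 while the output length is computed and is the output position afterwards;
  register 2 counts the bits still to be written.\<close>

lemma polytime_function_eval:
  assumes f: "\<And>x. f x = map (\<lambda>k. eval [x] (\<lambda>_. k) b \<noteq> 0) [0..<eval [x] (\<lambda>_. 0) a]"
  shows "polytime_function f"
proof -
  define c where "c = SEQ (compile 1 (\<lambda>_. 1) 2 a)
    (drain 2 (SEQ (compile 1 (\<lambda>_. 1) 3 b)
       (SEQ (IFS 3 {0} (OUT True) (OUT False)) (SEQ (drain 3 SKIP) (INC 1)))))"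
  define V where "V = val_bound a"
  define B where "B = (\<lambda>m. time_bound b (m + V m) + 1 + (Suc 1 + 1 + ((val_bound b (m + V m) * 4 + 1) + 1 + 1)))"
  define T where "T = (\<lambda>m. time_bound a m + 1 + (V m * (B m + 4) + 1))"
  have V: "poly_bounded V" unfolding V_def by (rule poly_bounded_val_bound)
  have "poly_bounded (\<lambda>m. Suc (T m))"
    unfolding T_def B_def Suc_eq_plus1
    by (intro poly_bounded_intros V poly_bounded_time_bound poly_bounded_compose[OF poly_bounded_time_bound]
        poly_bounded_compose[OF poly_bounded_val_bound])
  then obtain p :: "nat poly" where p: "\<And>m. Suc (T m) \<le> poly p m" by (auto simp: poly_bounded_def)
  obtain n where n: "1 \<le> n" "regs c \<subseteq> {..<n}" using regs_bound by blast
  obtain M where M: "wf_tm M" and out: "\<And>xs t s w. length xs = 1 \<Longrightarrow>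
      big (cells xs) c (\<lambda>_. 0, []) t (s, w) \<Longrightarrow> outputs_within M xs (Suc t) w"
    using com_machine[OF n(2) order_refl n(1)] by metis
  have "outputs_within M [x] (poly p (length x)) (f x)" for x
  proof -
    define m where "m = length x"
    define N where "N = eval [x] (\<lambda>_. 0) a"
    define g where "g = (\<lambda>k. eval [x] (\<lambda>_. k) b)"
    have in_m: "in_len [x] i \<le> m" for i by (simp add: in_len_def m_def)
    have NV: "N \<le> V m" unfolding N_def V_def by (rule eval_le_val_bound) (auto simp: in_m)
    have gV: "g k \<le> val_bound b (m + V m)" if "k < N" for k
      unfolding g_def using that NV in_m by (intro eval_le_val_bound) (auto intro: trans_le_add1)
    let ?\<tau> = "\<lambda>k. (\<lambda>_. 0::nat)(1 := k)"
    have "exec (cells [x]) c (\<lambda>_. 0, []) (T m) (?\<tau> N, f x)"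
      unfolding c_def T_def
    proof (rule exec_SEQ)
      have "exec (cells [x]) (compile (length [x]) (\<lambda>_. 1) 2 a) (\<lambda>_. 0, []) (time_bound a m)
         ((\<lambda>_. 0)(2 := eval [x] (\<lambda>v. (\<lambda>_. 0) ((\<lambda>_. 1::nat) v)) a), [])"
        by (rule exec_compile) (auto simp: in_m)
      then show "exec (cells [x]) (compile 1 (\<lambda>_. 1) 2 a) (\<lambda>_. 0, []) (time_bound a m) ((\<lambda>_. 0)(2 := N), [])"
        by (simp add: N_def)
      show "exec (cells [x]) (drain 2 (SEQ (compile 1 (\<lambda>_. 1) 3 b)
         (SEQ (IFS 3 {0} (OUT True) (OUT False)) (SEQ (drain 3 SKIP) (INC 1))))) ((\<lambda>_. 0)(2 := N), [])
         (V m * (B m + 4) + 1) (?\<tau> N, f x)"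
      proof (rule exec_drain[where \<tau> = ?\<tau> and n = N and \<omega> = "\<lambda>k. map (\<lambda>k. g k \<noteq> 0) [0..<k]" and b = "B m"])
        fix k assume k: "k < N"
        let ?s = "(?\<tau> k)(2 := N - Suc k)"
        let ?w = "\<lambda>k. map (\<lambda>k. g k \<noteq> 0) [0..<k]"
        have "exec (cells [x]) (compile (length [x]) (\<lambda>_. 1) 3 b) (?s, ?w k) (time_bound b (m + V m))
           (?s(3 := eval [x] (\<lambda>v. ?s ((\<lambda>_. 1::nat) v)) b), ?w k)"
          using k NV by (intro exec_compile) (auto intro: trans_le_add1 in_m)
        then have 1: "exec (cells [x]) (compile 1 (\<lambda>_. 1) 3 b) (?s, ?w k) (time_bound b (m + V m))
           (?s(3 := g k), ?w k)" by (simp add: g_def)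
        \<comment> \<open>A blank under head 3 means a nonzero value, so the first branch writes
          \<open>True\<close>.\<close>
        have 2: "exec (cells [x]) (IFS 3 {0} (OUT True) (OUT False)) (?s(3 := g k), ?w k) (Suc 1) (?s(3 := g k), ?w (Suc k))"
          by (rule exec_IFS) (use exec_OUT in \<open>auto simp: cells_def split: if_splits\<close>)
        have 3: "exec (cells [x]) (drain 3 SKIP) (?s(3 := g k), ?w (Suc k)) (val_bound b (m + V m) * 4 + 1) (?s, ?w (Suc k))"
          by (rule exec_clear) (use gV[OF k] in \<open>auto simp: fun_eq_iff\<close>)
        have 4: "exec (cells [x]) (INC 1) (?s, ?w (Suc k)) 1 ((?\<tau> (Suc k))(2 := N - Suc k), ?w (Suc k))"
          by (rule exec_INC) (auto simp: fun_eq_iff)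
        show "exec (cells [x]) (SEQ (compile 1 (\<lambda>_. 1) 3 b)
             (SEQ (IFS 3 {0} (OUT True) (OUT False)) (SEQ (drain 3 SKIP) (INC 1))))
             (?s, ?w k) (B m) ((?\<tau> (Suc k))(2 := N - Suc k), ?w (Suc k))"
          unfolding B_def by (rule exec_SEQ[OF 1 exec_SEQ[OF 2 exec_SEQ[OF 3 4]]])
      qed (use NV in \<open>auto simp: fun_eq_iff f g_def N_def\<close>)
    qed
    then obtain t where t: "t \<le> T m" "big (cells [x]) c (\<lambda>_. 0, []) t (?\<tau> N, f x)"
      by (auto simp: exec_def)
    show ?thesis
      by (rule outputs_within_mono[OF out[OF _ t(2)]]) (use p[of m] t(1) in \<open>auto simp: m_def\<close>)
  qed
  with M show ?thesis unfolding polytime_function_def by blast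
qed

text \<open>Registers 0 and 1 are the heads on the two inputs; register 2 stays 0 and represents
  every variable of the constant environment.\<close>

lemma polytime_relation_eval:
  assumes R: "\<And>x y. R x y \<longleftrightarrow> eval [x, y] (\<lambda>_. 0) a \<noteq> 0"
  shows "polytime_relation R"
proof -
  define c where "c = SEQ (compile 2 (\<lambda>_. 2) 3 a) (IFS 3 {0} (OUT True) (OUT False))"
  have "poly_bounded (\<lambda>m. time_bound a m + 4)"
    by (intro poly_bounded_intros poly_bounded_time_bound)
  then obtain p :: "nat poly" where p: "\<And>m. time_bound a m + 4 \<le> poly p m" by (auto simp: poly_bounded_def)
  obtain n where n: "2 \<le> n" "regs c \<subseteq> {..<n}" using regs_bound by blast
  obtain M where M: "wf_tm M" "num_tapes M = Suc n" and out: "\<And>xs t s w. length xs = 2 \<Longrightarrow>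
      big (cells xs) c (\<lambda>_. 0, []) t (s, w) \<Longrightarrow> outputs_within M xs (Suc t) w"
    using com_machine[OF n(2) _ n(1)] one_le_numeral by metis
  have "outputs_within M [x, y] (poly p (length x + length y)) [R x y]" for x y
  proof -
    define m where "m = length x + length y"
    let ?s = "(\<lambda>_. 0)(3 := eval [x, y] (\<lambda>_. 0) a)"
    have in_m: "in_len [x, y] i \<le> m" for i by (auto simp: in_len_def m_def less_Suc_eq)
    have "exec (cells [x, y]) (compile (length [x, y]) (\<lambda>_. 2) 3 a) (\<lambda>_. 0, []) (time_bound a m)
         ((\<lambda>_. 0)(3 := eval [x, y] (\<lambda>v. (\<lambda>_. 0) ((\<lambda>_. 2::nat) v)) a), [])"
      by (rule exec_compile) (auto simp: in_m)
    then have 1: "exec (cells [x, y]) (compile 2 (\<lambda>_. 2) 3 a) (\<lambda>_. 0, []) (time_bound a m) (?s, [])"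
      by (simp add: numeral_2_eq_2)
    have 2: "exec (cells [x, y]) (IFS 3 {0} (OUT True) (OUT False)) (?s, []) (Suc 1) (?s, [R x y])"
      by (rule exec_IFS) (use exec_OUT[of _ _ ?s "[]"] R[of x y] in \<open>auto simp: cells_def split: if_splits\<close>)
    obtain t where t: "t \<le> time_bound a m + 1 + Suc 1" "big (cells [x, y]) c (\<lambda>_. 0, []) t (?s, [R x y])"
      using exec_SEQ[OF 1 2] by (auto simp: exec_def c_def)
    show ?thesis
      by (rule outputs_within_mono[OF out[OF _ t(2)]]) (use p[of m] t(1) in \<open>auto simp: m_def\<close>)
  qed
  moreover have "2 \<le> num_tapes M" using M(2) n(1) by simp
  ultimately show ?thesis using M(1) unfolding polytime_relation_def by blast
qed

section \<open>Closure properties of expressible functions\<close>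

fun vars :: "expr \<Rightarrow> nat set" where
  "vars (Const k) = {}"
| "vars (Var v) = {v}"
| "vars (Len i) = {}"
| "vars (Inp i a) = vars a"
| "vars (Add a b) = vars a \<union> vars b"
| "vars (Sub a b) = vars a \<union> vars b"
| "vars (Sum v a b) = insert v (vars a \<union> vars b)"
| "vars (Let_in v a b) = insert v (vars a \<union> vars b)"

lemma finite_vars: "finite (vars a)"
  by (induction a) auto

lemma eval_cong: "(\<And>v. v \<in> vars a \<Longrightarrow> \<epsilon> v = \<epsilon>' v) \<Longrightarrow> eval xs \<epsilon> a = eval xs \<epsilon>' a"
proof (induction a arbitrary: \<epsilon> \<epsilon>')
  case (Sum v a b)
  have "eval xs \<epsilon> a = eval xs \<epsilon>' a" using Sum.prems by (intro Sum.IH) auto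
  moreover have "eval xs (\<epsilon>(v := i)) b = eval xs (\<epsilon>'(v := i)) b" for i
    using Sum.prems by (intro Sum.IH) auto
  ultimately show ?case by simp
next
  case (Let_in v a b)
  have "eval xs \<epsilon> a = eval xs \<epsilon>' a" using Let_in.prems by (intro Let_in.IH) auto
  moreover have "eval xs (\<epsilon>(v := i)) b = eval xs (\<epsilon>'(v := i)) b" for i
    using Let_in.prems by (intro Let_in.IH) auto
  ultimately show ?case by simp
next
  case (Inp i a)
  have "eval xs \<epsilon> a = eval xs \<epsilon>' a" using Inp.prems by (intro Inp.IH) auto
  then show ?case by simp
next
  case (Add a b)
  have "eval xs \<epsilon> a = eval xs \<epsilon>' a" "eval xs \<epsilon> b = eval xs \<epsilon>' b"
    using Add.prems by (auto intro!: Add.IH)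
  then show ?case by simp
next
  case (Sub a b)
  have "eval xs \<epsilon> a = eval xs \<epsilon>' a" "eval xs \<epsilon> b = eval xs \<epsilon>' b"
    using Sub.prems by (auto intro!: Sub.IH)
  then show ?case by simp
qed auto

type_synonym fn = "bool list list \<Rightarrow> (nat \<Rightarrow> nat) \<Rightarrow> nat"

text \<open>A semantic notion: later constructions are written as ordinary functions, and
  introduction rules following their syntax provide the expressions.\<close>

definition expressible :: "fn \<Rightarrow> bool" where
  "expressible f \<longleftrightarrow> (\<exists>a. \<forall>xs \<epsilon>. eval xs \<epsilon> a = f xs \<epsilon>)"

lemma expressibleI: "(\<And>xs \<epsilon>. eval xs \<epsilon> a = f xs \<epsilon>) \<Longrightarrow> expressible f"
  by (auto simp: expressible_def)

lemma expressible_const: "expressible (\<lambda>xs \<epsilon>. k)"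
  by (rule expressibleI[of "Const k"]) simp

lemma expressible_var: "expressible (\<lambda>xs \<epsilon>. \<epsilon> v)"
  by (rule expressibleI[of "Var v"]) simp

lemma expressible_len: "expressible (\<lambda>xs \<epsilon>. in_len xs i)"
  by (rule expressibleI[of "Len i"]) simp

lemma expressible_add:
  assumes "expressible f" "expressible g"
  shows "expressible (\<lambda>xs \<epsilon>. f xs \<epsilon> + g xs \<epsilon>)"
proof -
  obtain a b where "\<And>xs \<epsilon>. eval xs \<epsilon> a = f xs \<epsilon>" "\<And>xs \<epsilon>. eval xs \<epsilon> b = g xs \<epsilon>"
    using assms by (auto simp: expressible_def)
  then show ?thesis by (intro expressibleI[of "Add a b"]) simp
qed

lemma expressible_Suc: "expressible f \<Longrightarrow> expressible (\<lambda>xs \<epsilon>. Suc (f xs \<epsilon>))"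
  using expressible_add[OF _ expressible_const[of 1]] by simp

lemma expressible_diff:
  assumes "expressible f" "expressible g"
  shows "expressible (\<lambda>xs \<epsilon>. f xs \<epsilon> - g xs \<epsilon>)"
proof -
  obtain a b where "\<And>xs \<epsilon>. eval xs \<epsilon> a = f xs \<epsilon>" "\<And>xs \<epsilon>. eval xs \<epsilon> b = g xs \<epsilon>"
    using assms by (auto simp: expressible_def)
  then show ?thesis by (intro expressibleI[of "Sub a b"]) simp
qed

lemma expressible_sum:
  assumes "expressible f" "expressible g"
  shows "expressible (\<lambda>xs \<epsilon>. \<Sum>i<f xs \<epsilon>. g xs (\<epsilon>(v := i)))"
proof -
  obtain a b where "\<And>xs \<epsilon>. eval xs \<epsilon> a = f xs \<epsilon>" "\<And>xs \<epsilon>. eval xs \<epsilon> b = g xs \<epsilon>"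
    using assms by (auto simp: expressible_def)
  then show ?thesis by (intro expressibleI[of "Sum v a b"]) simp
qed

text \<open>Multiplication is a sum with a constant summand; the index has to be fresh for
  \<open>b\<close>, or it would be captured.\<close>

lemma expressible_mult:
  assumes "expressible f" "expressible g"
  shows "expressible (\<lambda>xs \<epsilon>. f xs \<epsilon> * g xs \<epsilon>)"
proof -
  obtain a b where ab: "\<And>xs \<epsilon>. eval xs \<epsilon> a = f xs \<epsilon>" "\<And>xs \<epsilon>. eval xs \<epsilon> b = g xs \<epsilon>"
    using assms by (auto simp: expressible_def)
  obtain z where z: "z \<notin> vars b" using ex_new_if_finite[OF infinite_UNIV_nat finite_vars] by blast
  have "eval xs (\<epsilon>(z := i)) b = eval xs \<epsilon> b" for xs \<epsilon> i
    by (rule eval_cong) (use z in auto)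
  then show ?thesis by (intro expressibleI[of "Sum z a b"]) (simp add: ab)
qed

lemma expressible_comp1:
  assumes "expressible (\<lambda>xs \<epsilon>. F xs (\<epsilon> 0))" "expressible f"
  shows "expressible (\<lambda>xs \<epsilon>. F xs (f xs \<epsilon>))"
proof -
  obtain a b where "\<And>xs \<epsilon>. eval xs \<epsilon> a = F xs (\<epsilon> 0)" "\<And>xs \<epsilon>. eval xs \<epsilon> b = f xs \<epsilon>"
    using assms by (auto simp: expressible_def)
  then show ?thesis by (intro expressibleI[of "Let_in 0 b a"]) simp
qed

text \<open>The substitution must be simultaneous: \<open>g\<close> may mention variable 0 and
  \<open>f\<close> may mention variable 1. The value of \<open>f\<close> is parked in a fresh
  \<open>z\<close> until \<open>g\<close> has been evaluated.\<close>

lemma expressible_comp2: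
  assumes "expressible (\<lambda>xs \<epsilon>. F xs (\<epsilon> 0) (\<epsilon> 1))" "expressible f" "expressible g"
  shows "expressible (\<lambda>xs \<epsilon>. F xs (f xs \<epsilon>) (g xs \<epsilon>))"
proof -
  obtain a b c where ab: "\<And>xs \<epsilon>. eval xs \<epsilon> a = F xs (\<epsilon> 0) (\<epsilon> 1)"
     "\<And>xs \<epsilon>. eval xs \<epsilon> b = f xs \<epsilon>" "\<And>xs \<epsilon>. eval xs \<epsilon> c = g xs \<epsilon>"
    using assms by (auto simp: expressible_def)
  have "finite (insert 1 (vars c))" by (simp add: finite_vars)
  then obtain z where z: "z \<notin> insert 1 (vars c)" using ex_new_if_finite[OF infinite_UNIV_nat] by blast
  have c: "eval xs (\<epsilon>(z := i)) c = g xs \<epsilon>" for xs \<epsilon> i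
    unfolding ab(3)[symmetric] by (rule eval_cong) (use z in auto)
  show ?thesis
    by (rule expressibleI[of "Let_in z b (Let_in 1 c (Let_in 0 (Var z) a))"])
      (use z in \<open>simp add: ab(1,2) c\<close>)
qed

definition decidable :: "(bool list list \<Rightarrow> (nat \<Rightarrow> nat) \<Rightarrow> bool) \<Rightarrow> bool" where
  "decidable P \<longleftrightarrow> expressible (\<lambda>xs \<epsilon>. of_bool (P xs \<epsilon>))"

lemma decidable_bit:
  assumes "expressible f"
  shows "decidable (\<lambda>xs \<epsilon>. in_bit xs i (f xs \<epsilon>))"
proof -
  obtain a where "\<And>xs \<epsilon>. eval xs \<epsilon> a = f xs \<epsilon>"
    using assms by (auto simp: expressible_def)
  then show ?thesis unfolding decidable_def by (intro expressibleI[of "Inp i a"]) simp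
qed

lemma decidable_le:
  assumes "expressible f" "expressible g"
  shows "decidable (\<lambda>xs \<epsilon>. f xs \<epsilon> \<le> g xs \<epsilon>)"
proof -
  have "expressible (\<lambda>xs \<epsilon>. 1 - (f xs \<epsilon> - g xs \<epsilon>))"
    by (intro expressible_diff expressible_const assms)
  also have "(\<lambda>xs \<epsilon>. 1 - (f xs \<epsilon> - g xs \<epsilon>)) = (\<lambda>xs \<epsilon>. of_bool (f xs \<epsilon> \<le> g xs \<epsilon>))"
    by (auto simp: fun_eq_iff)
  finally show ?thesis unfolding decidable_def .
qed

lemma decidable_less: "expressible f \<Longrightarrow> expressible g \<Longrightarrow> decidable (\<lambda>xs \<epsilon>. f xs \<epsilon> < g xs \<epsilon>)"
  using decidable_le[OF expressible_Suc, of f g] by (simp add: Suc_le_eq)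

lemma decidable_conj:
  assumes "decidable P" "decidable Q"
  shows "decidable (\<lambda>xs \<epsilon>. P xs \<epsilon> \<and> Q xs \<epsilon>)"
  using expressible_mult[OF assms[unfolded decidable_def]]
  by (simp add: decidable_def of_bool_conj)

lemma decidable_not:
  assumes "decidable P"
  shows "decidable (\<lambda>xs \<epsilon>. \<not> P xs \<epsilon>)"
proof -
  have "expressible (\<lambda>xs \<epsilon>. 1 - of_bool (P xs \<epsilon>))"
    using assms unfolding decidable_def by (intro expressible_diff expressible_const)
  also have "(\<lambda>xs \<epsilon>. 1 - of_bool (P xs \<epsilon>)) = (\<lambda>xs \<epsilon>. of_bool (\<not> P xs \<epsilon>) :: nat)"
    by (auto simp: fun_eq_iff)
  finally show ?thesis unfolding decidable_def .
qed

lemma decidable_disj: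
  assumes "decidable P" "decidable Q"
  shows "decidable (\<lambda>xs \<epsilon>. P xs \<epsilon> \<or> Q xs \<epsilon>)"
  using decidable_not[OF decidable_conj[OF decidable_not[OF assms(1)] decidable_not[OF assms(2)]]]
  by simp

lemma decidable_imp:
  assumes "decidable P" "decidable Q"
  shows "decidable (\<lambda>xs \<epsilon>. P xs \<epsilon> \<longrightarrow> Q xs \<epsilon>)"
  using decidable_disj[OF decidable_not[OF assms(1)] assms(2)] by (simp only: imp_conv_disj)

lemma decidable_eq:
  assumes "expressible f" "expressible g"
  shows "decidable (\<lambda>xs \<epsilon>. f xs \<epsilon> = g xs \<epsilon>)"
proof -
  have "(\<lambda>xs \<epsilon>. f xs \<epsilon> = g xs \<epsilon>) = (\<lambda>xs \<epsilon>. f xs \<epsilon> \<le> g xs \<epsilon> \<and> g xs \<epsilon> \<le> f xs \<epsilon>)"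
    by (auto simp: fun_eq_iff)
  then show ?thesis by (simp only: decidable_conj decidable_le assms)
qed

lemma expressible_of_bool: "decidable P \<Longrightarrow> expressible (\<lambda>xs \<epsilon>. of_bool (P xs \<epsilon>))"
  by (simp add: decidable_def)

lemma expressible_if:
  assumes "decidable P" "expressible f" "expressible g"
  shows "expressible (\<lambda>xs \<epsilon>. if P xs \<epsilon> then f xs \<epsilon> else g xs \<epsilon>)"
proof -
  have "expressible (\<lambda>xs \<epsilon>. of_bool (P xs \<epsilon>) * f xs \<epsilon> + of_bool (\<not> P xs \<epsilon>) * g xs \<epsilon>)"
    by (intro expressible_add expressible_mult expressible_of_bool decidable_not assms)
  also have "(\<lambda>xs \<epsilon>. of_bool (P xs \<epsilon>) * f xs \<epsilon> + of_bool (\<not> P xs \<epsilon>) * g xs \<epsilon>) =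
     (\<lambda>xs \<epsilon>. if P xs \<epsilon> then f xs \<epsilon> else g xs \<epsilon>)"
    by (auto simp: fun_eq_iff)
  finally show ?thesis .
qed

lemma decidable_all:
  assumes "expressible f" "decidable P"
  shows "decidable (\<lambda>xs \<epsilon>. \<forall>i<f xs \<epsilon>. P xs (\<epsilon>(v := i)))"
proof -
  have "decidable (\<lambda>xs \<epsilon>. (\<Sum>i<f xs \<epsilon>. of_bool (\<not> P xs (\<epsilon>(v := i)))) = (0::nat))"
    using assms(2)
    by (intro decidable_eq expressible_sum[where g = "\<lambda>xs \<epsilon>. of_bool (\<not> P xs \<epsilon>)"] assms(1)
        expressible_const expressible_of_bool decidable_not)
  then show ?thesis by (simp add: Ball_def del: sum_of_bool_eq)
qed

lemma decidable_ex:
  assumes "expressible f" "decidable P"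
  shows "decidable (\<lambda>xs \<epsilon>. \<exists>i<f xs \<epsilon>. P xs (\<epsilon>(v := i)))"
  using decidable_not[OF decidable_all[OF assms(1) decidable_not[OF assms(2)]]] by simp

lemmas expressible_basic = expressible_const expressible_var expressible_len expressible_add
  expressible_Suc expressible_diff expressible_mult expressible_if expressible_of_bool
  decidable_bit decidable_le decidable_less decidable_conj decidable_not
  decidable_disj decidable_imp decidable_eq

text \<open>The quotient counts the positive multiples of \<open>b\<close> up to \<open>a\<close>;
  as \<open>b\<close> is positive, their multipliers \<open>Suc i\<close> are at most
  \<open>a\<close>.\<close>

lemma div_eq_sum: "0 < b \<Longrightarrow> a div b = (\<Sum>i<a. of_bool (Suc i * b \<le> a))" for a b :: nat
proof -
  assume b: "0 < b"
  have "{i. i < a \<and> Suc i * b \<le> a} = {..<a div b}"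
  proof safe
    fix i assume "Suc i * b \<le> a"
    then have "Suc i \<le> a div b" using b by (simp add: less_eq_div_iff_mult_less_eq)
    then show "i < a div b" by simp
  next
    fix i assume i: "i < a div b"
    then show "i < a" using div_le_dividend[of a b] by linarith
    from i have "Suc i \<le> a div b" by simp
    then show "Suc i * b \<le> a" using b by (simp only: less_eq_div_iff_mult_less_eq)
  qed
  moreover have "(\<Sum>i<a. of_bool (Suc i * b \<le> a)) = card ({..<a} \<inter> {i. Suc i * b \<le> a})"
    by simp
  moreover have "{..<a} \<inter> {i. Suc i * b \<le> a} = {i. i < a \<and> Suc i * b \<le> a}" by auto
  ultimately show "a div b = (\<Sum>i<a. of_bool (Suc i * b \<le> a))" by simp
qed

lemma expressible_div:
  assumes "expressible f" "expressible g"
  shows "expressible (\<lambda>xs \<epsilon>. f xs \<epsilon> div g xs \<epsilon>)"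
proof (rule expressible_comp2[OF _ assms])
  \<comment> \<open>The case distinction matches the convention that division by 0 gives 0; the sum
    alone would give \<open>\<epsilon> 0\<close>.\<close>
  have "expressible (\<lambda>xs \<epsilon>. if 0 < \<epsilon> 1 then \<Sum>i<\<epsilon> (0::nat). (\<lambda>xs \<epsilon>. of_bool (Suc (\<epsilon> 2) * \<epsilon> 1 \<le> \<epsilon> 0)) xs (\<epsilon>(2 := i)) else 0)"
    by (intro expressible_basic expressible_sum)
  also have "(\<lambda>xs \<epsilon>. if 0 < \<epsilon> 1 then \<Sum>i<\<epsilon> (0::nat). (\<lambda>xs \<epsilon>. of_bool (Suc (\<epsilon> 2) * \<epsilon> 1 \<le> \<epsilon> 0)) xs (\<epsilon>(2 := i)) else 0)
      = (\<lambda>(xs :: bool list list) \<epsilon>. \<epsilon> 0 div \<epsilon> (1::nat))"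
    by (auto simp: fun_eq_iff div_eq_sum simp del: mult_Suc sum_of_bool_eq)
  finally show "expressible (\<lambda>xs \<epsilon>. \<epsilon> 0 div \<epsilon> 1)" .
qed

lemma expressible_mod:
  assumes "expressible f" "expressible g"
  shows "expressible (\<lambda>xs \<epsilon>. f xs \<epsilon> mod g xs \<epsilon>)"
  unfolding minus_div_mult_eq_mod[symmetric] by (intro expressible_diff expressible_mult expressible_div assms)

text \<open>\<open>F\<close> is arbitrary: on a range fixed independently of the input, its values
  are hard-wired. Through such tables the transition function of a machine enters an
  expression.\<close>

lemma expressible_table:
  assumes "expressible f"
  shows "expressible (\<lambda>xs \<epsilon>. if f xs \<epsilon> < K then F (f xs \<epsilon>) else 0)"
proof (induction K)
  case (Suc K)
  have "expressible (\<lambda>xs \<epsilon>. if f xs \<epsilon> = K then F K else (if f xs \<epsilon> < K then F (f xs \<epsilon>) else 0))"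
    by (intro expressible_basic Suc assms)
  also have "(\<lambda>xs \<epsilon>. if f xs \<epsilon> = K then F K else (if f xs \<epsilon> < K then F (f xs \<epsilon>) else 0)) =
     (\<lambda>xs \<epsilon>. if f xs \<epsilon> < Suc K then F (f xs \<epsilon>) else 0)"
    by (auto simp: fun_eq_iff)
  finally show ?case .
qed (simp add: expressible_const)

lemma expressible_poly:
  assumes "expressible f"
  shows "expressible (\<lambda>xs \<epsilon>. poly p (f xs \<epsilon>))"
proof (induction p)
  case (pCons a p)
  then show ?case unfolding poly_pCons by (intro expressible_basic assms)
qed (simp add: expressible_const)

lemma expressible_prod_encode:
  assumes "expressible f" "expressible g"
  shows "expressible (\<lambda>xs \<epsilon>. prod_encode (f xs \<epsilon>, g xs \<epsilon>))"
  unfolding prod_encode_def triangle_def prod.case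
  by (intro expressible_basic expressible_div assms)

text \<open>Unpairing by exhaustive search: the components do not exceed the code, and only the
  right pair contributes to the double sum.\<close>

lemma prod_decode_eq_sum:
  "fst (prod_decode n) = (\<Sum>i<Suc n. \<Sum>j<Suc n. if prod_encode (i, j) = n then i else 0)"
  "snd (prod_decode n) = (\<Sum>i<Suc n. \<Sum>j<Suc n. if prod_encode (i, j) = n then j else 0)"
proof -
  obtain a b where ab: "prod_decode n = (a, b)" by (cases "prod_decode n")
  then have n: "n = prod_encode (a, b)" by (metis prod_decode_inverse)
  have bnd: "a < Suc n" "b < Suc n" unfolding n by (simp_all add: le_imp_less_Suc le_prod_encode_1 le_prod_encode_2)
  have "(\<Sum>i<Suc n. \<Sum>j<Suc n. if prod_encode (i, j) = n then g i j else 0) = g a b" for g :: "nat \<Rightarrow> nat \<Rightarrow> nat"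
  proof -
    have "(\<Sum>i<Suc n. \<Sum>j<Suc n. if prod_encode (i, j) = n then g i j else 0) =
      (\<Sum>i<Suc n. if i = a then (\<Sum>j<Suc n. if j = b then g i j else 0) else 0)"
      by (intro sum.cong refl) (auto simp: n prod_encode_eq)
    also have "\<dots> = g a b" using bnd by (simp only: sum.delta finite_lessThan lessThan_iff if_True)
    finally show ?thesis .
  qed
  then show "fst (prod_decode n) = (\<Sum>i<Suc n. \<Sum>j<Suc n. if prod_encode (i, j) = n then i else 0)"
    "snd (prod_decode n) = (\<Sum>i<Suc n. \<Sum>j<Suc n. if prod_encode (i, j) = n then j else 0)"
    unfolding ab by (simp_all del: sum.lessThan_Suc)
qed

lemma expressible_prod_decode:
  assumes "expressible f"
  shows "expressible (\<lambda>xs \<epsilon>. fst (prod_decode (f xs \<epsilon>)))"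
    and "expressible (\<lambda>xs \<epsilon>. snd (prod_decode (f xs \<epsilon>)))"
proof -
  have "expressible (\<lambda>xs \<epsilon>. \<Sum>i<Suc (\<epsilon> 0). (\<lambda>xs \<epsilon>. \<Sum>j<Suc (\<epsilon> 0).
     (\<lambda>xs \<epsilon>. if prod_encode (\<epsilon> 1, \<epsilon> 2) = \<epsilon> 0 then \<epsilon> 1 else 0) xs (\<epsilon>(2 := j))) xs (\<epsilon>(1 := i)))"
    by (intro expressible_basic expressible_sum expressible_prod_encode)
  then show "expressible (\<lambda>xs \<epsilon>. fst (prod_decode (f xs \<epsilon>)))"
    by (intro expressible_comp1[OF _ assms, of "\<lambda>_ n. fst (prod_decode n)"])
      (simp add: prod_decode_eq_sum del: sum.lessThan_Suc lessThan_Suc cong: if_cong)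
  have "expressible (\<lambda>xs \<epsilon>. \<Sum>i<Suc (\<epsilon> 0). (\<lambda>xs \<epsilon>. \<Sum>j<Suc (\<epsilon> 0).
     (\<lambda>xs \<epsilon>. if prod_encode (\<epsilon> 1, \<epsilon> 2) = \<epsilon> 0 then \<epsilon> 2 else 0) xs (\<epsilon>(2 := j))) xs (\<epsilon>(1 := i)))"
    by (intro expressible_basic expressible_sum expressible_prod_encode)
  then show "expressible (\<lambda>xs \<epsilon>. snd (prod_decode (f xs \<epsilon>)))"
    by (intro expressible_comp1[OF _ assms, of "\<lambda>_ n. snd (prod_decode n)"])
      (simp add: prod_decode_eq_sum del: sum.lessThan_Suc lessThan_Suc cong: if_cong)
qed

lemmas expressible_intros = expressible_basic expressible_div expressible_mod
  expressible_prod_encode expressible_prod_decode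

lemma polytime_functionI:
  assumes "expressible N" "decidable B"
    "\<And>x. f x = map (\<lambda>k. B [x] (\<lambda>_. k)) [0..<N [x] (\<lambda>_. 0)]"
  shows "polytime_function f"
proof -
  obtain a b where "\<And>xs \<epsilon>. eval xs \<epsilon> a = N xs \<epsilon>" "\<And>xs \<epsilon>. eval xs \<epsilon> b = of_bool (B xs \<epsilon>)"
    using assms by (auto simp: expressible_def decidable_def)
  then show ?thesis by (intro polytime_function_eval[of _ b a]) (simp add: assms(3))
qed

lemma polytime_relationI:
  assumes "decidable B" "\<And>x y. R x y \<longleftrightarrow> B [x, y] (\<lambda>_. 0)"
  shows "polytime_relation R"
proof -
  obtain b where "\<And>xs \<epsilon>. eval xs \<epsilon> b = of_bool (B xs \<epsilon>)"
    using assms by (auto simp: expressible_def decidable_def)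
  then show ?thesis by (intro polytime_relation_eval[of _ b]) (simp add: assms(2))
qed

section \<open>Two labels on cubic graphs\<close>

lemma sum_two_labels:
  fixes p q :: nat
  assumes "finite A" "card A = 3" "\<And>w. w \<in> A \<Longrightarrow> c w = (if b w then q else p)"
  shows "(\<Sum>w\<in>A. c w) = q * card {w\<in>A. b w} + p * (3 - card {w\<in>A. b w})"
proof -
  have "(\<Sum>w\<in>A. c w) = (\<Sum>w\<in>A. if b w then q else p)"
    by (rule sum.cong) (use assms in auto)
  also have "\<dots> = (\<Sum>w\<in>A \<inter> {w. b w}. q) + (\<Sum>w\<in>A \<inter> - {w. b w}. p)"
    using sum.If_cases[OF assms(1), of b "\<lambda>_. q" "\<lambda>_. p"] by simp
  also have "A \<inter> {w. b w} = {w\<in>A. b w}" by auto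
  also have "A \<inter> - {w. b w} = A - {w\<in>A. b w}" by auto
  also have "card (A - {w\<in>A. b w}) = 3 - card {w\<in>A. b w}"
    using assms by (subst card_Diff_subset) auto
  ultimately show ?thesis using assms(1) by (simp add: card_Diff_subset assms(2))
qed

lemma finite_nbhd: "simple_graph V E \<Longrightarrow> finite (nbhd V E v)"
  by (simp add: simple_graph_def nbhd_def)

lemma cubic_sigma_coloring_card:
  assumes reg: "regular_graph 3 V E" and ne: "V \<noteq> {}" and c: "sigma_coloring V E c"
  shows "2 \<le> card (c ` V)"
proof (rule ccontr)
  assume "\<not> 2 \<le> card (c ` V)"
  moreover have "finite V" using reg by (simp add: regular_graph_def simple_graph_def)
  ultimately have "card (c ` V) \<le> Suc 0" by simp
  then have const: "c u = c v" if "u \<in> V" "v \<in> V" for u v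
    using \<open>finite V\<close> that by (metis card_le_Suc0_iff_eq finite_imageI imageI)
  obtain v where v: "v \<in> V" using ne by blast
  have deg: "card (nbhd V E u) = 3" if "u \<in> V" for u using reg that by (simp add: regular_graph_def)
  have "nbhd V E v \<noteq> {}" using deg[OF v] by force
  then obtain u where u: "u \<in> V" "{v, u} \<in> E" unfolding nbhd_def by blast
  have "(\<Sum>w\<in>nbhd V E x. c w) = 3 * c v" if "x \<in> V" for x
  proof -
    have "(\<Sum>w\<in>nbhd V E x. c w) = (\<Sum>w\<in>nbhd V E x. c v)"
      by (rule sum.cong[OF refl], rule const[OF _ v]) (simp add: nbhd_def)
    then show ?thesis using deg[OF that] by simp
  qed
  then show False using c u v by (auto simp: sigma_coloring_def)
qed

text \<open>With three neighbours and two labels the sum is determined by how many neighbours carry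
  the second label, so different sums need different counts. Conversely, labels 0 and 1 make the sum
  equal to the count. That one label never suffices needs an edge, hence
  \<open>V \<noteq> {}\<close>.\<close>

lemma cubic_sigma_2_iff:
  assumes reg: "regular_graph 3 V E" and ne: "V \<noteq> {}"
  shows "sigma_chromatic_number V E = 2 \<longleftrightarrow>
    (\<exists>b. \<forall>u\<in>V. \<forall>v\<in>V. {u, v} \<in> E \<longrightarrow> card {w\<in>nbhd V E u. b w} \<noteq> card {w\<in>nbhd V E v. b w})"
    (is "?L \<longleftrightarrow> ?R")
proof
  have sg: "simple_graph V E" using reg by (simp add: regular_graph_def)
  have deg: "card (nbhd V E u) = 3" if "u \<in> V" for u using reg that by (simp add: regular_graph_def)
  note fin = finite_nbhd[OF sg]
  {
    assume L: ?L
    have "\<exists>k c. sigma_coloring V E c \<and> card (c ` V) = k" using sigma_coloring_exists[OF sg] by blast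
    from LeastI_ex[OF this] obtain c where c: "sigma_coloring V E c" "card (c ` V) = 2"
      using L unfolding sigma_chromatic_number_def by auto
    obtain p q where pq: "c ` V = {p, q}" using c(2) by (meson card_2_iff)
    define b where "b = (\<lambda>w. c w = q)"
    have "c w = (if b w then q else p)" if "w \<in> V" for w
      using pq that by (auto simp: b_def)
    then have "(\<Sum>w\<in>nbhd V E x. c w) = q * card {w\<in>nbhd V E x. b w} + p * (3 - card {w\<in>nbhd V E x. b w})"
      if "x \<in> V" for x
      by (intro sum_two_labels fin deg that) (auto simp: nbhd_def)
    then show ?R using c(1) unfolding sigma_coloring_def by (intro exI[of _ b]) metis
  next
    assume ?R
    then obtain b where b: "\<forall>u\<in>V. \<forall>v\<in>V. {u, v} \<in> E \<longrightarrow> card {w\<in>nbhd V E u. b w} \<noteq> card {w\<in>nbhd V E v. b w}"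
      by blast
    define c where "c = (\<lambda>w. if b w then 1 else 0 :: nat)"
    have "(\<Sum>w\<in>nbhd V E x. c w) = 1 * card {w\<in>nbhd V E x. b w} + 0 * (3 - card {w\<in>nbhd V E x. b w})"
      if "x \<in> V" for x
      by (intro sum_two_labels fin deg that) (auto simp: c_def)
    then have col: "sigma_coloring V E c" using b by (simp add: sigma_coloring_def)
    have "c ` V \<subseteq> {0, 1}" by (auto simp: c_def)
    then have "card (c ` V) \<le> card {0, 1 :: nat}" by (intro card_mono) auto
    with cubic_sigma_coloring_card[OF reg ne col] have "card (c ` V) = 2" by simp
    with col show ?L unfolding sigma_chromatic_number_def
      by (intro Least_equality) (use cubic_sigma_coloring_card[OF reg ne] in auto)
  }
qed

section \<open>Cubic graphs given by neighbour lists\<close>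

locale cubic_neighbours =
  fixes V :: "'a set" and nb :: "'a \<Rightarrow> 'a list" and enc :: "'a \<Rightarrow> nat" and N :: nat
  assumes bij: "bij_betw enc V {..<N}"
    and closed: "a \<in> V \<Longrightarrow> set (nb a) \<subseteq> V"
    and symmetric: "a \<in> V \<Longrightarrow> b \<in> set (nb a) \<Longrightarrow> a \<in> set (nb b)"
    and irreflexive: "a \<in> V \<Longrightarrow> a \<notin> set (nb a)"
    and distinct: "a \<in> V \<Longrightarrow> distinct (nb a)"
    and three: "a \<in> V \<Longrightarrow> length (nb a) = 3"
    and nonempty: "V \<noteq> {}"
begin

definition edges :: "nat set set" where
  "edges = {{enc a, enc b} | a b. a \<in> V \<and> b \<in> set (nb a)}"

lemma enc_eq: "a \<in> V \<Longrightarrow> b \<in> V \<Longrightarrow> enc a = enc b \<longleftrightarrow> a = b"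
  using bij by (auto simp: bij_betw_def inj_on_def)

lemma edge_iff:
  assumes "a \<in> V" "b \<in> V"
  shows "{enc a, enc b} \<in> edges \<longleftrightarrow> b \<in> set (nb a)"
proof
  assume "{enc a, enc b} \<in> edges"
  then obtain a' b' where ab: "{enc a, enc b} = {enc a', enc b'}" "a' \<in> V" "b' \<in> set (nb a')"
    unfolding edges_def by blast
  have "b' \<in> V" using ab closed by blast
  then have "a = a' \<and> b = b' \<or> a = b' \<and> b = a'"
    using ab(1,2) assms by (simp add: doubleton_eq_iff enc_eq)
  then show "b \<in> set (nb a)" using ab symmetric by blast
next
  assume "b \<in> set (nb a)"
  then show "{enc a, enc b} \<in> edges" using assms unfolding edges_def by blast
qed

lemma enc_image: "enc ` V = {..<N}"
  using bij by (simp add: bij_betw_def)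

lemma nbhd_enc: "a \<in> V \<Longrightarrow> nbhd {..<N} edges (enc a) = enc ` set (nb a)"
  unfolding nbhd_def enc_image[symmetric] using closed[of a] by (auto simp: edge_iff subset_iff)

lemma inj_on_nb: "a \<in> V \<Longrightarrow> inj_on enc (set (nb a))"
  using bij closed by (auto simp: bij_betw_def intro: inj_on_subset)

lemma regular: "regular_graph 3 {..<N} edges"
proof -
  have "e \<subseteq> {..<N} \<and> card e = 2" if "e \<in> edges" for e
  proof -
    obtain a b where e: "e = {enc a, enc b}" and a: "a \<in> V" and b: "b \<in> set (nb a)"
      using \<open>e \<in> edges\<close> by (auto simp: edges_def)
    have "b \<in> V" "a \<noteq> b" using a b closed irreflexive by blast+
    then show ?thesis using a enc_image enc_eq[of a b] unfolding e by (auto simp: card_insert_if)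
  qed
  moreover have "card (nbhd {..<N} edges v) = 3" if v: "v \<in> {..<N}" for v
  proof -
    obtain a where a: "a \<in> V" "v = enc a" using v enc_image by (metis imageE)
    then show ?thesis using distinct_card[OF distinct[OF a(1)]]
      by (simp add: nbhd_enc card_image inj_on_nb three)
  qed
  ultimately show ?thesis by (simp add: regular_graph_def simple_graph_def)
qed

text \<open>As the lists are distinct, counting in a neighbourhood becomes
  \<open>length (filter ...)\<close>, which simplification can evaluate at a vertex in constructor
  form.\<close>

lemma sigma_2_iff:
  "sigma_chromatic_number {..<N} edges = 2 \<longleftrightarrow>
     (\<exists>\<beta>. \<forall>a\<in>V. \<forall>b\<in>set (nb a). length (filter \<beta> (nb a)) \<noteq> length (filter \<beta> (nb b)))"
proof -
  have ne: "{..<N} \<noteq> {}" using nonempty enc_image by auto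
  have cnt: "card {w \<in> nbhd {..<N} edges (enc a). \<beta> w} = length (filter (\<lambda>x. \<beta> (enc x)) (nb a))"
    if a: "a \<in> V" for a \<beta>
  proof -
    have "{w \<in> nbhd {..<N} edges (enc a). \<beta> w} = enc ` set (filter (\<lambda>x. \<beta> (enc x)) (nb a))"
      using nbhd_enc[OF a] by auto
    moreover have "inj_on enc (set (filter (\<lambda>x. \<beta> (enc x)) (nb a)))"
      using inj_on_nb[OF a] by (rule inj_on_subset) auto
    ultimately show ?thesis using distinct[OF a] by (simp add: card_image flip: distinct_card)
  qed
  have "sigma_chromatic_number {..<N} edges = 2 \<longleftrightarrow>
     (\<exists>\<beta>. \<forall>a\<in>V. \<forall>b\<in>V. {enc a, enc b} \<in> edges \<longrightarrow>
        length (filter (\<lambda>x. \<beta> (enc x)) (nb a)) \<noteq> length (filter (\<lambda>x. \<beta> (enc x)) (nb b)))"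
    unfolding cubic_sigma_2_iff[OF regular ne] unfolding enc_image[symmetric] ball_simps
    by (simp add: cnt[unfolded enc_image[symmetric]] cong: ball_cong)
  also have "\<dots> \<longleftrightarrow> (\<exists>\<beta>. \<forall>a\<in>V. \<forall>b\<in>set (nb a).
        length (filter (\<lambda>x. \<beta> (enc x)) (nb a)) \<noteq> length (filter (\<lambda>x. \<beta> (enc x)) (nb b)))"
    using closed by (intro ex_cong1) (auto simp: edge_iff)
  also have "\<dots> \<longleftrightarrow> (\<exists>\<beta>. \<forall>a\<in>V. \<forall>b\<in>set (nb a). length (filter \<beta> (nb a)) \<noteq> length (filter \<beta> (nb b)))"
  proof safe
    fix \<beta> assume *: "\<forall>a\<in>V. \<forall>b\<in>set (nb a). length (filter \<beta> (nb a)) \<noteq> length (filter \<beta> (nb b))"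
    \<comment> \<open>Transport of a labelling of the abstract vertices to the numbers, along the
      inverse of \<open>enc\<close>.\<close>
    define \<gamma> where "\<gamma> = (\<lambda>x. \<beta> (inv_into V enc x))"
    have inv: "inv_into V enc (enc x) = x" if "x \<in> V" for x
      using that bij by (simp add: bij_betw_def)
    have "filter (\<lambda>x. \<gamma> (enc x)) (nb a) = filter \<beta> (nb a)" if "a \<in> V" for a
      by (rule filter_cong) (use closed[OF that] inv in \<open>auto simp: \<gamma>_def\<close>)
    with * show "\<exists>\<beta>. \<forall>a\<in>V. \<forall>b\<in>set (nb a).
        length (filter (\<lambda>x. \<beta> (enc x)) (nb a)) \<noteq> length (filter (\<lambda>x. \<beta> (enc x)) (nb b))"
      using closed by (intro exI[of _ \<gamma>]) (auto simp: subset_iff)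
  qed blast
  finally show ?thesis .
qed

end

text \<open>The edge between \<open>u\<close> and \<open>w\<close> gives
  \<open>u \<noteq> w\<close>. With \<open>s\<close> the number of true values among
  \<open>x\<close> and \<open>y\<close>, the vertices \<open>u\<close> and \<open>w\<close> then see
  \<open>s\<close> and \<open>s + 1\<close> true neighbours in some order, while \<open>x\<close>
  sees one more than the value of \<open>h1\<close>. So a false \<open>h1\<close> forces
  \<open>s = 2\<close> and a true one \<open>s = 0\<close>; the same holds for \<open>h2\<close>. In
  particular \<open>x\<close> and \<open>y\<close> are opposite to the hubs.\<close>

lemma diamond_rigid:
  fixes h1 h2 x y u w :: bool
  assumes "length (filter id [h1, u, w]) \<noteq> length (filter id [w, x, y])"
    "length (filter id [h1, u, w]) \<noteq> length (filter id [u, x, y])"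
    "length (filter id [h2, u, w]) \<noteq> length (filter id [w, x, y])"
    "length (filter id [h2, u, w]) \<noteq> length (filter id [u, x, y])"
    "length (filter id [w, x, y]) \<noteq> length (filter id [u, x, y])"
  shows "h1 = h2"
  using assms by (cases h1; cases h2; cases x; cases y; cases u; cases w) simp_all

text \<open>If the outer values agreed, the counts could differ only through the omitted value
  \<open>t0\<close>, \<open>t1\<close> or \<open>t2\<close>, and three truth values cannot be
  pairwise different.\<close>

lemma triangle_not_all_equal:
  fixes h0 h1 h2 t0 t1 t2 :: bool
  assumes "length (filter id [h0, t1, t2]) \<noteq> length (filter id [h1, t2, t0])"
    "length (filter id [h1, t2, t0]) \<noteq> length (filter id [h2, t0, t1])"
    "length (filter id [h0, t1, t2]) \<noteq> length (filter id [h2, t0, t1])"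
  shows "\<not> (h0 = h1 \<and> h1 = h2)"
  using assms by (cases h0; cases h1; cases h2; cases t0; cases t1; cases t2) simp_all

section \<open>The cubic graph of a not-all-equal instance\<close>

datatype vertex = Hub nat nat | Dx nat nat | Dy nat nat | Du nat nat | Dw nat nat
  | Pin nat nat | Px nat nat | Py nat nat | Pu nat nat | Pw nat nat | Tri nat nat | Cap nat

text \<open>An instance of monotone not-all-equal satisfiability: slot \<open>3 c + k\<close> is the \<open>k\<close>-th
  position of clause \<open>c\<close>, and \<open>var\<close> gives the variable in each slot. Variable \<open>v\<close> is a ring of
  hubs \<open>Hub v j\<close>, one for each slot, with consecutive hubs joined through a diamond (\<open>K\<^sub>4\<close> minus
  an edge). The third edge of a hub goes to the clause triangle if the slot belongs to the
  variable, and otherwise to a hub \<open>Pin v j\<close> of a private ring with a single diamond. The hubs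
  \<open>Pin v j\<close> that are not needed for this purpose are joined in threes to the vertices \<open>Cap c\<close>.\<close>

locale nae_instance =
  fixes n m :: nat and var :: "nat \<Rightarrow> nat"
  assumes m: "0 < m" and var: "j < 3 * m \<Longrightarrow> var j < n"
begin

definition J :: nat where "J = 3 * m"

definition nx :: "nat \<Rightarrow> nat" where "nx j = (if Suc j = J then 0 else Suc j)"

definition pv :: "nat \<Rightarrow> nat" where "pv j = (if j = 0 then J - 1 else j - 1)"

fun nb :: "vertex \<Rightarrow> vertex list" where
  "nb (Hub v j) = [Dx v j, Dy v (pv j), if var j = v then Tri (j div 3) (j mod 3) else Pin v j]"
| "nb (Dx v j) = [Hub v j, Du v j, Dw v j]"
| "nb (Dy v j) = [Hub v (nx j), Du v j, Dw v j]"
| "nb (Du v j) = [Dw v j, Dx v j, Dy v j]"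
| "nb (Dw v j) = [Du v j, Dx v j, Dy v j]"
| "nb (Pin v j) = [Px v j, Py v j, if var j = v then Cap (j div 3) else Hub v j]"
| "nb (Px v j) = [Pin v j, Pu v j, Pw v j]"
| "nb (Py v j) = [Pin v j, Pu v j, Pw v j]"
| "nb (Pu v j) = [Pw v j, Px v j, Py v j]"
| "nb (Pw v j) = [Pu v j, Px v j, Py v j]"
| "nb (Tri c k) = [Hub (var (3 * c + k)) (3 * c + k), Tri c ((k + 1) mod 3), Tri c ((k + 2) mod 3)]"
| "nb (Cap c) = [Pin (var (3 * c)) (3 * c), Pin (var (3 * c + 1)) (3 * c + 1), Pin (var (3 * c + 2)) (3 * c + 2)]"

fun valid :: "vertex \<Rightarrow> bool" where
  "valid (Tri c k) \<longleftrightarrow> c < m \<and> k < 3"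
| "valid (Cap c) \<longleftrightarrow> c < m"
| "valid (Hub v j) \<longleftrightarrow> v < n \<and> j < J"
| "valid (Dx v j) \<longleftrightarrow> v < n \<and> j < J"
| "valid (Dy v j) \<longleftrightarrow> v < n \<and> j < J"
| "valid (Du v j) \<longleftrightarrow> v < n \<and> j < J"
| "valid (Dw v j) \<longleftrightarrow> v < n \<and> j < J"
| "valid (Pin v j) \<longleftrightarrow> v < n \<and> j < J"
| "valid (Px v j) \<longleftrightarrow> v < n \<and> j < J"
| "valid (Py v j) \<longleftrightarrow> v < n \<and> j < J"
| "valid (Pu v j) \<longleftrightarrow> v < n \<and> j < J"
| "valid (Pw v j) \<longleftrightarrow> v < n \<and> j < J"

text \<open>The ten roles for each pair of variable and slot. The pairs fill a whole rectangle, so a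
  number is decoded by \<open>div\<close> and \<open>mod\<close> alone.\<close>

definition cell :: "nat \<Rightarrow> nat \<Rightarrow> nat \<Rightarrow> nat" where
  "cell v j r = 10 * (v * J + j) + r"

fun enc :: "vertex \<Rightarrow> nat" where
  "enc (Hub v j) = cell v j 0"
| "enc (Dx v j) = cell v j 1"
| "enc (Dy v j) = cell v j 2"
| "enc (Du v j) = cell v j 3"
| "enc (Dw v j) = cell v j 4"
| "enc (Pin v j) = cell v j 5"
| "enc (Px v j) = cell v j 6"
| "enc (Py v j) = cell v j 7"
| "enc (Pu v j) = cell v j 8"
| "enc (Pw v j) = cell v j 9"
| "enc (Tri c k) = 10 * n * J + 3 * c + k"
| "enc (Cap c) = 10 * n * J + J + c"

definition N :: nat where "N = 10 * n * J + J + m"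

fun cell_vertex :: "nat \<Rightarrow> nat \<Rightarrow> nat \<Rightarrow> vertex" where
  "cell_vertex v j r = (if r = 0 then Hub v j else if r = 1 then Dx v j else if r = 2 then Dy v j
     else if r = 3 then Du v j else if r = 4 then Dw v j else if r = 5 then Pin v j
     else if r = 6 then Px v j else if r = 7 then Py v j else if r = 8 then Pu v j else Pw v j)"

definition dec :: "nat \<Rightarrow> vertex" where
  "dec i = (if i < 10 * n * J then cell_vertex (i div 10 div J) (i div 10 mod J) (i mod 10)
     else if i < 10 * n * J + J then Tri ((i - 10 * n * J) div 3) ((i - 10 * n * J) mod 3)
     else Cap (i - 10 * n * J - J))"

lemma J_pos: "0 < J" "3 \<le> J"
  using m by (auto simp: J_def)

lemma cell_less: "v < n \<Longrightarrow> j < J \<Longrightarrow> r < 10 \<Longrightarrow> cell v j r < 10 * n * J"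
proof -
  assume v: "v < n" and j: "j < J" and r: "r < 10"
  have "v * J + j < Suc v * J" using j by simp
  also have "\<dots> \<le> n * J" using v by (intro mult_le_mono1) simp
  finally have "Suc (v * J + j) \<le> n * J" by simp
  then have "10 * Suc (v * J + j) \<le> 10 * (n * J)" by (rule mult_le_mono2)
  then show ?thesis using r by (simp add: cell_def)
qed

lemma cell_mod: "r < 10 \<Longrightarrow> cell v j r mod 10 = r"
  unfolding cell_def by (simp only: mod_mult_self4 mod_less)

lemma cell_div: "r < 10 \<Longrightarrow> cell v j r div 10 = v * J + j"
  by (simp add: cell_def)

lemma cell_div_div: "r < 10 \<Longrightarrow> j < J \<Longrightarrow> cell v j r div 10 div J = v"
  by (simp add: cell_div)

lemma cell_div_mod: "r < 10 \<Longrightarrow> j < J \<Longrightarrow> cell v j r div 10 mod J = j"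
  by (simp add: cell_div)

lemmas cell_simps = cell_less cell_mod cell_div_div cell_div_mod

lemma slot_less: "c < m \<Longrightarrow> k < 3 \<Longrightarrow> 3 * c + k < J"
  by (simp add: J_def)

lemma dec_enc: "valid a \<Longrightarrow> dec (enc a) = a"
  by (cases a) (auto simp: dec_def cell_simps J_def[symmetric] dest: slot_less)

lemma enc_less: "valid a \<Longrightarrow> enc a < N"
proof (cases a)
  case (Tri c k)
  moreover assume "valid a"
  ultimately show ?thesis using slot_less[of c k] by (simp add: N_def)
next
  case (Cap c)
  moreover assume "valid a"
  ultimately show ?thesis by (simp add: N_def)
qed (auto simp: N_def intro!: trans_less_add1 cell_less)

lemma enc_dec: "i < N \<Longrightarrow> valid (dec i) \<and> enc (dec i) = i"
proof -
  assume i: "i < N"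
  consider "i < 10 * n * J" | "10 * n * J \<le> i" "i < 10 * n * J + J" | "10 * n * J + J \<le> i" by linarith
  then show ?thesis
  proof cases
    case 1
    define r where "r = i mod 10"
    define q where "q = i div 10"
    have iq: "i = 10 * q + r" "r < 10" by (simp_all add: q_def r_def)
    have "q < n * J" using 1 iq by linarith
    then have v: "q div J < n" by (simp add: less_mult_imp_div_less)
    have j: "q mod J < J" using J_pos by simp
    have c: "cell (q div J) (q mod J) r = i" by (simp add: cell_def iq)
    have d: "dec i = cell_vertex (q div J) (q mod J) r" using 1 by (simp add: dec_def q_def r_def)
    have "r \<in> {0, 1, 2, 3, 4, 5, 6, 7, 8, 9}" using iq(2) by auto
    then show ?thesis unfolding d using v j c by auto
  next
    case 2
    then have "(i - 10 * n * J) div 3 < m" by (auto simp: J_def)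
    moreover have "3 * ((i - 10 * n * J) div 3) + (i - 10 * n * J) mod 3 = i - 10 * n * J" by simp
    ultimately show ?thesis using 2 unfolding dec_def by (auto simp: add.assoc)
  next
    case 3
    then show ?thesis using i by (auto simp: dec_def N_def)
  qed
qed

lemma bij_enc: "bij_betw enc {a. valid a} {..<N}"
  by (rule bij_betw_byWitness[where f' = dec]) (auto simp: dec_enc enc_dec enc_less)

lemma nx_pv: "j < J \<Longrightarrow> nx (pv j) = j" "j < J \<Longrightarrow> pv (nx j) = j"
  "j < J \<Longrightarrow> nx j < J" "j < J \<Longrightarrow> pv j < J"
  using J_pos by (auto simp: nx_def pv_def)

lemma less_3_cases: "k < 3 \<longleftrightarrow> k = 0 \<or> k = 1 \<or> k = (2::nat)"
  by auto

lemma var_slot: "c < m \<Longrightarrow> k < 3 \<Longrightarrow> var (3 * c + k) < n"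
  using var slot_less by (simp add: J_def)

lemma div_slot: "j < J \<Longrightarrow> j div 3 < m" "3 * (j div 3) + j mod 3 = j"
  by (auto simp: J_def)

lemma slot_cases: "j = 3 * (j div 3) \<or> j = 3 * (j div 3) + 1 \<or> j = 3 * (j div 3) + 2" for j :: nat
  by presburger

lemma Suc_Suc_slot: "Suc (Suc (3 * c)) div 3 = c" "Suc (Suc (3 * c)) mod 3 = 2" for c :: nat
  by presburger+

sublocale cubic_neighbours "{a. valid a}" nb enc N
proof
  show "bij_betw enc {a. valid a} {..<N}" by (rule bij_enc)
  show "set (nb a) \<subseteq> {a. valid a}" if "a \<in> {a. valid a}" for a
    using that var_slot[of _ 0] var_slot[of _ 1] var_slot[of _ 2]
      slot_less[of _ 0] slot_less[of _ 1] slot_less[of _ 2]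
    by (cases a) (auto simp: nx_pv div_slot var_slot slot_less)
  show "a \<in> set (nb b)" if "a \<in> {a. valid a}" "b \<in> set (nb a)" for a b
    using that
  proof (cases a)
    case (Pin v j)
    show ?thesis
    proof (cases "var j = v \<and> b = Cap (j div 3)")
      case True
      \<comment> \<open>\<open>slot_cases\<close> brings \<open>j\<close> into the form in which the
        list of \<open>Cap\<close> names its three pins.\<close>
      then show ?thesis using slot_cases[of j] unfolding Pin by auto
    next
      case False
      then show ?thesis using that unfolding Pin by (auto split: if_splits)
    qed
  qed (auto simp: nx_pv div_slot less_3_cases Suc_Suc_slot split: if_splits)
  show "a \<notin> set (nb a)" if "a \<in> {a. valid a}" for a
    using that by (cases a) (auto simp: less_3_cases)
  show "distinct (nb a)" if "a \<in> {a. valid a}" for a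
    using that by (cases a) (auto simp: less_3_cases)
  show "length (nb a) = 3" if "a \<in> {a. valid a}" for a by (cases a) auto
  have "valid (Cap 0)" using m by simp
  then show "{a. valid a} \<noteq> {}" by blast
qed

lemma nb_Tri:
  "nb (Tri c 0) = [Hub (var (3 * c + 0)) (3 * c + 0), Tri c 1, Tri c 2]"
  "nb (Tri c 1) = [Hub (var (3 * c + 1)) (3 * c + 1), Tri c 2, Tri c 0]"
  "nb (Tri c 2) = [Hub (var (3 * c + 2)) (3 * c + 2), Tri c 0, Tri c 1]"
  by simp_all

lemma sigma_2_imp_nae:
  assumes "sigma_chromatic_number {..<N} edges = 2"
  shows "\<exists>f :: nat \<Rightarrow> bool. \<forall>c<m. \<not> (f (var (3 * c)) = f (var (3 * c + 1)) \<and> f (var (3 * c + 1)) = f (var (3 * c + 2)))"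
proof -
  obtain \<beta> where \<beta>: "\<And>a b. valid a \<Longrightarrow> b \<in> set (nb a) \<Longrightarrow> length (filter \<beta> (nb a)) \<noteq> length (filter \<beta> (nb b))"
    using assms unfolding sigma_2_iff by auto
  have filt: "length (filter \<beta> [a, b, c]) = length (filter id [\<beta> a, \<beta> b, \<beta> c])" for a b c
    by simp
  \<comment> \<open>The five premises of \<open>diamond_rigid\<close> are the conditions along the
    five edges of the diamond between two consecutive hubs.\<close>
  have ring: "\<beta> (Hub v j) = \<beta> (Hub v (nx j))" if "v < n" "j < J" for v j
  proof (rule diamond_rigid)
    show "length (filter id [\<beta> (Hub v j), \<beta> (Du v j), \<beta> (Dw v j)]) \<noteq> length (filter id [\<beta> (Dw v j), \<beta> (Dx v j), \<beta> (Dy v j)])"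
      using \<beta>[of "Dx v j" "Du v j"] that unfolding nb.simps filt by simp
    show "length (filter id [\<beta> (Hub v j), \<beta> (Du v j), \<beta> (Dw v j)]) \<noteq> length (filter id [\<beta> (Du v j), \<beta> (Dx v j), \<beta> (Dy v j)])"
      using \<beta>[of "Dx v j" "Dw v j"] that unfolding nb.simps filt by simp
    show "length (filter id [\<beta> (Hub v (nx j)), \<beta> (Du v j), \<beta> (Dw v j)]) \<noteq> length (filter id [\<beta> (Dw v j), \<beta> (Dx v j), \<beta> (Dy v j)])"
      using \<beta>[of "Dy v j" "Du v j"] that unfolding nb.simps filt by simp
    show "length (filter id [\<beta> (Hub v (nx j)), \<beta> (Du v j), \<beta> (Dw v j)]) \<noteq> length (filter id [\<beta> (Du v j), \<beta> (Dx v j), \<beta> (Dy v j)])"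
      using \<beta>[of "Dy v j" "Dw v j"] that unfolding nb.simps filt by simp
    show "length (filter id [\<beta> (Dw v j), \<beta> (Dx v j), \<beta> (Dy v j)]) \<noteq> length (filter id [\<beta> (Du v j), \<beta> (Dx v j), \<beta> (Dy v j)])"
      using \<beta>[of "Du v j" "Dw v j"] that unfolding nb.simps filt by simp
  qed
  have hub: "\<beta> (Hub v j) = \<beta> (Hub v 0)" if "v < n" "j < J" for v j
    using that(2)
  proof (induction j)
    case (Suc j)
    then show ?case using ring[OF that(1), of j] by (simp add: nx_def)
  qed simp
  define f where "f = (\<lambda>v. \<beta> (Hub v 0))"
  have "\<not> (f (var (3 * c)) = f (var (3 * c + 1)) \<and> f (var (3 * c + 1)) = f (var (3 * c + 2)))" if c: "c < m" for c
  proof -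
    have f: "f (var (3 * c + k)) = \<beta> (Hub (var (3 * c + k)) (3 * c + k))" if "k < 3" for k
      unfolding f_def using hub[OF var_slot[OF c that] slot_less[OF c that]] by simp
    let ?t = "\<lambda>k. \<beta> (Tri c k)"
    have T: "length (filter id [f (var (3 * c + 0)), ?t 1, ?t 2]) = length (filter \<beta> (nb (Tri c 0)))"
      "length (filter id [f (var (3 * c + 1)), ?t 2, ?t 0]) = length (filter \<beta> (nb (Tri c 1)))"
      "length (filter id [f (var (3 * c + 2)), ?t 0, ?t 1]) = length (filter \<beta> (nb (Tri c 2)))"
      unfolding nb_Tri filt using f[of 0] f[of 1] f[of 2] by simp_all
    have "\<not> (f (var (3 * c + 0)) = f (var (3 * c + 1)) \<and> f (var (3 * c + 1)) = f (var (3 * c + 2)))"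
    proof (rule triangle_not_all_equal[of _ "?t 1" "?t 2" _ "?t 0"])
      show "length (filter id [f (var (3 * c + 0)), ?t 1, ?t 2]) \<noteq> length (filter id [f (var (3 * c + 1)), ?t 2, ?t 0])"
        unfolding T by (rule \<beta>) (use c in \<open>auto simp: nb_Tri\<close>)
      show "length (filter id [f (var (3 * c + 1)), ?t 2, ?t 0]) \<noteq> length (filter id [f (var (3 * c + 2)), ?t 0, ?t 1])"
        unfolding T by (rule \<beta>) (use c in \<open>auto simp: nb_Tri\<close>)
      show "length (filter id [f (var (3 * c + 0)), ?t 1, ?t 2]) \<noteq> length (filter id [f (var (3 * c + 2)), ?t 0, ?t 1])"
        unfolding T by (rule \<beta>) (use c in \<open>auto simp: nb_Tri\<close>)
    qed
    then show ?thesis by simp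
  qed
  then show ?thesis by blast
qed

text \<open>The values of \<open>Dx\<close>, \<open>Dy\<close>, \<open>Px\<close> and
  \<open>Py\<close> are those forced by the diamonds; \<open>Du\<close> and \<open>Dw\<close> only
  have to differ. A pin attached to a hub is opposite to it, which makes all three neighbours of
  that hub equal. For truth values \<open>(a = b) = a\<close> is just \<open>b\<close>, so the
  triangle vertex at position \<open>k\<close> takes the value of the next position of its
  clause.\<close>

fun labelling :: "(nat \<Rightarrow> bool) \<Rightarrow> vertex \<Rightarrow> bool" where
  "labelling f (Hub v j) = f v"
| "labelling f (Dx v j) = (\<not> f v)"
| "labelling f (Dy v j) = (\<not> f v)"
| "labelling f (Du v j) = False"
| "labelling f (Dw v j) = True"
| "labelling f (Pin v j) = (var j \<noteq> v \<and> \<not> f v)"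
| "labelling f (Px v j) = (\<not> (var j \<noteq> v \<and> \<not> f v))"
| "labelling f (Py v j) = (\<not> (var j \<noteq> v \<and> \<not> f v))"
| "labelling f (Pu v j) = False"
| "labelling f (Pw v j) = True"
| "labelling f (Tri c k) = ((f (var (3 * c + k)) = f (var (3 * c + (k + 1) mod 3))) = f (var (3 * c + k)))"
| "labelling f (Cap c) = False"

text \<open>Let \<open>h0\<close>, \<open>h1\<close>, \<open>h2\<close> be the values in a clause,
  as 0 or 1, with indices modulo 3. Triangle vertex \<open>k\<close> has
  \<open>2 h_k + h_(k+2)\<close> true neighbours. If two of these numbers agreed, so would their
  binary digits, and then all three values. A true hub sees at most one true neighbour and a false
  one at least two, whereas its triangle vertex sees at least two or at most one, and its diamond
  neighbours exactly two or one, respectively.\<close>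

lemma nae_imp_sigma_2:
  fixes f :: "nat \<Rightarrow> bool"
  assumes f: "\<And>c. c < m \<Longrightarrow> \<not> (f (var (3 * c)) = f (var (3 * c + 1)) \<and> f (var (3 * c + 1)) = f (var (3 * c + 2)))"
  shows "sigma_chromatic_number {..<N} edges = 2"
proof -
  have lab: "labelling f (Tri c 0) = ((f (var (3 * c)) = f (var (3 * c + 1))) = f (var (3 * c)))"
    "labelling f (Tri c 1) = ((f (var (3 * c + 1)) = f (var (3 * c + 2))) = f (var (3 * c + 1)))"
    "labelling f (Tri c 2) = ((f (var (3 * c + 2)) = f (var (3 * c))) = f (var (3 * c + 2)))" for c
    by simp_all
  have "length (filter (labelling f) (nb a)) \<noteq> length (filter (labelling f) (nb b))"
    if a: "valid a" and b: "b \<in> set (nb a)" for a b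
    using a b
  proof (cases a)
    case (Hub v j)
    show ?thesis
    proof (cases "var j = v")
      case True
      obtain c k where j: "j = 3 * c + k" "k < 3" "c < m"
        using a Hub div_slot(1)[of j] div_slot(2)[of j] by (intro that[of "j div 3" "j mod 3"]) auto
      have k: "k = 0 \<or> k = 1 \<or> k = 2" using j(2) by auto
      have "j div 3 = c" "j mod 3 = k" using j by auto
      then have nbH: "nb a = [Dx v j, Dy v (pv j), Tri c k]" using True by (simp add: Hub)
      note fc = f[OF j(3)]
      show ?thesis
      proof (cases "b = Tri c k")
        case True': True
        show ?thesis using k fc unfolding nbH True' True[symmetric] j(1)
          by (elim disjE) (auto simp: nb_Tri lab simp del: nb.simps(11) labelling.simps(11) One_nat_def add_2_eq_Suc')
      next
        case False
        then show ?thesis using b unfolding nbH by (auto simp del: labelling.simps(11))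
      qed
    next
      case False
      then show ?thesis using b unfolding Hub by auto
    qed
  next
    case (Tri c k)
    then have c: "c < m" and k: "k = 0 \<or> k = 1 \<or> k = 2" using a by auto
    have sl: "(3 * c + 1) div 3 = c" "(3 * c + 1) mod 3 = 1"
      "(3 * c + 2) div 3 = c" "(3 * c + 2) mod 3 = 2"
      by (simp_all add: Suc_Suc_slot)
    have nbH: "nb (Hub (var (3 * c)) (3 * c)) = [Dx (var (3 * c)) (3 * c), Dy (var (3 * c)) (pv (3 * c)), Tri c 0]"
      "nb (Hub (var (3 * c + 1)) (3 * c + 1)) = [Dx (var (3 * c + 1)) (3 * c + 1), Dy (var (3 * c + 1)) (pv (3 * c + 1)), Tri c 1]"
      "nb (Hub (var (3 * c + 2)) (3 * c + 2)) = [Dx (var (3 * c + 2)) (3 * c + 2), Dy (var (3 * c + 2)) (pv (3 * c + 2)), Tri c 2]"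
      unfolding nb.simps sl by simp_all
    consider "b = Hub (var (3 * c + k)) (3 * c + k)" | "b = Tri c 0" | "b = Tri c 1" | "b = Tri c 2"
      using k b unfolding Tri by (elim disjE) (auto simp: nb_Tri simp del: nb.simps(11) One_nat_def add_2_eq_Suc')
    then show ?thesis
    proof cases
      case 1
      show ?thesis using k f[OF c] unfolding Tri 1
        by (elim disjE) (auto simp: nb_Tri nbH lab
            simp del: nb.simps(1,11) labelling.simps(11) One_nat_def add_2_eq_Suc')
    qed (use k b f[OF c] in \<open>unfold Tri, elim disjE,
        auto simp: nb_Tri lab split: if_splits
          simp del: nb.simps(11) labelling.simps(11) One_nat_def add_2_eq_Suc'\<close>)
  next
    case (Cap c)
    then show ?thesis using a b by auto
  next
    case (Pin v j)
    then show ?thesis using a b div_slot[of j] by auto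
  qed (auto split: if_splits)
  then show ?thesis unfolding sigma_2_iff by (intro exI[of _ "labelling f"]) auto
qed

lemma sigma_2_iff_nae: "sigma_chromatic_number {..<N} edges = 2 \<longleftrightarrow>
  (\<exists>f :: nat \<Rightarrow> bool. \<forall>c<m. \<not> (f (var (3 * c)) = f (var (3 * c + 1)) \<and> f (var (3 * c + 1)) = f (var (3 * c + 2))))"
  using sigma_2_imp_nae nae_imp_sigma_2 by blast

end

section \<open>Neighbours computed from vertex numbers\<close>

definition cell_code :: "nat \<Rightarrow> nat \<Rightarrow> nat \<Rightarrow> nat \<Rightarrow> nat" where
  "cell_code m v j r = 10 * (v * (3 * m) + j) + r"

text \<open>First position of the list \<open>nb\<close> on numbers, with \<open>r\<close> the role
  in the order of \<open>enc\<close>; \<open>nbn1\<close> and \<open>nbn2\<close> are the other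
  positions. For numbers beyond the rectangle of cells only \<open>i\<close> is consulted.\<close>

definition nbn0 :: "nat \<Rightarrow> nat \<Rightarrow> (nat \<Rightarrow> nat) \<Rightarrow> nat \<Rightarrow> nat \<Rightarrow> nat \<Rightarrow> nat \<Rightarrow> nat" where
  "nbn0 n m var v j r i =
    (if i < 10 * n * (3 * m) then
       if r = 0 then cell_code m v j 1 else if r = 1 then cell_code m v j 0
       else if r = 2 then cell_code m v (if Suc j = 3 * m then 0 else Suc j) 0
       else if r = 3 then cell_code m v j 4 else if r = 4 then cell_code m v j 3
       else if r = 5 then cell_code m v j 6 else if r = 6 then cell_code m v j 5
       else if r = 7 then cell_code m v j 5 else if r = 8 then cell_code m v j 9
       else cell_code m v j 8
     else if i < 10 * n * (3 * m) + 3 * m then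
       cell_code m (var (i - 10 * n * (3 * m))) (i - 10 * n * (3 * m)) 0
     else cell_code m (var (3 * (i - 10 * n * (3 * m) - 3 * m))) (3 * (i - 10 * n * (3 * m) - 3 * m)) 5)"

definition nbn1 :: "nat \<Rightarrow> nat \<Rightarrow> (nat \<Rightarrow> nat) \<Rightarrow> nat \<Rightarrow> nat \<Rightarrow> nat \<Rightarrow> nat \<Rightarrow> nat" where
  "nbn1 n m var v j r i =
    (if i < 10 * n * (3 * m) then
       if r = 0 then cell_code m v (if j = 0 then 3 * m - 1 else j - 1) 2
       else if r = 1 then cell_code m v j 3 else if r = 2 then cell_code m v j 3
       else if r = 3 then cell_code m v j 1 else if r = 4 then cell_code m v j 1
       else if r = 5 then cell_code m v j 7 else if r = 6 then cell_code m v j 8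
       else if r = 7 then cell_code m v j 8 else if r = 8 then cell_code m v j 6
       else cell_code m v j 6
     else if i < 10 * n * (3 * m) + 3 * m then
       10 * n * (3 * m) + 3 * ((i - 10 * n * (3 * m)) div 3) + ((i - 10 * n * (3 * m)) mod 3 + 1) mod 3
     else cell_code m (var (3 * (i - 10 * n * (3 * m) - 3 * m) + 1)) (3 * (i - 10 * n * (3 * m) - 3 * m) + 1) 5)"

definition nbn2 :: "nat \<Rightarrow> nat \<Rightarrow> (nat \<Rightarrow> nat) \<Rightarrow> nat \<Rightarrow> nat \<Rightarrow> nat \<Rightarrow> nat \<Rightarrow> nat" where
  "nbn2 n m var v j r i =
    (if i < 10 * n * (3 * m) then
       if r = 0 then if var j = v then 10 * n * (3 * m) + 3 * (j div 3) + j mod 3 else cell_code m v j 5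
       else if r = 1 then cell_code m v j 4 else if r = 2 then cell_code m v j 4
       else if r = 3 then cell_code m v j 2 else if r = 4 then cell_code m v j 2
       else if r = 5 then if var j = v then 10 * n * (3 * m) + 3 * m + j div 3 else cell_code m v j 0
       else if r = 6 then cell_code m v j 9
       else if r = 7 then cell_code m v j 9 else if r = 8 then cell_code m v j 7
       else cell_code m v j 7
     else if i < 10 * n * (3 * m) + 3 * m then
       10 * n * (3 * m) + 3 * ((i - 10 * n * (3 * m)) div 3) + ((i - 10 * n * (3 * m)) mod 3 + 2) mod 3
     else cell_code m (var (3 * (i - 10 * n * (3 * m) - 3 * m) + 2)) (3 * (i - 10 * n * (3 * m) - 3 * m) + 2) 5)"

definition adjacent_code :: "nat \<Rightarrow> nat \<Rightarrow> (nat \<Rightarrow> nat) \<Rightarrow> nat \<Rightarrow> nat \<Rightarrow> bool" where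
  "adjacent_code n m var i i' \<longleftrightarrow>
     i' = nbn0 n m var (i div 10 div (3 * m)) (i div 10 mod (3 * m)) (i mod 10) i \<or>
     i' = nbn1 n m var (i div 10 div (3 * m)) (i div 10 mod (3 * m)) (i mod 10) i \<or>
     i' = nbn2 n m var (i div 10 div (3 * m)) (i div 10 mod (3 * m)) (i mod 10) i"

context nae_instance
begin

lemma enc_nb:
  assumes "valid a"
  shows "map enc (nb a) =
    [nbn0 n m var (enc a div 10 div J) (enc a div 10 mod J) (enc a mod 10) (enc a),
     nbn1 n m var (enc a div 10 div J) (enc a div 10 mod J) (enc a mod 10) (enc a),
     nbn2 n m var (enc a div 10 div J) (enc a div 10 mod J) (enc a mod 10) (enc a)]"
proof -
  have cc: "cell_code m = cell" by (simp add: fun_eq_iff cell_def cell_code_def J_def)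
  note defs = nbn0_def nbn1_def nbn2_def cc J_def[symmetric]
  show ?thesis
  proof (cases a)
    case (Tri c k)
    with assms have "3 * c + k < J" "k < 3" by (auto simp: slot_less)
    then show ?thesis unfolding defs by (simp add: Tri add.assoc)
  next
    case (Cap c)
    then show ?thesis unfolding defs by simp
  qed (use assms in \<open>auto simp: defs cell_simps nx_def pv_def\<close>)
qed

lemma edges_iff_code:
  assumes "i < N" "i' < N"
  shows "{i, i'} \<in> edges \<longleftrightarrow> adjacent_code n m var i i'"
proof -
  obtain a b where ab: "valid a" "valid b" "i = enc a" "i' = enc b"
    using enc_dec assms by metis
  have "{i, i'} \<in> edges \<longleftrightarrow> b \<in> set (nb a)" using ab edge_iff by simp
  also have "\<dots> \<longleftrightarrow> enc b \<in> set (map enc (nb a))"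
    using inj_on_image_mem_iff[of enc "{a. valid a}" b "set (nb a)"] bij closed[of a] ab(1,2)
    by (simp add: bij_betw_def)
  also have "\<dots> \<longleftrightarrow> adjacent_code n m var i i'"
    unfolding enc_nb[OF ab(1)] adjacent_code_def ab(3,4) J_def
    by (simp only: list.set insert_iff empty_iff simp_thms)
  finally show ?thesis .
qed

end

lemma concat_rows_eq_map:
  "concat (map (\<lambda>i. map (f i) [0..<N]) [0..<M]) = map (\<lambda>k. f (k div N) (k mod N)) [0..<M * N]"
proof (induction M)
  case (Suc M)
  have "Suc M * N = M * N + N" by simp
  then have "[0..<Suc M * N] = [0..<M * N] @ [M * N..<M * N + N]"
    using upt_add_eq_append[of 0 "M * N" N] by (simp only: le0)
  moreover have "map (\<lambda>k. f (k div N) (k mod N)) [M * N..<M * N + N] = map (f M) [0..<N]"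
    by (rule nth_equalityI) auto
  ultimately show ?case using Suc by (simp del: mult_Suc)
qed simp

text \<open>By \<open>adj_matrix_inj\<close> the matrix determines the graph, so membership cannot
  come from a different graph with the same matrix.\<close>

lemma adj_matrix_in_CUBIC_SIGMA_2:
  assumes "regular_graph 3 {..<N} E"
  shows "adj_matrix N E \<in> CUBIC_SIGMA_2 \<longleftrightarrow> sigma_chromatic_number {..<N} E = 2"
proof
  assume "adj_matrix N E \<in> CUBIC_SIGMA_2"
  then obtain n' E' where *: "adj_matrix N E = adj_matrix n' E'" "regular_graph 3 {..<n'} E'"
    "sigma_chromatic_number {..<n'} E' = 2" by (auto simp: CUBIC_SIGMA_2_def)
  then show "sigma_chromatic_number {..<N} E = 2"
    using adj_matrix_inj[of N E n' E'] assms by (auto simp: regular_graph_def)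
qed (use assms in \<open>auto simp: CUBIC_SIGMA_2_def\<close>)

lemma expressible_nbn:
  assumes "expressible n" "expressible m" "expressible (\<lambda>xs \<epsilon>. var xs (\<epsilon> 0))"
    "expressible v" "expressible j" "expressible r" "expressible i"
  shows "expressible (\<lambda>xs \<epsilon>. nbn0 (n xs \<epsilon>) (m xs \<epsilon>) (var xs) (v xs \<epsilon>) (j xs \<epsilon>) (r xs \<epsilon>) (i xs \<epsilon>))"
    and "expressible (\<lambda>xs \<epsilon>. nbn1 (n xs \<epsilon>) (m xs \<epsilon>) (var xs) (v xs \<epsilon>) (j xs \<epsilon>) (r xs \<epsilon>) (i xs \<epsilon>))"
    and "expressible (\<lambda>xs \<epsilon>. nbn2 (n xs \<epsilon>) (m xs \<epsilon>) (var xs) (v xs \<epsilon>) (j xs \<epsilon>) (r xs \<epsilon>) (i xs \<epsilon>))"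
  unfolding nbn0_def nbn1_def nbn2_def cell_code_def
  by (intro expressible_intros assms expressible_comp1[OF assms(3)])+

lemma nae_reducible:
  fixes m :: "bool list list \<Rightarrow> nat" and var :: "bool list list \<Rightarrow> nat \<Rightarrow> nat"
  assumes m: "expressible (\<lambda>xs \<epsilon>. m xs)" and var: "expressible (\<lambda>xs \<epsilon>. var xs (\<epsilon> 0))"
    and pos: "\<And>xs. 0 < m xs"
    and L: "\<And>x. x \<in> L \<longleftrightarrow> (\<exists>f :: nat \<Rightarrow> bool. \<forall>c<m [x].
      \<not> (f (var [x] (3 * c)) = f (var [x] (3 * c + 1)) \<and> f (var [x] (3 * c + 1)) = f (var [x] (3 * c + 2))))"
  shows "L \<le>\<^sub>p CUBIC_SIGMA_2"
proof -
  \<comment> \<open>The sum over all slots is a crude but expressible bound on the variables.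
    Variables without a slot do not affect the not-all-equal condition.\<close>
  define n where "n = (\<lambda>xs. Suc (\<Sum>j<3 * m xs. var xs j))"
  have nae: "nae_instance (n xs) (m xs) (var xs)" for xs
  proof
    fix j assume "j < 3 * m xs"
    then have "var xs j \<le> (\<Sum>j<3 * m xs. var xs j)" by (intro member_le_sum) auto
    then show "var xs j < n xs" by (simp add: n_def)
  qed (rule pos)
  define sz where "sz = (\<lambda>xs. nae_instance.N (n xs) (m xs))"
  define E where "E = (\<lambda>xs. cubic_neighbours.edges {a. nae_instance.valid (n xs) (m xs) a}
    (nae_instance.nb (m xs) (var xs)) (nae_instance.enc (n xs) (m xs)))"
  have sz: "sz xs = 10 * n xs * (3 * m xs) + 3 * m xs + m xs" for xs
    unfolding sz_def nae_instance.N_def[OF nae] nae_instance.J_def[OF nae] ..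
  have "expressible (\<lambda>xs \<epsilon>. \<Sum>j<3 * m xs. (\<lambda>xs \<epsilon>. var xs (\<epsilon> 0)) xs (\<epsilon>(0 := j)))"
    by (rule expressible_sum[OF _ var]) (intro expressible_intros m)
  then have n: "expressible (\<lambda>xs \<epsilon>. n xs)"
    unfolding n_def by (intro expressible_Suc) simp
  have esz: "expressible (\<lambda>xs \<epsilon>. sz xs)" unfolding sz by (intro expressible_intros n m)
  define B where "B = (\<lambda>xs \<epsilon>. adjacent_code (n xs) (m xs) (var xs) (\<epsilon> (0::nat) div sz xs) (\<epsilon> 0 mod sz xs))"
  have B: "decidable B"
    unfolding B_def adjacent_code_def
    by (intro expressible_intros expressible_nbn[where i = "\<lambda>xs \<epsilon>. \<epsilon> 0 div sz xs" and n = "\<lambda>xs _. n xs" and m = "\<lambda>xs _. m xs"] n m var esz)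
  define f where "f = (\<lambda>x. adj_matrix (sz [x]) (E [x]))"
  have f: "f x = map (\<lambda>k. B [x] (\<lambda>_. k)) [0..<sz [x] * sz [x]]" for x
  proof -
    interpret nae_instance "n [x]" "m [x]" "var [x]" by (rule nae)
    have "f x = concat (map (\<lambda>i. map (\<lambda>j. adjacent_code (n [x]) (m [x]) (var [x]) i j) [0..<sz [x]]) [0..<sz [x]])"
      unfolding f_def adj_matrix_def E_def
      by (intro arg_cong[where f = concat] map_cong refl) (simp add: edges_iff_code sz_def)
    then show ?thesis unfolding concat_rows_eq_map B_def .
  qed
  have "polytime_function f"
    by (rule polytime_functionI[OF _ B f]) (intro expressible_intros esz)
  moreover have "x \<in> L \<longleftrightarrow> f x \<in> CUBIC_SIGMA_2" for x
  proof -
    interpret nae_instance "n [x]" "m [x]" "var [x]" by (rule nae)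
    show ?thesis
      unfolding f_def sz_def E_def adj_matrix_in_CUBIC_SIGMA_2[OF regular] sigma_2_iff_nae L ..
  qed
  ultimately show ?thesis unfolding polytime_reducible_def by blast
qed

section \<open>From 3-clauses to not-all-equal clauses\<close>

definition lit_true :: "(nat \<Rightarrow> bool) \<Rightarrow> nat \<Rightarrow> bool" where
  "lit_true \<alpha> l \<longleftrightarrow> (even l \<longleftrightarrow> \<alpha> (l div 2))"

text \<open>Literal \<open>2 a\<close> is the variable \<open>a\<close> and \<open>2 a + 1\<close> its negation, both in the clauses and
  among the variables of the not-all-equal instance. There, \<open>0\<close> stands for truth and, for the
  \<open>c\<close>-th clause, \<open>4 c + 2\<close> is a fresh variable that splits the clause in two.\<close>

lemma cnf_reducible:
  fixes M :: "bool list list \<Rightarrow> nat" and l1 l2 l3 :: "bool list list \<Rightarrow> nat \<Rightarrow> nat"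
  assumes M: "expressible (\<lambda>xs \<epsilon>. M xs)"
    and l1: "expressible (\<lambda>xs \<epsilon>. l1 xs (\<epsilon> 0))"
    and l2: "expressible (\<lambda>xs \<epsilon>. l2 xs (\<epsilon> 0))"
    and l3: "expressible (\<lambda>xs \<epsilon>. l3 xs (\<epsilon> 0))"
    and complete: "\<And>x. x \<in> L \<Longrightarrow>
      \<exists>\<alpha>. \<forall>c. lit_true \<alpha> (l1 [x] c) \<or> lit_true \<alpha> (l2 [x] c) \<or> lit_true \<alpha> (l3 [x] c)"
    and sound: "\<And>x \<alpha>. \<forall>c<M [x]. lit_true \<alpha> (l1 [x] c) \<or> lit_true \<alpha> (l2 [x] c) \<or> lit_true \<alpha> (l3 [x] c) \<Longrightarrow>
      x \<in> L"
  shows "L \<le>\<^sub>p CUBIC_SIGMA_2"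
proof -
  \<comment> \<open>Numbers \<open>2 b\<close> and \<open>2 b + 1\<close> are complementary
    throughout: \<open>b = 0\<close> is truth, \<open>b = 2 c + 1\<close> the fresh variable of
    clause \<open>c\<close>, and \<open>b = 2 a + 2\<close> the propositional variable
    \<open>a\<close>.\<close>
  define up where "up = (\<lambda>l :: nat. 4 * (l div 2) + 4 + l mod 2)"
  \<comment> \<open>Nine slots per index \<open>c\<close>. With \<open>w\<close> the fresh variable,
    the clause becomes not-all-equal of \<open>l1, l2, w\<close> and of
    \<open>not w, l3, false\<close>; the third triple \<open>2 c, 2 c, 2 c + 1\<close> enforces one
    complementary pair.\<close>
  define var where "var = (\<lambda>xs j. let c = j div 9; k = j mod 9 in
     if k = 0 then up (l1 xs c) else if k = 1 then up (l2 xs c) else if k = 2 then 4 * c + 2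
     else if k = 3 then 4 * c + 3 else if k = 4 then up (l3 xs c) else if k = 5 then 1
     else if k = 8 then 2 * c + 1 else 2 * c)"
  define S where "S = (\<lambda>xs. \<Sum>c<M xs. l1 xs c + l2 xs c + l3 xs c)"
  \<comment> \<open>Enough indices to make all literals of the first \<open>M\<close> clauses (each
    at most \<open>S\<close>), their fresh variables and truth complementary. The indices from
    \<open>M\<close> to \<open>K\<close> bring in further clauses, which is why
    \<open>complete\<close> speaks of all \<open>c\<close>.\<close>
  define K where "K = (\<lambda>xs. 3 + 2 * M xs + S xs)"
  have "expressible (\<lambda>xs \<epsilon>. \<Sum>j<M xs. (\<lambda>xs \<epsilon>. l1 xs (\<epsilon> 0) + l2 xs (\<epsilon> 0) + l3 xs (\<epsilon> 0)) xs (\<epsilon>(0 := j)))"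
    by (rule expressible_sum[OF M]) (intro expressible_intros l1 l2 l3)
  then have S: "expressible (\<lambda>xs \<epsilon>. S xs)" by (simp add: S_def)
  have var9: "var xs (9 * c + k) = (if k = 0 then up (l1 xs c) else if k = 1 then up (l2 xs c)
     else if k = 2 then 4 * c + 2
     else if k = 3 then 4 * c + 3 else if k = 4 then up (l3 xs c) else if k = 5 then 1
     else if k = 8 then 2 * c + 1 else 2 * c)" if "k < 9" for xs c k
  proof -
    have "(9 * c + k) div 9 = c" "(9 * c + k) mod 9 = k" using that by auto
    then show ?thesis by (simp add: var_def)
  qed
  let ?nae = "\<lambda>f xs q. \<not> (f (var xs (3 * q)) = f (var xs (3 * q + 1)) \<and> f (var xs (3 * q + 1)) = f (var xs (3 * q + 2)))"
  have nae0: "?nae f xs (3 * c) \<longleftrightarrow> \<not> (f (up (l1 xs c)) = f (up (l2 xs c)) \<and> f (up (l2 xs c)) = f (4 * c + 2))"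
    for f :: "nat \<Rightarrow> bool" and xs c
    using var9[of 0 xs c] var9[of 1 xs c] var9[of 2 xs c] by simp
  have nae1: "?nae f xs (3 * c + 1) \<longleftrightarrow> \<not> (f (4 * c + 3) = f (up (l3 xs c)) \<and> f (up (l3 xs c)) = f 1)"
    for f :: "nat \<Rightarrow> bool" and xs c
    using var9[of 3 xs c] var9[of 4 xs c] var9[of 5 xs c] by (simp add: algebra_simps)
  have nae2: "?nae f xs (3 * c + 2) \<longleftrightarrow> f (2 * c) \<noteq> f (2 * c + 1)"
    for f :: "nat \<Rightarrow> bool" and xs c
    using var9[of 6 xs c] var9[of 7 xs c] var9[of 8 xs c] by (simp add: algebra_simps)
  show ?thesis
  proof (rule nae_reducible[where m = "\<lambda>xs. 3 * K xs" and var = var])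
    show "expressible (\<lambda>xs \<epsilon>. 3 * K xs)" unfolding K_def by (intro expressible_intros M S)
    show "expressible (\<lambda>xs \<epsilon>. var xs (\<epsilon> 0))" unfolding var_def up_def Let_def
      by (intro expressible_intros expressible_comp1[OF l1] expressible_comp1[OF l2] expressible_comp1[OF l3])
    show "0 < 3 * K xs" for xs by (simp add: K_def)
    show "x \<in> L \<longleftrightarrow> (\<exists>f :: nat \<Rightarrow> bool. \<forall>q<3 * K [x]. ?nae f [x] q)" for x
    proof
      assume "x \<in> L"
      then obtain \<alpha> where \<alpha>: "\<And>c. lit_true \<alpha> (l1 [x] c) \<or> lit_true \<alpha> (l2 [x] c) \<or> lit_true \<alpha> (l3 [x] c)"
        using complete by blast
      \<comment> \<open>The fresh variable is true exactly if \<open>l3\<close> holds and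
        \<open>l1\<close> fails. If true, it differs from \<open>l1\<close>, and \<open>l3\<close>
        differs from falsity. If false, \<open>l1\<close> or \<open>l2\<close> holds and differs
        from it, and its negation differs from falsity.\<close>
      define base where "base = (\<lambda>b. if b = 0 then True else if odd b
        then lit_true \<alpha> (l3 [x] (b div 2)) \<and> \<not> lit_true \<alpha> (l1 [x] (b div 2)) else \<alpha> (b div 2 - 1))"
      define f where "f = (\<lambda>v. even v \<longleftrightarrow> base (v div 2))"
      have f_up: "f (up l) = lit_true \<alpha> l" for l
      proof -
        have "up l div 2 = 2 * (l div 2) + 2" "even (up l) = even l" by (auto simp: up_def)
        then show ?thesis by (simp add: f_def base_def lit_true_def)
      qed
      have w: "f (4 * c + 2) = (lit_true \<alpha> (l3 [x] c) \<and> \<not> lit_true \<alpha> (l1 [x] c))" for c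
      proof -
        have "(4 * c + 2) div 2 = 2 * c + 1" "even (4 * c + 2)" by auto
        then show ?thesis by (simp add: f_def base_def)
      qed
      have nw: "f (2 * c + 1) = (\<not> f (2 * c))" for c by (auto simp: f_def)
      have w': "f (4 * c + 3) = (\<not> f (4 * c + 2))" for c
        using nw[of "2 * c + 1"] by (simp add: algebra_simps numeral_eq_Suc)
      have "\<not> f 1" by (simp add: f_def base_def)
      have "?nae f [x] q" for q
      proof -
        have "q = 3 * (q div 3) \<or> q = 3 * (q div 3) + 1 \<or> q = 3 * (q div 3) + 2" by presburger
        then consider c where "q = 3 * c" | c where "q = 3 * c + 1" | c where "q = 3 * c + 2" by blast
        then show ?thesis
        proof cases
          case (1 c)
          show ?thesis unfolding 1 nae0 f_up w using \<alpha>[of c] by auto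
        next
          case (2 c)
          show ?thesis unfolding 2 nae1 w' f_up w using \<alpha>[of c] \<open>\<not> f 1\<close> by auto
        next
          case (3 c)
          show ?thesis unfolding 3 nae2 using nw[of c] by simp
        qed
      qed
      then show "\<exists>f :: nat \<Rightarrow> bool. \<forall>q<3 * K [x]. ?nae f [x] q" by blast
    next
      assume "\<exists>f :: nat \<Rightarrow> bool. \<forall>q<3 * K [x]. ?nae f [x] q"
      then obtain f :: "nat \<Rightarrow> bool" where f: "\<And>q. q < 3 * K [x] \<Longrightarrow> ?nae f [x] q" by blast
      have neg: "f (2 * b + 1) = (\<not> f (2 * b))" if "b < K [x]" for b
        using f[of "3 * b + 2"] that unfolding nae2 by auto
      \<comment> \<open>Solutions are closed under complement, so truth is whatever value variable 0
        has.\<close>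
      define \<alpha> where "\<alpha> = (\<lambda>a. f (4 * a + 4) = f 0)"
      have f1: "f 1 = (\<not> f 0)" using neg[of 0] by (simp add: K_def)
      have lit: "lit_true \<alpha> l = (f (up l) = f 0)" if "l \<le> S [x]" for l
      proof -
        define a where "a = l div 2"
        have "2 * a + 2 < K [x]" using that by (auto simp: K_def a_def)
        moreover have "2 * (2 * a + 2) = 4 * a + 4" by simp
        ultimately have *: "f (4 * a + 4 + 1) = (\<not> f (4 * a + 4))" using neg by metis
        show ?thesis
        proof (cases "even l")
          case True
          then have "up l = 4 * a + 4" by (simp add: up_def a_def)
          then show ?thesis using True by (simp add: lit_true_def \<alpha>_def a_def)
        next
          case False
          then have "up l = 4 * a + 4 + 1" by (simp add: up_def a_def odd_iff_mod_2_eq_one)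
          then show ?thesis using False * by (auto simp: lit_true_def \<alpha>_def a_def)
        qed
      qed
      have "lit_true \<alpha> (l1 [x] c) \<or> lit_true \<alpha> (l2 [x] c) \<or> lit_true \<alpha> (l3 [x] c)" if c: "c < M [x]" for c
      proof -
        have "l1 [x] c + l2 [x] c + l3 [x] c \<le> S [x]"
          unfolding S_def using c by (intro member_le_sum[of _ _ "\<lambda>c. l1 [x] c + l2 [x] c + l3 [x] c"]) auto
        then have le: "l1 [x] c \<le> S [x]" "l2 [x] c \<le> S [x]" "l3 [x] c \<le> S [x]" by auto
        have "2 * c + 1 < K [x]" using c by (simp add: K_def)
        from neg[OF this] have w: "f (4 * c + 3) = (\<not> f (4 * c + 2))" by (simp add: algebra_simps numeral_eq_Suc)
        have cK: "c < K [x]" using c by (simp add: K_def)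
        have "\<not> (f (up (l1 [x] c)) = f (up (l2 [x] c)) \<and> f (up (l2 [x] c)) = f (4 * c + 2))"
          using f[of "3 * c"] cK unfolding nae0 by simp
        moreover have "\<not> (f (4 * c + 3) = f (up (l3 [x] c)) \<and> f (up (l3 [x] c)) = f 1)"
          using f[of "3 * c + 1"] cK unfolding nae1 by simp
        ultimately show ?thesis using le w f1 by (auto simp: lit)
      qed
      then show "x \<in> L" by (intro sound) blast
    qed
  qed
qed

section \<open>Clauses describing a computation\<close>

definition code :: "nat \<Rightarrow> nat list \<Rightarrow> nat" where
  "code b l = foldl (\<lambda>r s. r * b + s) 0 l"

lemma code_simps [simp]: "code b [] = 0" "code b (l @ [s]) = code b l * b + s"
  by (simp_all add: code_def)

lemma code_less: "set l \<subseteq> {..<b} \<Longrightarrow> code b l < b ^ length l"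
proof (induction l rule: rev_induct)
  case (snoc s l)
  then have "Suc (code b l) \<le> b ^ length l" "s < b" by auto
  then have "code b l * b + s < Suc (code b l) * b" by simp
  also have "\<dots> \<le> b ^ length l * b" using \<open>Suc (code b l) \<le> b ^ length l\<close> by (rule mult_le_mono1)
  finally show ?case by (simp add: mult.commute)
qed simp

lemma code_inj: "set l \<subseteq> {..<b} \<Longrightarrow> set l' \<subseteq> {..<b} \<Longrightarrow> length l = length l' \<Longrightarrow> code b l = code b l' \<Longrightarrow> l = l'"
proof (induction l arbitrary: l' rule: rev_induct)
  case (snoc s l)
  from snoc.prems(3) obtain l1 s1 where l': "l' = l1 @ [s1]" by (cases l' rule: rev_cases) auto
  have s: "s < b" "s1 < b" using snoc.prems l' by auto
  have eq: "code b l * b + s = code b l1 * b + s1" using snoc.prems(4) l' by simp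
  from arg_cong[OF eq, of "\<lambda>z. z div b"] s have "code b l = code b l1" by simp
  moreover from this eq have "s = s1" by simp
  moreover have "l = l1" by (rule snoc.IH) (use snoc.prems l' calculation in auto)
  ultimately show ?case using l' by simp
qed simp

text \<open>By this, the code of a tuple of upper bounds dominates the codes of all tuples below
  it.\<close>

lemma prod_encode_mono: "a \<le> a' \<Longrightarrow> b \<le> b' \<Longrightarrow> prod_encode (a, b) \<le> prod_encode (a', b')"
  unfolding prod_encode_def triangle_def prod.case
  by (intro add_mono div_le_mono mult_le_mono) auto

definition expressible3 :: "(bool list list \<Rightarrow> (nat \<Rightarrow> nat) \<Rightarrow> nat \<times> nat \<times> nat) \<Rightarrow> bool" where
  "expressible3 F \<longleftrightarrow> expressible (\<lambda>xs \<epsilon>. fst (F xs \<epsilon>)) \<and> expressible (\<lambda>xs \<epsilon>. fst (snd (F xs \<epsilon>)))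
     \<and> expressible (\<lambda>xs \<epsilon>. snd (snd (F xs \<epsilon>)))"

lemma expressible3_triple:
  "expressible f \<Longrightarrow> expressible g \<Longrightarrow> expressible h \<Longrightarrow> expressible3 (\<lambda>xs \<epsilon>. (f xs \<epsilon>, g xs \<epsilon>, h xs \<epsilon>))"
  by (simp add: expressible3_def)

lemma expressible3_if:
  "decidable P \<Longrightarrow> expressible3 F \<Longrightarrow> expressible3 G \<Longrightarrow>
   expressible3 (\<lambda>xs \<epsilon>. if P xs \<epsilon> then F xs \<epsilon> else G xs \<epsilon>)"
  unfolding expressible3_def if_distrib[of fst] if_distrib[of snd] by (intro conjI expressible_if) auto

definition pos :: "nat \<Rightarrow> nat" where "pos a = 2 * a"
definition neg :: "nat \<Rightarrow> nat" where "neg a = 2 * a + 1"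

lemma lit_true_pos [simp]: "lit_true \<alpha> (pos a) = \<alpha> a"
  by (simp add: lit_true_def pos_def)

lemma lit_true_neg [simp]: "lit_true \<alpha> (neg a) = (\<not> \<alpha> a)"
  by (simp add: lit_true_def neg_def)

definition atom :: "nat \<Rightarrow> nat \<Rightarrow> nat \<Rightarrow> nat \<Rightarrow> nat \<Rightarrow> nat" where
  "atom K t i p s = prod_encode (K, prod_encode (t, prod_encode (i, prod_encode (p, s))))"

text \<open>\<open>Tp t i p s\<close>: at time \<open>t\<close> cell \<open>p\<close> of tape \<open>i\<close> holds \<open>s\<close>. \<open>Hd t i p\<close>: the head of tape \<open>i\<close>
  is on cell \<open>p\<close>. \<open>Sc t i s\<close>: the \<open>i\<close>-th entry of the list of scanned symbols, extended by the
  state, is \<open>s\<close>. \<open>Tr t j r\<close>: \<open>r\<close> is the code of the first \<open>j\<close> entries of this list. Cells are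
  numbered such that the origin has a positive number.\<close>

definition Tp where "Tp t i p s = atom 0 t i p s"
definition Hd where "Hd t i p = atom 1 t i p 0"
definition Sc where "Sc t i s = atom 2 t i s 0"
definition Tr where "Tr t j r = atom 3 t j r 0"

section \<open>The run of a verifier as a set of clauses\<close>

locale np_verifier =
  fixes M :: tm and R :: "bool list \<Rightarrow> bool list \<Rightarrow> bool" and pt py :: "nat poly" and L :: "bool list set"
  assumes wf: "wf_tm M" and two_tapes: "2 \<le> num_tapes M"
    and out: "outputs_within M [x, y] (poly pt (length x + length y)) [R x y]"
    and L: "x \<in> L \<longleftrightarrow> (\<exists>y. length y \<le> poly py (length x) \<and> R x y)"
begin

definition k :: nat where "k = num_tapes M"

text \<open>One base for symbols and states, as the state is an entry of the scanned list; the
  halting state \<open>num_states M\<close> has to fit in as well.\<close>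

definition b :: nat where "b = num_symbols M + num_states M + 1"

definition scanned :: "config \<Rightarrow> nat list" where
  "scanned C = map (\<lambda>i. tape C i (head C i)) [0..<k] @ [state C]"

definition good :: "config \<Rightarrow> bool" where
  "good C \<longleftrightarrow> state C \<le> num_states M \<and> (\<forall>i<k. \<forall>p. tape C i p < num_symbols M)"

text \<open>A choice operator is enough: only finitely many arguments matter, and they enter the
  expressions as tables.\<close>

definition uncode :: "nat \<Rightarrow> nat list" where
  "uncode r = (SOME l. length l = Suc k \<and> set l \<subseteq> {..<b} \<and> code b l = r)"

text \<open>Extended to the halting state by doing nothing, as \<open>step\<close> does, so that a
  run can be described up to a time bound common to all certificates.\<close>

definition result :: "nat list \<Rightarrow> nat \<times> (nat \<times> move) list" where
  "result l = (if l ! k < num_states M then delta M (l ! k) (take k l)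
     else (l ! k, map (\<lambda>s. (s, Move_Stay)) (take k l)))"

definition new_state :: "nat \<Rightarrow> nat" where
  "new_state r = fst (result (uncode r))"

definition new_symbol :: "nat \<Rightarrow> nat \<Rightarrow> nat" where
  "new_symbol r i = fst (snd (result (uncode r)) ! i)"

text \<open>The added 1 keeps head movements within the natural numbers; group 4 of the clauses
  subtracts it again.\<close>

definition shift :: "nat \<Rightarrow> nat \<Rightarrow> nat" where
  "shift r i = nat (offset (snd (snd (result (uncode r)) ! i)) + 1)"

lemma k2: "2 \<le> k" using two_tapes by (simp add: k_def)

lemma length_scanned: "length (scanned C) = Suc k"
  by (simp add: scanned_def)

lemma scanned_nth: "i < k \<Longrightarrow> scanned C ! i = tape C i (head C i)" "scanned C ! k = state C"
  by (simp_all add: scanned_def nth_append)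

lemma set_scanned:
  assumes "good C"
  shows "set (scanned C) \<subseteq> {..<b}"
proof -
  have "tape C i p < b" if "i < k" for i p
  proof -
    have "tape C i p < num_symbols M" using assms that by (simp add: good_def)
    then show ?thesis by (simp add: b_def)
  qed
  then show ?thesis using assms by (auto simp: good_def scanned_def b_def)
qed

lemma uncode_scanned:
  assumes "good C"
  shows "uncode (code b (scanned C)) = scanned C"
  unfolding uncode_def
proof (rule some_equality)
  show "length (scanned C) = Suc k \<and> set (scanned C) \<subseteq> {..<b} \<and> code b (scanned C) = code b (scanned C)"
    using set_scanned[OF assms] length_scanned by simp
  show "l = scanned C" if "length l = Suc k \<and> set l \<subseteq> {..<b} \<and> code b l = code b (scanned C)" for l
    using that set_scanned[OF assms] length_scanned by (intro code_inj) auto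
qed

lemma offset_ge: "0 \<le> offset d + 1" "offset d \<le> 1"
  by (cases d; simp)+

lemma step_good:
  assumes g: "good C"
  defines "r \<equiv> code b (scanned C)"
  shows "state (step M C) = new_state r"
    and "i < k \<Longrightarrow> tape (step M C) i = (tape C i)(head C i := new_symbol r i)"
    and "i < k \<Longrightarrow> head (step M C) i = head C i + int (shift r i) - 1"
    and "good (step M C)"
proof -
  have u: "uncode r = scanned C" unfolding r_def using g by (rule uncode_scanned)
  have tk: "take k (scanned C) = map (\<lambda>i. tape C i (head C i)) [0..<k]" by (simp add: scanned_def)
  have "state (step M C) = new_state r \<and>
    (\<forall>i<k. tape (step M C) i = (tape C i)(head C i := new_symbol r i) \<and>
      head (step M C) i = head C i + int (shift r i) - 1) \<and> good (step M C)"
  proof (cases "state C < num_states M")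
    case True
    define ss where "ss = map (\<lambda>i. tape C i (head C i)) [0..<k]"
    obtain q' acts where d: "delta M (state C) ss = (q', acts)" by (cases "delta M (state C) ss")
    have res: "result (scanned C) = (q', acts)"
      using True d tk by (simp add: result_def scanned_nth ss_def)
    have "length ss = num_tapes M \<and> set ss \<subseteq> {..<num_symbols M}"
      using g by (auto simp: ss_def good_def k_def)
    then have "let (q', acts) = delta M (state C) ss in
        q' \<le> num_states M \<and> length acts = num_tapes M \<and> fst ` set acts \<subseteq> {..<num_symbols M}"
      using wf True unfolding wf_tm_def by blast
    then have w: "q' \<le> num_states M" "length acts = k" "fst ` set acts \<subseteq> {..<num_symbols M}"
      by (simp_all add: d k_def)
    have fs: "fst (acts ! i) < num_symbols M" if "i < k" for i
    proof -
      have "acts ! i \<in> set acts" using that w(2) by simp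
      then show ?thesis using w(3) by auto
    qed
    have st: "step M C = \<lparr> state = q',
        tape = (\<lambda>i. if i < k then (tape C i)(head C i := fst (acts ! i)) else tape C i),
        head = (\<lambda>i. if i < k then head C i + offset (snd (acts ! i)) else head C i) \<rparr>"
      using True d by (simp add: step_def halted_def k_def ss_def)
    show ?thesis
      using g w(1) fs unfolding st good_def new_state_def new_symbol_def shift_def u res
      by (auto simp: fun_upd_def offset_ge)
  next
    case False
    then have st: "step M C = C" by (simp add: step_def halted_def)
    have "result (scanned C) = (state C, map (\<lambda>s. (s, Move_Stay)) (map (\<lambda>i. tape C i (head C i)) [0..<k]))"
      using False tk by (simp add: result_def scanned_nth)
    then show ?thesis using g unfolding st new_state_def new_symbol_def shift_def u by auto
  qed
  then show "state (step M C) = new_state r"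
    "i < k \<Longrightarrow> tape (step M C) i = (tape C i)(head C i := new_symbol r i)"
    "i < k \<Longrightarrow> head (step M C) i = head C i + int (shift r i) - 1"
    "good (step M C)" by auto
qed

definition run :: "bool list \<Rightarrow> bool list \<Rightarrow> nat \<Rightarrow> config" where
  "run x y t = (step M ^^ t) (init_config [x, y])"

lemma run_simps: "run x y 0 = init_config [x, y]" "run x y (Suc t) = step M (run x y t)"
  by (simp_all add: run_def)

lemma init_tape: "tape (init_config [x, y]) i = (if i = 0 then string_tape x else if i = 1 then string_tape y else (\<lambda>_. 0))"
  by (auto simp: init_config_def nth_Cons')

lemma good_run: "good (run x y t)"
proof (induction t)
  case 0
  have "3 \<le> num_symbols M" using wf by (simp add: wf_tm_def)
  moreover have "string_tape z p < 3" for z p by (simp add: string_tape_def)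
  ultimately show ?case
    by (auto simp: good_def run_simps init_tape intro: less_le_trans) (simp add: init_config_def)
qed (simp add: run_simps step_good(4))

lemma shift_le: "shift r i \<le> 2"
  using offset_ge by (simp add: shift_def nat_le_iff)

lemma head_run: "i < k \<Longrightarrow> \<bar>head (run x y t) i\<bar> \<le> int t"
proof (induction t)
  case 0
  then show ?case by (simp add: run_simps init_config_def)
next
  case (Suc t)
  then show ?case using step_good(3)[OF good_run[of x y t] Suc.prems] shift_le[of "code b (scanned (run x y t))" i]
    by (auto simp: run_simps)
qed

definition ylen :: "bool list list \<Rightarrow> nat" where "ylen xs = poly py (in_len xs 0)"
definition time :: "bool list list \<Rightarrow> nat" where "time xs = poly pt (in_len xs 0 + ylen xs)"
text \<open>Within \<open>time xs\<close> steps the heads move at most \<open>time xs\<close> cells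
  away from the origin, so with this offset they stay on cells 1 to
  \<open>2 * time xs + 1\<close>.\<close>

definition origin :: "bool list list \<Rightarrow> nat" where "origin xs = Suc (time xs)"

text \<open>The time for the longest admissible certificate covers the shorter ones: polynomials
  with natural coefficients are monotone, and a halted machine keeps its output.\<close>

lemma final_tape:
  assumes "length y \<le> ylen [x]"
  shows "tape (run x y (time [x])) (k - 1) 0 = (if R x y then 2 else 1)"
proof -
  have "poly pt (length x + length y) \<le> time [x]"
    unfolding time_def using assms by (intro poly_nat_mono) (simp add: in_len_def)
  from outputs_within_mono[OF out this] show ?thesis
    by (auto simp: outputs_within_def run_def k_def Let_def string_tape_def)
qed

definition tape0 :: "bool list list \<Rightarrow> nat \<Rightarrow> nat" where
  "tape0 xs p = (if origin xs \<le> p \<and> p - origin xs < in_len xs 0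
     then (if in_bit xs 0 (p - origin xs) then 2 else 1) else 0)"

lemma tape0: "tape0 [x] p = string_tape x (int p - int (origin [x]))"
  by (auto simp: tape0_def string_tape_def in_len_def in_bit_def nat_diff_distrib)

definition RN :: nat where "RN = b ^ Suc k"

definition tab_bound :: nat where "tab_bound = Suc (prod_encode (RN, k))"

definition state_tab :: "nat \<Rightarrow> nat" where
  "state_tab r = (if r < RN then new_state r else 0)"

text \<open>The pair is packed into one number because a table takes a single argument.\<close>

definition tab2 :: "(nat \<Rightarrow> nat \<Rightarrow> nat) \<Rightarrow> nat \<Rightarrow> nat \<Rightarrow> nat" where
  "tab2 f r i = (if prod_encode (r, i) < tab_bound
     then f (fst (prod_decode (prod_encode (r, i)))) (snd (prod_decode (prod_encode (r, i)))) else 0)"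

lemma tab2: "r < RN \<Longrightarrow> i < k \<Longrightarrow> tab2 f r i = f r i"
  using prod_encode_mono[of r RN i k] by (simp add: tab2_def tab_bound_def)

text \<open>Groups 0 to 3 fold the scanned entries into a code and derive the next state; 4 to 6
  move a head, write under it and preserve every other cell, \<open>u\<close> being the head
  position in 6. Groups 7 to 13 fix the start: 11 leaves the symbols of the certificate open, 12
  continues its blanks, 13 limits its length. Group 14 forbids the answer \<open>False\<close>,
  whose symbol is 1. Everything else is a tautology.\<close>

definition clause :: "bool list list \<Rightarrow> nat \<Rightarrow> nat \<Rightarrow> nat \<Rightarrow> nat \<Rightarrow> nat \<Rightarrow> nat \<Rightarrow> nat \<times> nat \<times> nat" where
  "clause xs K t i p u s =
    (if K = 0 \<and> t < time xs then (pos (Tr t 0 0), pos (Tr t 0 0), pos (Tr t 0 0))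
     else if K = 1 \<and> t < time xs \<and> i \<le> k then (neg (Tr t i p), neg (Sc t i s), pos (Tr t (i + 1) (p * b + s)))
     else if K = 2 \<and> t < time xs \<and> i < k then (neg (Hd t i p), neg (Tp t i p s), pos (Sc t i s))
     else if K = 3 \<and> t < time xs then (neg (Tr t (k + 1) p), neg (Tr t (k + 1) p), pos (Sc (t + 1) k (state_tab p)))
     else if K = 4 \<and> t < time xs \<and> i < k then
       (neg (Tr t (k + 1) u), neg (Hd t i p), pos (Hd (t + 1) i (p + tab2 shift u i - 1)))
     else if K = 5 \<and> t < time xs \<and> i < k then
       (neg (Tr t (k + 1) u), neg (Hd t i p), pos (Tp (t + 1) i p (tab2 new_symbol u i)))
     else if K = 6 \<and> t < time xs \<and> i < k \<and> p \<noteq> u then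
       (neg (Hd t i u), neg (Tp t i p s), pos (Tp (t + 1) i p s))
     else if K = 7 then (pos (Sc 0 k 0), pos (Sc 0 k 0), pos (Sc 0 k 0))
     else if K = 8 \<and> i < k then (pos (Hd 0 i (origin xs)), pos (Hd 0 i (origin xs)), pos (Hd 0 i (origin xs)))
     else if K = 9 \<and> i = 0 then (pos (Tp 0 0 p (tape0 xs p)), pos (Tp 0 0 p (tape0 xs p)), pos (Tp 0 0 p (tape0 xs p)))
     else if K = 10 \<and> 2 \<le> i \<and> i < k then (pos (Tp 0 i p 0), pos (Tp 0 i p 0), pos (Tp 0 i p 0))
     else if K = 11 \<and> origin xs \<le> p then (pos (Tp 0 1 p 0), pos (Tp 0 1 p 1), pos (Tp 0 1 p 2))
     else if K = 12 \<and> origin xs \<le> p then (neg (Tp 0 1 p 0), neg (Tp 0 1 p 0), pos (Tp 0 1 (p + 1) 0))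
     else if K = 13 \<and> (p < origin xs \<or> origin xs + ylen xs \<le> p) then (pos (Tp 0 1 p 0), pos (Tp 0 1 p 0), pos (Tp 0 1 p 0))
     else if K = 14 then (neg (Tp (time xs) (k - 1) (origin xs) 1), neg (Tp (time xs) (k - 1) (origin xs) 1),
       neg (Tp (time xs) (k - 1) (origin xs) 1))
     else (pos 0, neg 0, pos 0))"

definition sat3 :: "(nat \<Rightarrow> bool) \<Rightarrow> nat \<times> nat \<times> nat \<Rightarrow> bool" where
  "sat3 \<alpha> = (\<lambda>(l1, l2, l3). lit_true \<alpha> l1 \<or> lit_true \<alpha> l2 \<or> lit_true \<alpha> l3)"

definition truth :: "bool list \<Rightarrow> bool list \<Rightarrow> nat \<Rightarrow> bool" where
  "truth x y a = (let (K, a1) = prod_decode a; (t, a2) = prod_decode a1; (i, a3) = prod_decode a2;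
      (p, s) = prod_decode a3; C = run x y t in
      if K = 0 then tape C i (int p - int (origin [x])) = s
      else if K = 1 then head C i = int p - int (origin [x])
      else if K = 2 then scanned C ! i = p
      else p = code b (take i (scanned C)))"

lemma truth_simps:
  "truth x y (Tp t i p s) \<longleftrightarrow> tape (run x y t) i (int p - int (origin [x])) = s"
  "truth x y (Hd t i p) \<longleftrightarrow> head (run x y t) i = int p - int (origin [x])"
  "truth x y (Sc t i s) \<longleftrightarrow> scanned (run x y t) ! i = s"
  "truth x y (Tr t i p) \<longleftrightarrow> p = code b (take i (scanned (run x y t)))"
  by (simp_all add: truth_def Tp_def Hd_def Sc_def Tr_def atom_def)

text \<open>Stated for all prefixes, since the codes of prefixes are parameters in group 1 and have
  to stay within the enumerated range.\<close>

lemma code_scanned_less: "code b (take j (scanned (run x y t))) < RN"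
proof -
  have *: "set (take j (scanned (run x y t))) \<subseteq> {..<b}"
    using set_scanned[OF good_run] set_take_subset by fast
  have "code b (take j (scanned (run x y t))) < b ^ length (take j (scanned (run x y t)))"
    by (rule code_less[OF *])
  also have "\<dots> \<le> b ^ Suc k" by (rule power_increasing) (auto simp: length_scanned b_def)
  finally show ?thesis by (simp add: RN_def)
qed

lemma take_scanned: "take (Suc k) (scanned C) = scanned C"
  by (simp add: length_scanned)

lemma string_tape_eq_0: "0 \<le> j \<Longrightarrow> string_tape y j = 0 \<longleftrightarrow> int (length y) \<le> j"
  by (auto simp: string_tape_def)

text \<open>Each clause is a true statement about the run, for arbitrary parameters. In group 4 the
  time limit puts the head on a cell with positive number, so that the subtraction of 1 is
  exact.\<close>

lemma clause_complete:
  assumes y: "length y \<le> ylen [x]" "R x y"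
  shows "sat3 (truth x y) (clause [x] K t i p u s)"
proof -
  let ?r = "code b (scanned (run x y t))"
  have r: "?r < RN" using code_scanned_less[of "Suc k" x y t] by (simp add: take_scanned)
  note st = step_good[OF good_run[of x y t]]
  consider "K = 1" "i \<le> k" | "K = 3" | "K = 4" "i < k" "t < time [x]" | "K = 5" "i < k"
    | "K = 6" "i < k" "p \<noteq> u" | "K = 11" | "K = 12" | "K = 14" | "K = 13" |
      "K \<notin> {1, 3, 4, 5, 6, 11, 12, 13, 14} \<or> K = 1 \<and> \<not> i \<le> k \<or> K = 4 \<and> \<not> (t < time [x] \<and> i < k)
       \<or> K = 5 \<and> \<not> i < k \<or> K = 6 \<and> \<not> (i < k \<and> p \<noteq> u)" by blast
  then show ?thesis
  proof cases
    case 1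
    have "take (Suc i) (scanned (run x y t)) = take i (scanned (run x y t)) @ [scanned (run x y t) ! i]"
      using 1 by (intro take_Suc_conv_app_nth) (simp add: length_scanned)
    then show ?thesis using 1 by (simp add: clause_def sat3_def truth_simps)
  next
    case 2
    then show ?thesis using st(1) r
      by (simp add: clause_def sat3_def truth_simps take_scanned run_simps scanned_nth state_tab_def)
  next
    case 3
    have "int (p + shift ?r i - 1) = int p + int (shift ?r i) - 1" if "head (run x y t) i = int p - int (origin [x])"
      using head_run[OF 3(2), of x y t] that 3(3) by (simp add: origin_def of_nat_diff)
    then show ?thesis using 3 st(3)[OF 3(2)] r
      by (simp add: clause_def sat3_def truth_simps take_scanned run_simps tab2)
  next
    case 4
    then show ?thesis using st(2)[OF 4(2)] r
      by (simp add: clause_def sat3_def truth_simps take_scanned run_simps tab2)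
  next
    case 5
    then show ?thesis using st(2)[OF 5(2)]
      by (simp add: clause_def sat3_def truth_simps run_simps)
  next
    case 6
    then show ?thesis
      by (simp add: clause_def sat3_def truth_simps run_simps init_tape string_tape_def)
  next
    case 7
    have "tape (run x y 0) 1 (int (p + 1) - int (origin [x])) = 0"
      if "origin [x] \<le> p" "tape (run x y 0) 1 (int p - int (origin [x])) = 0"
      using that string_tape_eq_0[of "int p - int (origin [x])" y]
        string_tape_eq_0[of "int (p + 1) - int (origin [x])" y]
      by (simp add: run_simps init_tape)
    then show ?thesis unfolding 7
      by (auto simp: clause_def sat3_def truth_simps simp del: neq0_conv)
  next
    case 8
    then show ?thesis using final_tape[OF y(1)] y(2)
      by (simp add: clause_def sat3_def truth_simps)
  next
    case 9
    have "tape (run x y 0) 1 (int p - int (origin [x])) = 0"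
      if "p < origin [x] \<or> origin [x] + ylen [x] \<le> p"
      using that y(1) by (auto simp: run_simps init_tape string_tape_def)
    then show ?thesis unfolding 9
      by (auto simp: clause_def sat3_def truth_simps)
  next
    case 10
    then have "clause [x] K t i p u s = (pos 0, neg 0, pos 0)" if "K \<notin> {0, 2, 7, 8, 9, 10}"
      using that by (elim disjE) (simp_all add: clause_def, blast+)
    then consider "K = 0" | "K = 2" | "K = 7" | "K = 8" | "K = 9" | "K = 10"
      | "clause [x] K t i p u s = (pos 0, neg 0, pos 0)"
      by blast
    then show ?thesis
    proof cases
      case 3
      then show ?thesis
        by (simp add: clause_def sat3_def truth_simps run_simps scanned_nth) (simp add: init_config_def)
    next
      case 4
      then show ?thesis
        by (simp add: clause_def sat3_def truth_simps run_simps) (simp add: init_config_def)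
    qed (auto simp: clause_def sat3_def truth_simps run_simps scanned_nth init_tape tape0)
  qed
qed

section \<open>Enumeration of the clauses and extraction of a certificate\<close>

definition bound :: "bool list list \<Rightarrow> nat" where
  "bound xs = 20 + k + b + RN + 2 * time xs + ylen xs + origin xs"

definition six :: "nat \<Rightarrow> nat \<Rightarrow> nat \<Rightarrow> nat \<Rightarrow> nat \<Rightarrow> nat \<Rightarrow> nat" where
  "six K t i p u s = prod_encode (K, prod_encode (t, prod_encode (i, prod_encode (p, prod_encode (u, s)))))"

definition clause_of :: "bool list list \<Rightarrow> nat \<Rightarrow> nat \<times> nat \<times> nat" where
  "clause_of xs c = clause xs (fst (prod_decode c)) (fst (prod_decode (snd (prod_decode c))))
     (fst (prod_decode (snd (prod_decode (snd (prod_decode c))))))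
     (fst (prod_decode (snd (prod_decode (snd (prod_decode (snd (prod_decode c))))))))
     (fst (prod_decode (snd (prod_decode (snd (prod_decode (snd (prod_decode (snd (prod_decode c))))))))))
     (snd (prod_decode (snd (prod_decode (snd (prod_decode (snd (prod_decode (snd (prod_decode c))))))))))"

lemma clause_of_six: "clause_of xs (six K t i p u s) = clause xs K t i p u s"
  by (simp add: clause_of_def six_def)

text \<open>All tuples with entries up to \<open>bound xs\<close> have smaller codes. This covers
  every clause used for soundness; the 20 in \<open>bound\<close> exceeds the group numbers.\<close>

definition num_clauses :: "bool list list \<Rightarrow> nat" where
  "num_clauses xs = Suc (six (bound xs) (bound xs) (bound xs) (bound xs) (bound xs) (bound xs))"

lemma six_less: "K \<le> bound xs \<Longrightarrow> t \<le> bound xs \<Longrightarrow> i \<le> bound xs \<Longrightarrow> p \<le> bound xs \<Longrightarrow>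
    u \<le> bound xs \<Longrightarrow> s \<le> bound xs \<Longrightarrow> six K t i p u s < num_clauses xs"
  unfolding num_clauses_def six_def less_Suc_eq_le by (intro prod_encode_mono)

text \<open>Only one direction is established for \<open>\<alpha>\<close>: the facts of the run on
  the extracted certificate hold. It may make other facts true as well, and this is harmless because
  the contradiction comes from a fact that holds although group 14 forbids it.\<close>

lemma clause_sound:
  assumes "\<forall>c<num_clauses [x]. sat3 \<alpha> (clause_of [x] c)"
  shows "x \<in> L"
proof -
  define T where "T = time [x]"
  define Q where "Q = origin [x]"
  define B where "B = bound [x]"
  have Q: "Q = Suc T" by (simp add: Q_def T_def origin_def)
  have BB: "2 * T + Q + 20 + k + b + RN + ylen [x] \<le> B" by (simp add: B_def bound_def Q_def T_def)
  have cl: "sat3 \<alpha> (clause [x] K t i p u s)"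
    if "K \<le> B" "t \<le> B" "i \<le> B" "p \<le> B" "u \<le> B" "s \<le> B" for K t i p u s
    using assms six_less[of K "[x]" t i p u s] that unfolding B_def clause_of_six[symmetric] by blast
  note sdefs = clause_def sat3_def T_def[symmetric] Q_def[symmetric]
  let ?blank = "\<lambda>l. \<alpha> (Tp 0 1 (Q + l) 0)"
  \<comment> \<open>The certificate ends at the first cell that \<open>\<alpha>\<close> calls blank.
    Before it, group 11 leaves the symbols 1 and 2; if \<open>\<alpha>\<close> admits both, the bit
    is taken to be \<open>True\<close>.\<close>
  define len where "len = (LEAST l. ?blank l)"
  define y where "y = map (\<lambda>l. \<alpha> (Tp 0 1 (Q + l) 2)) [0..<len]"
  have "?blank (ylen [x])"
    using cl[of 13 0 0 "Q + ylen [x]" 0 0] BB by (simp add: sdefs)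
  then have blank: "?blank len" and len: "len \<le> ylen [x]"
    unfolding len_def by (auto intro: LeastI Least_le)
  have nonblank: "\<not> ?blank l" if "l < len" for l
    using that not_less_Least unfolding len_def by blast
  have blanks: "?blank l" if "len \<le> l" "Q + l \<le> B" for l
    using that
  proof (induction l rule: dec_induct)
    case (step l)
    then show ?case using cl[of 12 0 0 "Q + l" 0 0] BB by (simp add: sdefs)
  qed (rule blank)
  have leny: "length y \<le> ylen [x]" using len by (simp add: y_def)
  have cert: "\<alpha> (Tp 0 1 p (string_tape y (int p - int Q)))" if p: "p \<le> B" for p
  proof (cases "p < Q")
    case True
    then show ?thesis using cl[of 13 0 0 p 0 0] BB p by (simp add: sdefs string_tape_def)
  next
    case False
    then obtain l where l: "p = Q + l" using le_Suc_ex not_less by blast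
    show ?thesis
    proof (cases "l < len")
      case True
      then have "y ! l = \<alpha> (Tp 0 1 p 2)" by (simp add: y_def l)
      then show ?thesis using True cl[of 11 0 0 p 0 0] BB p nonblank[OF True] l
        by (auto simp: sdefs string_tape_def y_def)
    next
      case False
      then show ?thesis using blanks[of l] p l by (simp add: string_tape_def y_def)
    qed
  qed
  let ?C = "run x y"
  define hp where "hp = (\<lambda>t i. nat (head (?C t) i + int Q))"
  have hp: "int (hp t i) = head (?C t) i + int Q" "hp t i \<le> B" "1 \<le> hp t i"
    "hp t i \<le> 2 * T + 1" if "i < k" "t \<le> T" for t i
    using head_run[OF that(1), of x y t] that(2) BB unfolding hp_def Q by auto
  have sym: "tape (?C t) i p \<le> B" if "i < k" for t i p
  proof -
    have "tape (?C t) i p < num_symbols M" using good_run[of x y t] that by (simp add: good_def)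
    then show ?thesis using BB by (simp add: b_def)
  qed
  \<comment> \<open>The range from 1 to \<open>2 * T + 1\<close> contains all cells that a head can
    visit up to time \<open>T\<close>; tape facts outside it are not tracked.\<close>
  have "(\<forall>i<k. \<alpha> (Hd t i (hp t i)) \<and> (\<forall>p\<ge>1. p \<le> 2 * T + 1 \<longrightarrow> \<alpha> (Tp t i p (tape (?C t) i (int p - int Q)))))
     \<and> \<alpha> (Sc t k (state (?C t)))" if "t \<le> T" for t
    using that
  proof (induction t)
    case 0
    have "\<alpha> (Hd 0 i (hp 0 i))" if "i < k" for i
    proof -
      have "hp 0 i = Q" by (simp add: hp_def run_simps init_config_def)
      then show ?thesis using cl[of 8 0 i 0 0 0] that BB by (simp add: sdefs)
    qed
    moreover have "\<alpha> (Tp 0 i p (tape (?C 0) i (int p - int Q)))" if "i < k" "p \<le> 2 * T + 1" for i p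
    proof -
      have p: "p \<le> B" using that BB by simp
      consider "i = 0" | "i = 1" | "2 \<le> i" by linarith
      then show ?thesis
      proof cases
        case 1
        then show ?thesis using cl[of 9 0 i p 0 0] that p BB
          by (simp add: sdefs run_simps init_tape tape0)
      next
        case 2
        then show ?thesis using cert[OF p] by (simp add: run_simps init_tape)
      next
        case 3
        then show ?thesis using cl[of 10 0 i p 0 0] that p BB by (simp add: sdefs run_simps init_tape)
      qed
    qed
    moreover have "\<alpha> (Sc 0 k (state (?C 0)))"
      using cl[of 7 0 0 0 0 0] BB by (simp add: sdefs run_simps init_config_def)
    ultimately show ?case by blast
  next
    case (Suc t)
    then have t: "t < T" "t \<le> T" and IH: "\<And>i. i < k \<Longrightarrow> \<alpha> (Hd t i (hp t i))"
      "\<And>i p. i < k \<Longrightarrow> 1 \<le> p \<Longrightarrow> p \<le> 2 * T + 1 \<Longrightarrow> \<alpha> (Tp t i p (tape (?C t) i (int p - int Q)))"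
      "\<alpha> (Sc t k (state (?C t)))" by auto
    note st = step_good[OF good_run[of x y t]]
    let ?l = "scanned (?C t)"
    let ?r = "code b ?l"
    have tB: "t \<le> B" using t BB by simp
    have r: "?r < RN" using code_scanned_less[of "Suc k" x y t] by (simp add: take_scanned)
    have rB: "?r \<le> B" using r BB by simp
    have sc: "\<alpha> (Sc t i (?l ! i))" if "i \<le> k" for i
    proof (cases "i = k")
      case True
      then show ?thesis using IH(3) by (simp add: scanned_nth)
    next
      case False
      with that have i: "i < k" by simp
      have "\<alpha> (Tp t i (hp t i) (?l ! i))"
        using IH(2)[OF i hp(3,4)[OF i t(2)]] hp(1)[OF i t(2)] i by (simp add: scanned_nth)
      moreover have "?l ! i \<le> B" using sym[OF i, of t] i by (simp add: scanned_nth)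
      ultimately show ?thesis
        using cl[of 2 t i "hp t i" 0 "?l ! i"] IH(1)[OF i] hp(2)[OF i t(2)] i t(1) tB BB by (simp add: sdefs)
    qed
    \<comment> \<open>Group 1 appends the entries one at a time, the state being the last
      one.\<close>
    have tr: "\<alpha> (Tr t j (code b (take j ?l)))" if "j \<le> Suc k" for j
      using that
    proof (induction j)
      case 0
      then show ?case using cl[of 0 t 0 0 0 0] t(1) tB BB by (simp add: sdefs)
    next
      case (Suc j)
      have tk: "take (Suc j) ?l = take j ?l @ [?l ! j]"
        using Suc.prems by (intro take_Suc_conv_app_nth) (simp add: length_scanned)
      have "code b (take j ?l) \<le> B" using code_scanned_less[of j x y t] BB by simp
      moreover have "?l ! j \<le> B"
      proof -
        have "?l ! j \<in> set ?l" using Suc.prems by (intro nth_mem) (simp add: length_scanned)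
        then show ?thesis using set_scanned[OF good_run[of x y t]] BB by auto
      qed
      ultimately show ?case
        using cl[of 1 t j "code b (take j ?l)" 0 "?l ! j"] Suc sc[of j] t(1) tB BB
        unfolding tk by (simp add: sdefs)
    qed
    have tr: "\<alpha> (Tr t (Suc k) ?r)" using tr[of "Suc k"] by (simp add: take_scanned)
    have "\<alpha> (Sc (Suc t) k (state (?C (Suc t))))"
      using cl[of 3 t 0 ?r 0 0] tr t(1) tB rB r BB st(1) by (simp add: sdefs run_simps state_tab_def)
    moreover have "\<alpha> (Hd (Suc t) i (hp (Suc t) i))" if i: "i < k" for i
    proof -
      have "hp (Suc t) i = hp t i + shift ?r i - 1"
        using hp(1)[OF i t(2)] hp(3)[OF i t(2)] st(3)[OF i] by (simp add: hp_def run_simps)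
      then show ?thesis
        using cl[of 4 t i "hp t i" ?r 0] tr IH(1)[OF i] hp(2)[OF i t(2)] i t(1) tB rB r BB
        by (simp add: sdefs tab2)
    qed
    moreover have "\<alpha> (Tp (Suc t) i p (tape (?C (Suc t)) i (int p - int Q)))"
      if i: "i < k" and p: "1 \<le> p" "p \<le> 2 * T + 1" for i p
    proof (cases "p = hp t i")
      case True
      then have "tape (?C (Suc t)) i (int p - int Q) = new_symbol ?r i"
        using hp(1)[OF i t(2)] st(2)[OF i] by (simp add: run_simps)
      then show ?thesis
        using cl[of 5 t i p ?r 0] tr IH(1)[OF i] hp(2)[OF i t(2)] i t(1) tB rB r BB True
        by (simp add: sdefs tab2)
    next
      case False
      then have "int p - int Q \<noteq> head (?C t) i" using hp(1)[OF i t(2)] by linarith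
      then have "tape (?C (Suc t)) i (int p - int Q) = tape (?C t) i (int p - int Q)"
        using st(2)[OF i] by (simp add: run_simps)
      moreover have "p \<le> B" using p BB by simp
      ultimately show ?thesis
        using cl[of 6 t i p "hp t i" "tape (?C t) i (int p - int Q)"] IH(1)[OF i] IH(2)[OF i p]
          hp(2)[OF i t(2)] sym[OF i] i t(1) tB BB False
        by (simp add: sdefs)
    qed
    ultimately show ?case by auto
  qed
  moreover have "k - 1 < k" "1 \<le> Q" "Q \<le> 2 * T + 1" using k2 Q by auto
  ultimately have "\<alpha> (Tp T (k - 1) Q (tape (?C T) (k - 1) (int Q - int Q)))"
    by blast
  \<comment> \<open>A rejecting run would write symbol 1 here, and the induction would make this
    fact true.\<close>
  moreover have "\<not> \<alpha> (Tp T (k - 1) Q 1)"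
    using cl[of 14 0 0 0 0 0] BB by (simp add: sdefs)
  ultimately have "tape (?C T) (k - 1) 0 \<noteq> 1" by auto
  then have "R x y" using final_tape[OF leny] by (auto simp: T_def split: if_splits)
  then show ?thesis using L leny by (auto simp: ylen_def in_len_def)
qed

section \<open>Expressibility of the clauses\<close>

lemma expressible_params:
  "expressible (\<lambda>xs \<epsilon>. time xs)" "expressible (\<lambda>xs \<epsilon>. ylen xs)" "expressible (\<lambda>xs \<epsilon>. origin xs)"
  unfolding time_def origin_def ylen_def by (intro expressible_intros expressible_poly)+

lemma expressible_tab2:
  assumes "expressible f" "expressible g"
  shows "expressible (\<lambda>xs \<epsilon>. tab2 h (f xs \<epsilon>) (g xs \<epsilon>))"
  unfolding tab2_def
  by (rule expressible_table[where F = "\<lambda>z. h (fst (prod_decode z)) (snd (prod_decode z))"])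
    (intro expressible_prod_encode assms)

lemma expressible_clause:
  assumes "expressible K" "expressible t" "expressible i" "expressible p" "expressible u" "expressible s"
  shows "expressible3 (\<lambda>xs \<epsilon>. clause xs (K xs \<epsilon>) (t xs \<epsilon>) (i xs \<epsilon>) (p xs \<epsilon>) (u xs \<epsilon>) (s xs \<epsilon>))"
proof -
  have tab: "expressible (\<lambda>xs \<epsilon>. state_tab (p xs \<epsilon>))"
    unfolding state_tab_def by (rule expressible_table[OF assms(4)])
  show ?thesis
    unfolding clause_def pos_def neg_def Tp_def Hd_def Sc_def Tr_def atom_def tape0_def
    by (intro expressible3_if expressible3_triple expressible_intros expressible_tab2 tab
        expressible_params assms)
qed

lemma reducible: "L \<le>\<^sub>p CUBIC_SIGMA_2"
proof -
  have c: "expressible3 (\<lambda>xs \<epsilon>. clause_of xs (\<epsilon> 0))"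
    unfolding clause_of_def by (intro expressible_clause expressible_intros)
  have bnd: "expressible (\<lambda>xs \<epsilon>. bound xs)"
    unfolding bound_def by (intro expressible_intros expressible_params)
  show ?thesis
  proof (rule cnf_reducible[where M = num_clauses and ?l1.0 = "\<lambda>xs c. fst (clause_of xs c)"
      and ?l2.0 = "\<lambda>xs c. fst (snd (clause_of xs c))" and ?l3.0 = "\<lambda>xs c. snd (snd (clause_of xs c))"])
    show "expressible (\<lambda>xs \<epsilon>. num_clauses xs)"
      unfolding num_clauses_def six_def by (intro expressible_intros bnd)
    show "\<exists>\<alpha>. \<forall>c. lit_true \<alpha> (fst (clause_of [x] c)) \<or> lit_true \<alpha> (fst (snd (clause_of [x] c))) \<or>
        lit_true \<alpha> (snd (snd (clause_of [x] c)))" if xL: "x \<in> L" for x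
    proof -
      obtain y where y: "length y \<le> ylen [x]" "R x y" using xL unfolding L by (auto simp: ylen_def in_len_def)
      have "sat3 (truth x y) (clause_of [x] c)" for c
        unfolding clause_of_def by (rule clause_complete[OF y])
      then show ?thesis by (auto simp: sat3_def split_beta)
    qed
    show "x \<in> L" if "\<forall>c<num_clauses [x]. lit_true \<alpha> (fst (clause_of [x] c)) \<or>
        lit_true \<alpha> (fst (snd (clause_of [x] c))) \<or> lit_true \<alpha> (snd (snd (clause_of [x] c)))" for x \<alpha>
      by (rule clause_sound[of _ \<alpha>]) (use that in \<open>auto simp: sat3_def split_beta\<close>)
  qed (use c in \<open>auto simp: expressible3_def\<close>)
qed

end

lemma NP_reducible: "L \<in> NP \<Longrightarrow> L \<le>\<^sub>p CUBIC_SIGMA_2"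
proof -
  assume "L \<in> NP"
  then obtain R py where R: "polytime_relation R" and L: "\<And>x. x \<in> L \<longleftrightarrow> (\<exists>y. length y \<le> poly py (length x) \<and> R x y)"
    by (auto simp: NP_def)
  then obtain M pt where "wf_tm M" "2 \<le> num_tapes M"
    "\<And>x y. outputs_within M [x, y] (poly pt (length x + length y)) [R x y]"
    by (auto simp: polytime_relation_def)
  with L interpret np_verifier M R pt py L by unfold_locales
  show ?thesis by (rule reducible)
qed

section \<open>Membership in NP\<close>

lemma row_index_less: "i < n \<Longrightarrow> j < n \<Longrightarrow> i * n + j < n * n" for i j n :: nat
proof -
  assume i: "i < n" and j: "j < n"
  have "i * n + j < Suc i * n" using j by simp
  also have "\<dots> \<le> n * n" using i by (intro mult_le_mono1) simp
  finally show ?thesis .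
qed

lemma adj_matrix_eq_map: "adj_matrix n E = map (\<lambda>k. {k div n, k mod n} \<in> E) [0..<n * n]"
  unfolding adj_matrix_def by (rule concat_rows_eq_map)

lemma adj_matrix_nth: "i < n \<Longrightarrow> j < n \<Longrightarrow> adj_matrix n E ! (i * n + j) \<longleftrightarrow> {i, j} \<in> E"
  using row_index_less[of i n j] by (simp add: adj_matrix_eq_map)

lemma card_nbhd_filter:
  fixes n :: nat
  shows "card {w \<in> nbhd {..<n} E i. P w} = (\<Sum>k<n. of_bool ({i, k} \<in> E \<and> P k))"
proof -
  have "{w \<in> nbhd {..<n} E i. P w} = {..<n} \<inter> {k. {i, k} \<in> E \<and> P k}" by (auto simp: nbhd_def)
  then show ?thesis by simp
qed

lemma card_nbhd: "card (nbhd {..<n} E i) = (\<Sum>k<n. of_bool ({i, k} \<in> E))" for n :: nat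
  using card_nbhd_filter[of n E i "\<lambda>_. True"] by simp

text \<open>Symmetry is tested because an arbitrary bit string of square length, read as a matrix,
  may fail to be symmetric.\<close>

definition graph_check :: "nat \<Rightarrow> (nat \<Rightarrow> nat \<Rightarrow> bool) \<Rightarrow> (nat \<Rightarrow> bool) \<Rightarrow> bool" where
  "graph_check n adj \<beta> \<longleftrightarrow> (\<forall>i<n. \<not> adj i i \<and> (\<Sum>k<n. of_bool (adj i k)) = (3::nat) \<and>
     (\<forall>j<n. adj i j \<longrightarrow> adj j i \<and>
        (\<Sum>k<n. of_bool (adj i k \<and> \<beta> k)) \<noteq> (\<Sum>k<n. of_bool (adj j k \<and> \<beta> k) :: nat)))"

lemma graph_check_cong:
  assumes "\<And>i j. i < n \<Longrightarrow> j < n \<Longrightarrow> adj i j = adj' i j" "\<And>i. i < n \<Longrightarrow> \<beta> i = \<beta>' i"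
  shows "graph_check n adj \<beta> = graph_check n adj' \<beta>'"
proof -
  have "(\<Sum>k<n. of_bool (adj i k)) = (\<Sum>k<n. of_bool (adj' i k) :: nat)"
    "(\<Sum>k<n. of_bool (adj i k \<and> \<beta> k)) = (\<Sum>k<n. of_bool (adj' i k \<and> \<beta>' k) :: nat)" if "i < n" for i
    using assms that by (auto intro!: sum.cong simp del: sum_of_bool_eq)
  then show ?thesis unfolding graph_check_def using assms(1) by (auto simp del: sum_of_bool_eq)
qed

text \<open>The check only sees sets of the form \<open>{i, j}\<close>. Larger sets and the empty
  set are invisible to it, which the condition on the members of \<open>E\<close> makes up
  for.\<close>

lemma graph_check_edges:
  fixes n :: nat
  assumes n: "0 < n" and sub: "\<And>e. e \<in> E \<Longrightarrow> e \<subseteq> {..<n}"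
  shows "(\<exists>\<beta>. graph_check n (\<lambda>i j. {i, j} \<in> E) \<beta>) \<and> (\<forall>e\<in>E. card e \<le> 2 \<and> e \<noteq> {}) \<longleftrightarrow>
    regular_graph 3 {..<n} E \<and> sigma_chromatic_number {..<n} E = 2"
proof -
  have sg: "simple_graph {..<n} E \<longleftrightarrow> (\<forall>i<n. {i, i} \<notin> E) \<and> (\<forall>e\<in>E. card e \<le> 2 \<and> e \<noteq> {})"
  proof safe
    assume *: "\<forall>i<n. {i, i} \<notin> E" "\<forall>e\<in>E. card e \<le> 2 \<and> e \<noteq> {}"
    have "card e = 2" if e: "e \<in> E" for e
    proof -
      have fin: "finite e" using sub[OF e] finite_subset by blast
      have "card e \<noteq> 0" using fin * e by auto
      moreover have "card e \<noteq> 1"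
      proof
        assume "card e = 1"
        then obtain i where i: "e = {i}" by (auto simp: card_1_singleton_iff)
        then show False using * e sub[OF e] by auto
      qed
      moreover have "card e \<le> 2" using * e by auto
      ultimately show ?thesis by linarith
    qed
    then show "simple_graph {..<n} E" using sub by (simp add: simple_graph_def)
  qed (auto simp: simple_graph_def)
  have reg: "regular_graph 3 {..<n} E \<longleftrightarrow> (\<forall>i<n. {i, i} \<notin> E) \<and> (\<forall>e\<in>E. card e \<le> 2 \<and> e \<noteq> {}) \<and>
      (\<forall>i<n. (\<Sum>k<n. of_bool ({i, k} \<in> E)) = (3::nat))"
    unfolding regular_graph_def sg by (auto simp: card_nbhd simp del: sum_of_bool_eq)
  have sig: "sigma_chromatic_number {..<n} E = 2 \<longleftrightarrow> (\<exists>\<beta>. \<forall>i<n. \<forall>j<n. {i, j} \<in> E \<longrightarrow>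
      (\<Sum>k<n. of_bool ({i, k} \<in> E \<and> \<beta> k)) \<noteq> (\<Sum>k<n. of_bool ({j, k} \<in> E \<and> \<beta> k) :: nat))"
    if "regular_graph 3 {..<n} E"
  proof -
    have ne: "{..<n} \<noteq> {}" using n by auto
    show ?thesis unfolding cubic_sigma_2_iff[OF that ne] card_nbhd_filter Ball_def lessThan_iff ..
  qed
  have chk: "graph_check n (\<lambda>i j. {i, j} \<in> E) \<beta> \<longleftrightarrow> (\<forall>i<n. {i, i} \<notin> E) \<and>
      (\<forall>i<n. (\<Sum>k<n. of_bool ({i, k} \<in> E)) = (3::nat)) \<and> (\<forall>i<n. \<forall>j<n. {i, j} \<in> E \<longrightarrow>
      (\<Sum>k<n. of_bool ({i, k} \<in> E \<and> \<beta> k)) \<noteq> (\<Sum>k<n. of_bool ({j, k} \<in> E \<and> \<beta> k) :: nat))" for \<beta>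
  proof -
    have "({i, j} \<in> E \<longrightarrow> {j, i} \<in> E \<and> Z) = ({i, j} \<in> E \<longrightarrow> Z)" for i j Z
      by (simp add: insert_commute)
    then show ?thesis unfolding graph_check_def by blast
  qed
  show ?thesis
    unfolding chk using reg sig by blast
qed

text \<open>The number of vertices is found by searching for the square root of the input length;
  the certificate has one label bit per vertex. The condition \<open>0 < n\<close> rejects the empty
  graph, which would pass the check although its sigma chromatic number is 0.\<close>

definition verifier :: "bool list \<Rightarrow> bool list \<Rightarrow> bool" where
  "verifier x y \<longleftrightarrow> (\<exists>n<Suc (length x). 0 < n \<and> n * n = length x \<and>
     graph_check n (\<lambda>i j. in_bit [x, y] 0 (i * n + j)) (\<lambda>k. in_bit [x, y] 1 k))"

lemma polytime_verifier: "polytime_relation verifier"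
proof (rule polytime_relationI)
  \<comment> \<open>Variables 0 to 3 play the roles of \<open>n\<close>, \<open>i\<close>,
    \<open>j\<close> and \<open>k\<close>.\<close>
  let ?adj = "\<lambda>v w (xs :: bool list list) (\<epsilon> :: nat \<Rightarrow> nat). in_bit xs 0 (\<epsilon> v * \<epsilon> 0 + \<epsilon> w)"
  let ?deg = "\<lambda>xs \<epsilon>. \<Sum>k<\<epsilon> 0. (\<lambda>xs \<epsilon>. of_bool (?adj 1 3 xs \<epsilon>)) xs (\<epsilon>(3 := k)) :: nat"
  let ?cnt = "\<lambda>v xs \<epsilon>. \<Sum>k<\<epsilon> 0. (\<lambda>xs \<epsilon>. of_bool (?adj v 3 xs \<epsilon> \<and> in_bit xs 1 (\<epsilon> 3))) xs (\<epsilon>(3 := k)) :: nat"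
  let ?inner = "\<lambda>xs \<epsilon>. ?adj 1 2 xs \<epsilon> \<longrightarrow> ?adj 2 1 xs \<epsilon> \<and> \<not> ?cnt 1 xs \<epsilon> = ?cnt 2 xs \<epsilon>"
  let ?mid = "\<lambda>xs \<epsilon>. \<not> ?adj 1 1 xs \<epsilon> \<and> ?deg xs \<epsilon> = 3 \<and> (\<forall>j<\<epsilon> 0. ?inner xs (\<epsilon>(2 := j)))"
  let ?outer = "\<lambda>xs \<epsilon>. 0 < \<epsilon> 0 \<and> \<epsilon> 0 * \<epsilon> 0 = in_len xs 0 \<and> (\<forall>i<\<epsilon> 0. ?mid xs (\<epsilon>(1 := i)))"
  let ?B = "\<lambda>xs \<epsilon>. \<exists>n<Suc (in_len xs 0). ?outer xs (\<epsilon>(0 := n))"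
  have cnt: "expressible (?cnt v)" for v
    by (rule expressible_sum) (intro expressible_intros)+
  have deg: "expressible ?deg"
    by (rule expressible_sum) (intro expressible_intros)+
  have inner: "decidable ?inner"
    by (intro expressible_intros cnt)
  have mid: "decidable ?mid"
    by (intro decidable_conj decidable_all[OF _ inner] expressible_intros deg)
  have outer: "decidable ?outer"
    by (intro decidable_conj decidable_all[OF _ mid] expressible_intros)
  show "decidable ?B"
    by (rule decidable_ex[OF _ outer]) (intro expressible_intros)
  show "verifier x y \<longleftrightarrow> ?B [x, y] (\<lambda>_. 0)" for x y
    unfolding verifier_def graph_check_def by (simp add: in_len_def del: sum_of_bool_eq)
qed

lemma sigma_chromatic_number_empty: "sigma_chromatic_number {} E = 0"
  unfolding sigma_chromatic_number_def by (rule Least_equality) (auto simp: sigma_coloring_def)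

lemma CUBIC_SIGMA_2_iff_verifier:
  "x \<in> CUBIC_SIGMA_2 \<longleftrightarrow> (\<exists>y. length y \<le> length x \<and> verifier x y)"
proof
  assume "x \<in> CUBIC_SIGMA_2"
  then obtain n E where x: "x = adj_matrix n E" and reg: "regular_graph 3 {..<n} E"
    and sig: "sigma_chromatic_number {..<n} E = 2" by (auto simp: CUBIC_SIGMA_2_def)
  have n: "0 < n" using sig sigma_chromatic_number_empty[of E] by (cases n) auto
  have len: "length x = n * n" by (simp add: x adj_matrix_eq_map)
  have xE: "x ! (i * n + j) \<longleftrightarrow> {i, j} \<in> E" if "i < n" "j < n" for i j
    using that by (simp add: x adj_matrix_nth)
  have "\<And>e. e \<in> E \<Longrightarrow> e \<subseteq> {..<n}" using reg by (auto simp: regular_graph_def simple_graph_def)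
  then obtain \<beta> where \<beta>: "graph_check n (\<lambda>i j. {i, j} \<in> E) \<beta>"
    using graph_check_edges[OF n, of E] reg sig by blast
  define y where "y = map \<beta> [0..<n]"
  have nn: "n < Suc (n * n)" using n by (simp add: less_Suc_eq_le)
  have "graph_check n (\<lambda>i j. in_bit [x, y] 0 (i * n + j)) (\<lambda>k. in_bit [x, y] 1 k)"
    using \<beta>
    by (subst graph_check_cong[of n _ "\<lambda>i j. {i, j} \<in> E" _ \<beta>])
      (simp_all add: in_bit_def len row_index_less xE y_def)
  then have "verifier x y" unfolding verifier_def len using n nn by blast
  then show "\<exists>y. length y \<le> length x \<and> verifier x y" using nn len by (intro exI[of _ y]) (simp only: y_def length_map length_upt, simp)
next
  assume "\<exists>y. length y \<le> length x \<and> verifier x y"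
  then obtain y n where n: "0 < n" and len: "n * n = length x"
    and chk: "graph_check n (\<lambda>i j. in_bit [x, y] 0 (i * n + j)) (\<lambda>k. in_bit [x, y] 1 k)"
    unfolding verifier_def by blast
  \<comment> \<open>The symmetry established by the check makes this reading faithful: an unordered
    pair stands for two matrix entries.\<close>
  define E where "E = {{i, j} | i j. i < n \<and> j < n \<and> x ! (i * n + j)}"
  have bit: "in_bit [x, y] 0 (i * n + j) = x ! (i * n + j)" if "i < n" "j < n" for i j
    using row_index_less[OF that] len by (simp add: in_bit_def)
  have sym: "x ! (j * n + i)" if "x ! (i * n + j)" "i < n" "j < n" for i j
    using chk that bit unfolding graph_check_def by blast
  have E: "{i, j} \<in> E \<longleftrightarrow> x ! (i * n + j)" if "i < n" "j < n" for i j
    unfolding E_def using that sym by (auto simp: doubleton_eq_iff)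
  have "graph_check n (\<lambda>i j. {i, j} \<in> E) (\<lambda>k. in_bit [x, y] 1 k)"
    using chk by (subst graph_check_cong[of n _ "\<lambda>i j. in_bit [x, y] 0 (i * n + j)"]) (auto simp: E bit)
  moreover have "\<forall>e\<in>E. card e \<le> 2 \<and> e \<noteq> {}" by (auto simp: E_def card_insert_if)
  moreover have "e \<subseteq> {..<n}" if "e \<in> E" for e using that by (auto simp: E_def)
  ultimately have "regular_graph 3 {..<n} E" "sigma_chromatic_number {..<n} E = 2"
    using graph_check_edges[OF n, of E] by blast+
  moreover have "adj_matrix n E = x"
  proof (rule nth_equalityI)
    show "length (adj_matrix n E) = length x" by (simp add: adj_matrix_eq_map len)
    fix k assume "k < length (adj_matrix n E)"
    then have k: "k < n * n" by (simp add: adj_matrix_eq_map)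
    then have "k div n < n" "k mod n < n" using n by (simp_all add: less_mult_imp_div_less)
    then show "adj_matrix n E ! k = x ! k" using adj_matrix_nth[of "k div n" n "k mod n" E] E by simp
  qed
  ultimately show "x \<in> CUBIC_SIGMA_2" unfolding CUBIC_SIGMA_2_def by blast
qed

lemma CUBIC_SIGMA_2_in_NP: "CUBIC_SIGMA_2 \<in> NP"
  unfolding NP_def
  by (intro CollectI exI[of _ verifier] exI[of _ "[:0, 1:]"] conjI polytime_verifier allI)
    (simp add: CUBIC_SIGMA_2_iff_verifier)

theorem theorem1: "NP_complete CUBIC_SIGMA_2"
  unfolding NP_complete_def using CUBIC_SIGMA_2_in_NP NP_reducible by blast

end
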